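(* Let $f:\mathbb{R}^n\to(-\infty,+\infty]$ be proper and closed (lower semicontinuous), possibly nonconvex, and let $g:\mathbb{R}^n\to\mathbb{R}$ be convex and differentiable with $L_g$-Lipschitz gradient. Let $\alpha>0$ and $\beta>(2\sqrt2+1)L_g$, and let $(x^k,y^k,\gamma^k)_{k\ge 0}$ be generated by $$x^{k+1}\in\mathbf{prox}_{\frac{f}{\alpha+\beta}}\Big(\frac{\alpha}{\alpha+\beta}x^k-\frac{\beta}{\alpha+\beta}y^k-\frac{\gamma^k}{\alpha+\beta}+e_1^{k+1}\Big),$$ $$y^{k+1}=\mathbf{prox}_{\frac{g}{\beta}}\Big(-x^{k+1}-\frac{\gamma^k}{\beta}+e_2^{k+1}\Big),\qquad \gamma^{k+1}=\gamma^k+\beta(x^{k+1}+y^{k+1}),$$ with noise vectors $e_1^k,e_2^k\in\mathbb{R}^n$. Assume that there exists $\sigma_0>0$ such that $$\inf_{y}\{g(y)-\sigma_0\|\nabla g(y)\|^2\}>-\infty,$$ that $\beta\ge\frac1{\sigma_0}$, that $(e_2^k)$ is bounded, that $f$ is coercive, and that $f$ and $g$ are both semi-algebraic. If $$\|e_1^k\|+\|e_2^k\|=\mathcal{O}\Big(\frac1{k^{p}}\Big)\quad\text{for some real } p>1,$$ then $(x^k,y^k)_{k\ge0}$ has finite length, i.e. $$\sum_{k=0}^{+\infty}\big(\|x^{k+1}-x^k\|+\|y^{k+1}-y^k\|\big)<+\infty.$$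
   Context: For a closed, possibly nonconvex function $J$, $\mathbf{prox}_J(x)=\arg\min_y\{J(y)+\frac{\|y-x\|^2}{2}\}$ is a set-valued map; $x^{k+1}$ is any element of the set. The scheme is an inexact ADMM for $\min_{x,y}\{f(x)+g(y):x+y=0\}$, with multiplier $\gamma$. A set in $\mathbb{R}^m$ is semi-algebraic if it is a finite union of finite intersections of sets $\{p(u)=0,\ q(u)<0\}$ with $p,q$ real polynomials; a function is semi-algebraic if its graph is. Coercive means $f(x)\to+\infty$ as $\|x\|\to\infty$. *)

theory Defs
  imports "HOL-Analysis.Analysis" "HOL-Library.Landau_Symbols"
begin

definition proper_fun :: "('a \<Rightarrow> ereal) \<Rightarrow> bool" where
  "proper_fun f \<longleftrightarrow> (\<forall>x. f x \<noteq> -\<infinity>) \<and> (\<exists>x. f x \<noteq> \<infinity>)"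

definition lower_semicontinuous :: "('a::topological_space \<Rightarrow> ereal) \<Rightarrow> bool" where
  "lower_semicontinuous f \<longleftrightarrow> (\<forall>x. f x \<le> Liminf (nhds x) f)"

definition coercive :: "('a::real_normed_vector \<Rightarrow> ereal) \<Rightarrow> bool" where
  "coercive f \<longleftrightarrow> (f \<longlongrightarrow> \<infinity>) at_infinity"

text \<open>The set of all minimizers, without any claim of existence or uniqueness.\<close>

definition prox :: "('a::real_normed_vector \<Rightarrow> ereal) \<Rightarrow> 'a \<Rightarrow> 'a set" where
  "prox J x = {y. is_arg_min (\<lambda>y. J y + ereal ((norm (y - x))\<^sup>2 / 2)) (\<lambda>_. True) y}"

text \<open>
  A finite union of finite intersections is indexed by a finite family of finite sets of
  pairs \<open>(p, q)\<close>. On a Euclidean space, \<^const>\<open>real_polynomial_function\<close> describes exactly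
  the functions that are real polynomials in the coordinates.
\<close>

definition semialgebraic_set :: "'a::euclidean_space set \<Rightarrow> bool" where
  "semialgebraic_set S \<longleftrightarrow>
     (\<exists>F. finite F \<and>
          (\<forall>C\<in>F. finite C \<and>
             (\<forall>(p, q)\<in>C. real_polynomial_function p \<and> real_polynomial_function q)) \<and>
          S = (\<Union>C\<in>F. \<Inter>(p, q)\<in>C. {u. p u = 0 \<and> q u < 0}))"

text \<open>
  The graph lives in \<open>'a \<times> \<real>\<close>, so points where \<open>h\<close> takes the value \<open>\<infinity>\<close> do not contribute.
\<close>

definition semialgebraic_fun :: "('a::euclidean_space \<Rightarrow> ereal) \<Rightarrow> bool" where
  "semialgebraic_fun h \<longleftrightarrow> semialgebraic_set {(x, t). h x = ereal t}"

end

theory Submission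
  imports Defs
begin

text \<open>
  The iterates are controlled by the augmented Lagrangian
  \<open>F = f x + g y + \<gamma> \<bullet> (x + y) + \<beta> / 2 * (norm (x + y))\<^sup>2\<close>. Optimality in the second proximal step says that the
  multiplier is minus the gradient of \<open>g\<close> at \<open>y\<close>, up to noise. So the increase of \<open>F\<close> in the multiplier step is
  dominated by the decrease in the other two, and \<open>F\<close> decreases by a multiple of the squared step length, up to the
  squared noise (\<open>admm_descent\<close>). The hypotheses on \<open>g\<close> and coercivity of \<open>f\<close> make \<open>F\<close> bounded below along the iterates and
  the iterates bounded. Finally, the optimality conditions provide at every iterate a proximal subgradient of \<open>F\<close>
  that is bounded by step length and noise (\<open>admm_slope\<close>).

  Descent alone gives square summable steps. Summability comes from the Kurdyka--Lojasiewicz inequality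
  \<open>c * (F - l) powr \<theta> \<le> norm V\<close> with \<open>\<theta> < 1\<close> for subgradients \<open>V\<close> above the limiting level \<open>l\<close>
  (\<open>definable_Kurdyka_Lojasiewicz\<close>). Along the iterates it turns the decrease of \<open>F\<close> into a
  telescoping bound for the step lengths (\<open>summable_of_descent_and_KL\<close>). Noise of order \<open>k powr - p\<close> with \<open>p > 1\<close> leaves a tail of squares
  of order \<open>k powr (1 - 2 * p)\<close>, and powers of this tail with exponents close to \<open>1\<close> are summable.

  The proof of the inequality for semialgebraic functions has three stages. First,
  semialgebraic sets are closed under projection (\<open>definable_ex_set\<close>), by the method of Cohen and Hormander: if the
  coefficients of a suitable finite family of polynomials have the same signs at two parameters, then the sign
  patterns of the two families along the line correspond to each other. Second, a bounded semialgebraic function \<open>h\<close> of one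
  variable satisfies a polynomial equation, so it approaches its limit at \<open>0\<close> at least as fast as a root \<open>root m s\<close>, and
  its difference quotients are bounded by a multiple of \<open>root m s / s\<close>
  (\<open>definable_left_quotient_bound\<close>). Third, this is applied to a semialgebraic curve that selects at each level a
  point with least subgradient: moving along such a curve at unit speed in the function value, the product of
  slope and velocity is at least \<open>1\<close>, so the slope is at least of order \<open>s / root m s\<close>.
\<close>

section \<open>Families of functions with matching sign patterns\<close>

definition sgn_const :: "'i set \<Rightarrow> ('i \<Rightarrow> real \<Rightarrow> real) \<Rightarrow> real set \<Rightarrow> bool" where
  "sgn_const J F I \<longleftrightarrow> (\<forall>j\<in>J. \<forall>r\<in>I. \<forall>s\<in>I. sgn (F j r) = sgn (F j s))"

text \<open>
  A member that vanishes identically has no cell boundaries, so its zeros do not count.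
\<close>

definition mark :: "'i set \<Rightarrow> ('i \<Rightarrow> real \<Rightarrow> real) \<Rightarrow> real \<Rightarrow> bool" where
  "mark J F z \<longleftrightarrow> (\<exists>j\<in>J. F j z = 0 \<and> (\<exists>r. F j r \<noteq> 0))"

definition tame :: "'i set \<Rightarrow> ('i \<Rightarrow> real \<Rightarrow> real) \<Rightarrow> bool" where
  "tame J F \<longleftrightarrow> finite J \<and> (\<forall>j\<in>J. continuous_on UNIV (F j) \<and> ((\<exists>r. F j r \<noteq> 0) \<longrightarrow> finite {r. F j r = 0}))"

text \<open>
  Cut the line into the finitely many maximal cells on which all members of \<open>F\<close> have constant
  sign, and likewise for \<open>H\<close>. A matching is an order isomorphism between the two cell
  decompositions, written as a relation between points so that cells need not be named: the fourth clause
  says that only points of one cell can be related in the wrong order, and the last two (saturation)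
  that whole cells are related to whole cells.
\<close>

definition matching ::
  "'i set \<Rightarrow> ('i \<Rightarrow> real \<Rightarrow> real) \<Rightarrow> ('i \<Rightarrow> real \<Rightarrow> real) \<Rightarrow> (real \<Rightarrow> real \<Rightarrow> bool) \<Rightarrow> bool" where
  "matching J F H R \<longleftrightarrow>
     (\<forall>t. \<exists>t'. R t t') \<and> (\<forall>t'. \<exists>t. R t t') \<and>
     (\<forall>t t'. R t t' \<longrightarrow> (\<forall>j\<in>J. sgn (F j t) = sgn (H j t'))) \<and>
     (\<forall>t t' s s'. R t t' \<and> R s s' \<and> t \<le> s \<and> s' \<le> t' \<longrightarrow> sgn_const J F {t..s} \<and> sgn_const J H {s'..t'}) \<and>
     (\<forall>t t' s'. R t t' \<and> (s' \<le> t' \<and> sgn_const J H {s'..t'} \<or> t' \<le> s' \<and> sgn_const J H {t'..s'}) \<longrightarrow> R t s') \<and>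
     (\<forall>t t' s. R t t' \<and> (s \<le> t \<and> sgn_const J F {s..t} \<or> t \<le> s \<and> sgn_const J F {t..s}) \<longrightarrow> R s t')"

lemma matchingD:
  assumes "matching J F H R"
  shows matching_total: "\<And>t. \<exists>t'. R t t'"
    and matching_surj: "\<And>t'. \<exists>t. R t t'"
    and matching_sgn: "\<And>t t' j. R t t' \<Longrightarrow> j \<in> J \<Longrightarrow> sgn (F j t) = sgn (H j t')"
    and matching_order: "\<And>t t' s s'. R t t' \<Longrightarrow> R s s' \<Longrightarrow> t \<le> s \<Longrightarrow> s' \<le> t' \<Longrightarrow>
           sgn_const J F {t..s} \<and> sgn_const J H {s'..t'}"
    and matching_sat: "\<And>t t' s'. R t t' \<Longrightarrow> s' \<le> t' \<and> sgn_const J H {s'..t'} \<or> t' \<le> s' \<and> sgn_const J H {t'..s'} \<Longrightarrow>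
        R t s'"
    and matching_sat2: "\<And>t t' s. R t t' \<Longrightarrow> s \<le> t \<and> sgn_const J F {s..t} \<or> t \<le> s \<and> sgn_const J F {t..s} \<Longrightarrow> R s t'"
  using assms[unfolded matching_def, THEN conjunct1]
    assms[unfolded matching_def, THEN conjunct2, THEN conjunct1]
    assms[unfolded matching_def, THEN conjunct2, THEN conjunct2, THEN conjunct1]
    assms[unfolded matching_def, THEN conjunct2, THEN conjunct2, THEN conjunct2, THEN conjunct1, rule_format, OF conjI, OF _ conjI, OF _ _ conjI]
    assms[unfolded matching_def, THEN conjunct2, THEN conjunct2, THEN conjunct2, THEN conjunct2, THEN conjunct1, rule_format, OF conjI]
    assms[unfolded matching_def, THEN conjunct2, THEN conjunct2, THEN conjunct2, THEN conjunct2, THEN conjunct2, rule_format, OF conjI]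
  by - (assumption | (drule spec, assumption) | (rule bspec, drule spec, drule spec, erule (1) mp, assumption))+

lemma sgn_const_mono: "sgn_const J F I \<Longrightarrow> I' \<subseteq> I \<Longrightarrow> sgn_const J F I'"
  unfolding sgn_const_def by blast

lemma sgn_constD: "sgn_const J F I \<Longrightarrow> j \<in> J \<Longrightarrow> r \<in> I \<Longrightarrow> s \<in> I \<Longrightarrow> sgn (F j r) = sgn (F j s)"
  unfolding sgn_const_def by blast

lemma sgn_const_singletonI: "(\<And>r. r \<in> I \<Longrightarrow> sgn (F j r) = c) \<Longrightarrow> sgn_const {j} F I"
  unfolding sgn_const_def by simp

lemma sgn_const_insert: "sgn_const (insert j J) F I \<longleftrightarrow> sgn_const {j} F I \<and> sgn_const J F I"
  unfolding sgn_const_def by blast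

text \<open>
  A further function only subdivides cells, so the refined matching is the old one restricted
  to pairs where the new signs agree; saturation is inherited automatically.
\<close>

lemma matching_insert:
  assumes m: "matching J F H R"
    and tot: "\<And>t. \<exists>t'. R t t' \<and> sgn (F j t) = sgn (H j t')"
    and surj: "\<And>t'. \<exists>t. R t t' \<and> sgn (F j t) = sgn (H j t')"
    and ord: "\<And>t t' s s'. R t t' \<Longrightarrow> R s s' \<Longrightarrow> t \<le> s \<Longrightarrow> s' \<le> t' \<Longrightarrow> sgn (F j t) = sgn (H j t') \<Longrightarrow>
       sgn (F j s) = sgn (H j s') \<Longrightarrow> sgn_const J F {t..s} \<Longrightarrow> sgn_const J H {s'..t'} \<Longrightarrow>
       sgn_const {j} F {t..s} \<and> sgn_const {j} H {s'..t'}"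
  shows "matching (insert j J) F H (\<lambda>t t'. R t t' \<and> sgn (F j t) = sgn (H j t'))"
proof -
  have sat: "sgn (H j t') = sgn (H j s')"
    if "s' \<le> t' \<and> sgn_const (insert j J) H {s'..t'} \<or> t' \<le> s' \<and> sgn_const (insert j J) H {t'..s'}" for t' s'
    using that unfolding sgn_const_def by auto
  have sat2: "sgn (F j t') = sgn (F j s')"
    if "s' \<le> t' \<and> sgn_const (insert j J) F {s'..t'} \<or> t' \<le> s' \<and> sgn_const (insert j J) F {t'..s'}" for t' s'
    using that unfolding sgn_const_def by auto
  show ?thesis unfolding matching_def
  proof (intro conjI allI impI)
    fix t show "\<exists>t'. R t t' \<and> sgn (F j t) = sgn (H j t')" by (rule tot)
  next
    fix t' show "\<exists>t. R t t' \<and> sgn (F j t) = sgn (H j t')" by (rule surj)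
  next
    fix t t' assume "R t t' \<and> sgn (F j t) = sgn (H j t')"
    then show "\<forall>j\<in>insert j J. sgn (F j t) = sgn (H j t')" using matching_sgn[OF m] by blast
  next
    fix t t' s s' assume a: "(R t t' \<and> sgn (F j t) = sgn (H j t')) \<and> (R s s' \<and> sgn (F j s) = sgn (H j s')) \<and>
        t \<le> s \<and> s' \<le> t'"
    then show "sgn_const (insert j J) F {t..s}" "sgn_const (insert j J) H {s'..t'}"
      using ord[of t t' s s'] matching_order[OF m, of t t' s s'] by (simp_all add: sgn_const_insert[of j J])
  next
    fix t t' s'
    assume a: "(R t t' \<and> sgn (F j t) = sgn (H j t')) \<and>
       (s' \<le> t' \<and> sgn_const (insert j J) H {s'..t'} \<or> t' \<le> s' \<and> sgn_const (insert j J) H {t'..s'})"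
    then show "R t s'" using matching_sat[OF m, of t t' s'] by (auto simp add: sgn_const_insert[of j J])
    from a show "sgn (F j t) = sgn (H j s')" using sat by auto
  next
    fix t t' s
    assume a: "(R t t' \<and> sgn (F j t) = sgn (H j t')) \<and>
       (s \<le> t \<and> sgn_const (insert j J) F {s..t} \<or> t \<le> s \<and> sgn_const (insert j J) F {t..s})"
    then show "R s t'" using matching_sat2[OF m, of t t' s] by (auto simp add: sgn_const_insert[of j J])
    from a show "sgn (F j s) = sgn (H j t')" using sat2[of s t] by auto
  qed
qed

lemma sgn_eq_if_no_zero:
  fixes f :: "real \<Rightarrow> real"
  assumes c: "continuous_on {a..b} f" and ab: "a \<le> b" and nz: "\<And>z. z \<in> {a..b} \<Longrightarrow> f z \<noteq> 0"
  shows "sgn (f a) = sgn (f b)"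
proof (rule ccontr)
  assume "sgn (f a) \<noteq> sgn (f b)"
  then have "f a < 0 \<and> 0 < f b \<or> f b < 0 \<and> 0 < f a"
    using nz[of a] nz[of b] ab by (auto simp: sgn_if split: if_splits)
  then show False
    using IVT'[of f a 0 b] IVT2'[of f b 0 a] c ab nz by (metis atLeastAtMost_iff less_eq_real_def)
qed

lemma sgn_const_if_no_mark:
  assumes tm: "tame J F" and nm: "\<And>z. z \<in> {a..b} \<Longrightarrow> \<not> mark J F z"
  shows "sgn_const J F {a..b}"
  unfolding sgn_const_def
proof (intro ballI)
  fix j r s assume j: "j \<in> J" and r: "r \<in> {a..b}" and s: "s \<in> {a..b}"
  have c: "continuous_on X (F j)" for X
    using tm j continuous_on_subset unfolding tame_def by (metis subset_UNIV)
  show "sgn (F j r) = sgn (F j s)"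
  proof (cases "\<exists>r. F j r \<noteq> 0")
    case True
    have nz: "F j z \<noteq> 0" if "z \<in> {a..b}" for z using nm[OF that] j True unfolding mark_def by blast
    show ?thesis
    proof (cases "r \<le> s")
      case True
      show ?thesis by (rule sgn_eq_if_no_zero[OF c True]) (use nz r s in auto)
    next
      case False
      then have "s \<le> r" by simp
      then show ?thesis using sgn_eq_if_no_zero[OF c, of s r] nz r s by auto
    qed
  qed auto
qed

lemma finite_marks: "tame J F \<Longrightarrow> finite {z. mark J F z}"
proof -
  assume t: "tame J F"
  have "{z. mark J F z} \<subseteq> (\<Union>j\<in>{j\<in>J. \<exists>r. F j r \<noteq> 0}. {r. F j r = 0})" unfolding mark_def by auto
  moreover have "finite \<dots>" using t unfolding tame_def by auto
  ultimately show ?thesis by (rule finite_subset)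
qed

text \<open>
  The situation in which \<open>p\<close> is to be added to \<open>F\<close> and \<open>q\<close> to \<open>H\<close>. Inside a cell, the signs of a
  monotone function are determined by its signs at the two ends of the cell, and an end is either a marked
  point or infinity; these are the places where \<open>p\<close> and \<open>q\<close> are required to agree.
\<close>

definition extension_setup where
  "extension_setup J F H R p q \<longleftrightarrow> matching J F H R \<and> tame J F \<and> tame J H \<and>
     (\<forall>j\<in>J. (\<forall>r. F j r = 0) \<longleftrightarrow> (\<forall>r. H j r = 0)) \<and>
     (\<forall>z z'. R z z' \<longrightarrow> mark J F z \<longrightarrow> sgn (p z) = sgn (q z')) \<and>
     continuous_on UNIV (p :: real \<Rightarrow> real) \<and> continuous_on UNIV (q :: real \<Rightarrow> real) \<and>
     (\<exists>M. \<forall>s\<ge>M. \<forall>s'\<ge>M. sgn (p s) = sgn (q s')) \<and>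
     (\<exists>M. \<forall>s\<le>M. \<forall>s'\<le>M. sgn (p s) = sgn (q s'))"

lemma mark_iff:
  assumes "matching J F H R" "\<forall>j\<in>J. (\<forall>r. F j r = 0) \<longleftrightarrow> (\<forall>r. H j r = 0)" "R z z'"
  shows "mark J F z \<longleftrightarrow> mark J H z'"
  using assms(2) matching_sgn[OF assms(1,3)] unfolding mark_def by (metis sgn_zero_iff)

lemma matching_swap: "matching J F H R \<Longrightarrow> matching J H F (\<lambda>t t'. R t' t)"
  unfolding matching_def by (intro conjI; (elim conjE); (metis | blast))

lemma extension_setup_swap:
  assumes "extension_setup J F H R p q" shows "extension_setup J H F (\<lambda>t t'. R t' t) q p"
proof -
  note a = assms[unfolded extension_setup_def]
  have z: "\<forall>j\<in>J. (\<forall>r. F j r = 0) \<longleftrightarrow> (\<forall>r. H j r = 0)" and m: "matching J F H R" using a by auto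
  have mk: "\<forall>z z'. R z' z \<longrightarrow> mark J H z \<longrightarrow> sgn (q z) = sgn (p z')"
    using a mark_iff[OF m z] by metis
  have inf: "\<exists>M. \<forall>s\<ge>M. \<forall>s'\<ge>M. sgn (q s) = sgn (p s')" "\<exists>M. \<forall>s\<le>M. \<forall>s'\<le>M. sgn (q s) = sgn (p s')"
    using a by metis+
  show ?thesis unfolding extension_setup_def
    using a by (intro conjI matching_swap[OF m] mk inf) auto
qed

lemma sgn_const_reflect: "sgn_const J (\<lambda>j t. F j (- t)) {a..b} \<longleftrightarrow> sgn_const J F {- b..- a}"
proof -
  have e: "{- b..- a} = uminus ` {a..b}" by simp
  show ?thesis unfolding sgn_const_def e by blast
qed

lemma tame_reflect: assumes "tame J F" shows "tame J (\<lambda>j t. F j (- t))"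
proof -
  have "finite {r. F j (- r) = 0}" if "finite {r. F j r = 0}" for j
  proof -
    have "{r. F j (- r) = 0} = uminus ` {r. F j r = 0}" by force
    then show ?thesis using that by simp
  qed
  moreover have "continuous_on UNIV (\<lambda>t. F j (- t))" if "continuous_on UNIV (F j)" for j
    by (rule continuous_on_compose2[OF that]) (auto intro: continuous_intros)
  ultimately show ?thesis using assms unfolding tame_def by (metis)
qed

lemma matching_reflect: 
  assumes "matching J F H R"
  shows "matching J (\<lambda>j t. F j (- t)) (\<lambda>j t. H j (- t)) (\<lambda>t t'. R (- t) (- t'))"
  unfolding matching_def sgn_const_reflect
proof (intro conjI allI impI)
  show "\<exists>t'. R (- t) (- t')" for t using matching_total[OF assms, of "-t"] by (metis minus_minus)
  show "\<exists>t. R (- t) (- t')" for t' using matching_surj[OF assms, of "-t'"] by (metis minus_minus)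
  show "\<forall>j\<in>J. sgn (F j (- t)) = sgn (H j (- t'))" if "R (- t) (- t')" for t t'
    using matching_sgn[OF assms that] by blast
  fix t t' s s' assume a: "R (- t) (- t') \<and> R (- s) (- s') \<and> t \<le> s \<and> s' \<le> t'"
  show "sgn_const J F {- s..- t}" "sgn_const J H {- t'..- s'}" 
    using matching_order[OF assms, of "-s" "-s'" "-t" "-t'"] a by auto
next
  fix t t' s' assume "R (- t) (- t') \<and> (s' \<le> t' \<and> sgn_const J H {- t'..- s'} \<or> t' \<le> s' \<and>
      sgn_const J H {- s'..- t'})"
  then show "R (- t) (- s')" using matching_sat[OF assms, of "-t" "-t'" "-s'"] by auto
next
  fix t t' s assume "R (- t) (- t') \<and> (s \<le> t \<and> sgn_const J F {- t..- s} \<or> t \<le> s \<and> sgn_const J F {- s..- t})"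
  then show "R (- s) (- t')" using matching_sat2[OF assms, of "-t" "-t'" "-s"] by auto
qed

lemma extension_setup_reflect:
  assumes "extension_setup J F H R p q"
  shows "extension_setup J (\<lambda>j t. F j (- t)) (\<lambda>j t. H j (- t)) (\<lambda>t t'. R (- t) (- t')) (\<lambda>t. p (- t)) (\<lambda>t. q (- t))"
proof -
  note a = assms[unfolded extension_setup_def]
  have all: "(\<forall>r. P (- r)) \<longleftrightarrow> (\<forall>r. P r)" for P :: "real \<Rightarrow> bool" by (metis minus_minus)
  then have ex: "(\<exists>r. P (- r)) \<longleftrightarrow> (\<exists>r. P r)" for P :: "real \<Rightarrow> bool" by (metis minus_minus)
  have mk: "mark J (\<lambda>j t. F j (- t)) z \<longleftrightarrow> mark J F (- z)" for z
    unfolding mark_def using ex[of "\<lambda>r. F _ r \<noteq> 0"] by simp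
  have cont: "continuous_on UNIV (\<lambda>t. f (- t))" if "continuous_on UNIV f" for f :: "real \<Rightarrow> real"
    by (rule continuous_on_compose2[OF that]) (auto intro: continuous_intros)
  have inf1: "\<exists>M. \<forall>s\<le>M. \<forall>s'\<le>M. sgn (p (- s)) = sgn (q (- s'))"
    using a by (metis le_minus_iff)
  have inf2: "\<exists>M. \<forall>s\<ge>M. \<forall>s'\<ge>M. sgn (p (- s)) = sgn (q (- s'))"
    using a by (metis minus_le_iff)
  have z: "\<forall>j\<in>J. (\<forall>r. F j (- r) = 0) \<longleftrightarrow> (\<forall>r. H j (- r) = 0)"
    using a all[of "\<lambda>r. F _ r = 0"] all[of "\<lambda>r. H _ r = 0"] by auto
  have m: "matching J F H R" and t: "tame J F" "tame J H" and c: "continuous_on UNIV p" "continuous_on UNIV q"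
    using a by auto
  have mks: "\<forall>z z'. R (- z) (- z') \<longrightarrow> mark J F (- z) \<longrightarrow> sgn (p (- z)) = sgn (q (- z'))"
    using a by blast
  show ?thesis unfolding extension_setup_def mk
    by (intro conjI matching_reflect[OF m] tame_reflect t cont c z mks inf1 inf2)
qed

lemma extension_setup_uminus:
  "extension_setup J F H R p q \<Longrightarrow> extension_setup J F H R (\<lambda>t. - p t) (\<lambda>t. - q t)"
  unfolding extension_setup_def by (auto simp: sgn_minus intro: continuous_intros)

lemma sgn_eqD: "sgn (a :: real) = sgn b \<Longrightarrow> (0 \<le> a \<longleftrightarrow> 0 \<le> b) \<and> (0 < a \<longleftrightarrow> 0 < b)"
  by (auto simp: sgn_if split: if_splits)

text \<open>
  The cell of \<open>t\<close> either ends at a marked point, which the matching carries together with the sign of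
  \<open>p\<close> to an end of the corresponding cell, and continuity of \<open>q\<close> pulls the sign back into that cell; or it
  is unbounded, and then so is the corresponding cell and the sign is found near infinity. The statement
  about left ends follows by reflecting the line.
\<close>

lemma extension_right:
  assumes st: "extension_setup J F H R p q"
    and R: "R t t'" and un: "\<not> mark J F t"
    and pos: "\<And>s. t < s \<Longrightarrow> (\<And>z. t \<le> z \<Longrightarrow> z < s \<Longrightarrow> \<not> mark J F z) \<Longrightarrow> p s > 0"
  shows "\<exists>s'\<ge>t'. sgn_const J H {t'..s'} \<and> q s' > 0"
proof -
  note a = st[unfolded extension_setup_def]
  have m: "matching J F H R" and tF: "tame J F" and tH: "tame J H"
    and z: "\<forall>j\<in>J. (\<forall>r. F j r = 0) \<longleftrightarrow> (\<forall>r. H j r = 0)"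
    and mk: "\<And>z z'. R z z' \<Longrightarrow> mark J F z \<Longrightarrow> sgn (p z) = sgn (q z')"
    and cq: "continuous_on UNIV q"
    and top: "\<exists>M. \<forall>s\<ge>M. \<forall>s'\<ge>M. sgn (p s) = sgn (q s')"
    using a by auto
  have nc: "\<not> sgn_const J F {u..v}" if uv: "u < v" "mark J F u \<or> mark J F v" for u v
  proof
    assume c: "sgn_const J F {u..v}"
    obtain w where w: "mark J F w" "w \<in> {u..v}" using uv by force
    then obtain j where j: "j \<in> J" "F j w = 0" "\<exists>r. F j r \<noteq> 0" unfolding mark_def by blast
    have "F j x = 0" if "x \<in> {u..v}" for x
      using c[unfolded sgn_const_def, rule_format, OF j(1) w(2) that] j(2) by (simp add: sgn_zero_iff)
    then have "{u..v} \<subseteq> {r. F j r = 0}" by auto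
    then have "finite {u..v}" using tF j(1,3) finite_subset unfolding tame_def by blast
    then show False using that by (simp add: infinite_Icc)
  qed
  have right: "t < z" if "R z z'" "mark J F z" "t' \<le> z'" for z z'
  proof (rule ccontr)
    assume "\<not> t < z"
    then have "z < t" using that un by (cases "z = t") auto
    then show False using matching_order[OF m \<open>R z z'\<close> R] nc[of z t] that by auto
  qed
  show ?thesis
  proof (cases "\<exists>z. t < z \<and> mark J F z")
    case True
    \<comment> \<open>The cell of \<open>t\<close> ends at the next marked point \<open>b\<close>.\<close>
    let ?Z = "{z. t < z \<and> mark J F z}"
    define b where "b = Min ?Z"
    have fZ: "finite ?Z" using finite_marks[OF tF] by (rule rev_finite_subset) auto
    have b: "b \<in> ?Z" unfolding b_def using Min_in[OF fZ] True by auto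
    have bmin: "b \<le> z" if "t < z" "mark J F z" for z using fZ that unfolding b_def by auto
    obtain b' where b': "R b b'" using matching_total[OF m] by blast
    have lt: "t' < b'"
    proof (rule ccontr)
      assume "\<not> t' < b'"
      then show False using matching_order[OF m R b'] b nc[of t b] by auto
    qed
    have "p b > 0" 
    proof (rule pos)
      show "t < b" using b by simp
      show "\<not> mark J F z" if "t \<le> z" "z < b" for z using that bmin[of z] un by (cases "z = t") auto
    qed
    then have qb: "q b' > 0" using mk[OF b'] b by (auto simp: sgn_if split: if_splits)
    have nm: "\<not> mark J H z'" if "t' \<le> z'" "z' < b'" for z'
    proof
      assume mz: "mark J H z'"
      obtain z0 where z0: "R z0 z'" using matching_surj[OF m] by blast
      have mz0: "mark J F z0" using mark_iff[OF m z z0] mz by simp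
      then have "b \<le> z0" using right[OF z0] that bmin by auto
      have c: "sgn_const J H {z'..b'}" "sgn_const J F {b..z0}"
        using matching_order[OF m b' z0 \<open>b \<le> z0\<close>] that by auto
      obtain j where j: "j \<in> J" "H j z' = 0" "\<exists>r. H j r \<noteq> 0" using mz unfolding mark_def by auto
      then have "H j x = 0" if "x \<in> {z'..b'}" for x
        using c(1)[unfolded sgn_const_def, rule_format, OF j(1), of z' x] that \<open>z' < b'\<close>
            by (simp add: sgn_zero_iff)
      then have "{z'..b'} \<subseteq> {r. H j r = 0}" by auto
      then have "finite {z'..b'}" using tH j(1,3) finite_subset unfolding tame_def by blast
      then show False using that by (simp add: infinite_Icc)
    qed
    have "isCont q b'" using cq by (simp add: continuous_on_eq_continuous_at)
    then have "eventually (\<lambda>s. q s > 0) (at b')"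
      using qb by (simp add: isCont_def order_tendstoD(1))
    then have "eventually (\<lambda>s. q s > 0) (at_left b')" by (simp add: eventually_at_split)
    moreover have "eventually (\<lambda>s. s \<in> {t'<..<b'}) (at_left b')"
      using eventually_at_left_real[OF lt] .
    ultimately have "eventually (\<lambda>s. q s > 0 \<and> s \<in> {t'<..<b'}) (at_left b')" by eventually_elim simp
    then obtain s' where s': "q s' > 0" "s' \<in> {t'<..<b'}"
      using eventually_happens'[OF trivial_limit_at_left_real] by auto
    then have "sgn_const J H {t'..s'}" by (intro sgn_const_if_no_mark[OF tH] nm) auto
    then show ?thesis using s' by (intro exI[of _ s']) auto
  next
    case False
    then have nmF: "\<not> mark J F z" if "t \<le> z" for z using that un by (cases "z = t") auto
    have nm: "\<not> mark J H z'" if zz: "t' \<le> z'" for z'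
    proof
      assume mz: "mark J H z'"
      obtain z0 where z0: "R z0 z'" using matching_surj[OF m] by blast
      have "mark J F z0" using mark_iff[OF m z z0] mz by simp
      then show False using right[OF z0 _ zz] nmF[of z0] by auto
    qed
    obtain M where M: "\<forall>s\<ge>M. \<forall>s'\<ge>M. sgn (p s) = sgn (q s')" using top by blast
    define s' where "s' = max M t'"
    have "p (max M (t + 1)) > 0" using nmF by (intro pos) auto
    moreover have "sgn (p (max M (t + 1))) = sgn (q s')" unfolding s'_def by (intro M[rule_format]) auto
    ultimately have "q s' > 0" using sgn_eqD by blast
    moreover have "sgn_const J H {t'..s'}" by (intro sgn_const_if_no_mark[OF tH] nm) auto
    ultimately show ?thesis by (intro exI[of _ s']) (auto simp: s'_def)
  qed
qed

text \<open>
  The derivative is a member of the family, so on the cell of an unmarked \<open>t\<close> it has constant nonzero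
  sign and \<open>p\<close> is strictly monotone. If \<open>p t\<close> is positive or negative then so is \<open>p\<close> towards one end of
  the cell, which transfers to \<open>q\<close>; if \<open>p t = 0\<close> then \<open>q\<close> takes both signs in the corresponding cell and the
  intermediate value theorem gives a zero.
\<close>

lemma extension_total:
  assumes st: "extension_setup J F H R p q"
    and dp: "\<And>t. (p has_real_derivative c * F k t) (at t)" and k: "k \<in> J" and nz: "\<exists>r. F k r \<noteq> 0" and c: "c \<noteq> 0"
  shows "\<exists>t'. R t t' \<and> sgn (p t) = sgn (q t')"
proof -
  have m: "matching J F H R" and tF: "tame J F" and cq: "continuous_on UNIV q" and cp: "continuous_on UNIV p"
    and mk: "\<And>z z'. R z z' \<Longrightarrow> mark J F z \<Longrightarrow> sgn (p z) = sgn (q z')"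
    using st unfolding extension_setup_def by auto
  obtain t' where R: "R t t'" using matching_total[OF m] by blast
  show ?thesis
  proof (cases "mark J F t")
    case True then show ?thesis using mk R by blast
  next
    case un: False
    have main: "\<exists>t'. R t t' \<and> sgn (p t) = sgn (q t')"
      if st: "extension_setup J F H R p q" and dp: "\<And>t. (p has_real_derivative c * F k t) (at t)" and pt: "c * F k t > 0"
      for p q c
    proof -
      have cq: "continuous_on UNIV q" and cp: "continuous_on UNIV p" using st unfolding extension_setup_def
          by auto
      have sg: "c * F k z > 0" if "sgn_const J F {t..s} \<and> z \<in> {t..s} \<or> sgn_const J F {s..t} \<and>
          z \<in> {s..t}" for s z
      proof -
        have "sgn (F k z) = sgn (F k t)" 
          using that sgn_constD[of J F "{t..s}" k z t] sgn_constD[of J F "{s..t}" k z t] k by auto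
        then have "sgn (c * F k z) = sgn (c * F k t)" by (simp add: sgn_mult)
        then show ?thesis using pt sgn_eqD by blast
      qed
      have A: "\<exists>s'\<ge>t'. sgn_const J H {t'..s'} \<and> q s' > 0" if "p t \<ge> 0"
      proof (rule extension_right[OF st R un])
        fix s assume ts: "t < s" and nm: "\<And>z. t \<le> z \<Longrightarrow> z < s \<Longrightarrow> \<not> mark J F z"
        have "p t < p s"
        proof (rule DERIV_pos_imp_increasing_open[OF ts])
          fix x assume x: "t < x" "x < s"
          have "sgn_const J F {t..x}" using nm x by (intro sgn_const_if_no_mark[OF tF]) auto
          then have "c * F k x > 0" using sg[of x x] x by auto
          then show "\<exists>y. (p has_real_derivative y) (at x) \<and> 0 < y" using dp by blast
        qed (use cp continuous_on_subset in blast)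
        then show "p s > 0" using that by simp
      qed
      have B: "\<exists>s'\<le>t'. sgn_const J H {s'..t'} \<and> q s' < 0" if "p t \<le> 0"
      proof -
        have "\<exists>s'\<ge>-t'. sgn_const J (\<lambda>j t. H j (- t)) {-t'..s'} \<and> - q (- s') > 0"
        proof (rule extension_right[OF extension_setup_reflect[OF extension_setup_uminus[OF st]], where t = "-t"])
          have ex: "(\<exists>r. P (- r)) \<longleftrightarrow> (\<exists>r. P r)" for P :: "real \<Rightarrow> bool" by (metis minus_minus)
          have mk: "mark J (\<lambda>j t. F j (- t)) z \<longleftrightarrow> mark J F (- z)" for z
            unfolding mark_def using ex[of "\<lambda>r. F _ r \<noteq> 0"] by simp
          show "R (- (- t)) (- (- t'))" using R by simp
          show "\<not> mark J (\<lambda>j t. F j (- t)) (- t)" using un mk by simp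
          fix s assume ts: "- t < s" and nm: "\<And>z. - t \<le> z \<Longrightarrow> z < s \<Longrightarrow> \<not> mark J (\<lambda>j t. F j (- t)) z"
          have nm': "\<not> mark J F z" if "- s < z" "z \<le> t" for z using nm[of "-z"] that mk by auto
          have "p (- s) < p t"
          proof (rule DERIV_pos_imp_increasing_open[where f = p])
            show "- s < t" using ts by simp
            fix x assume x: "- s < x" "x < t"
            have "sgn_const J F {x..t}" using nm' x by (intro sgn_const_if_no_mark[OF tF]) auto
            then have "c * F k x > 0" using sg[of x x] x by auto
            then show "\<exists>y. (p has_real_derivative y) (at x) \<and> 0 < y" using dp by blast
          qed (use cp continuous_on_subset in blast)
          then show "- p (- s) > 0" using that by simp
        qed
        then obtain s' where "s' \<ge> - t'" "sgn_const J H {- s'..t'}" "q (- s') < 0"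
          by (auto simp: sgn_const_reflect)
        then show ?thesis by (intro exI[of _ "- s'"]) auto
      qed
      consider "p t > 0" | "p t < 0" | "p t = 0" by linarith
      then show ?thesis
      proof cases
        case 1 then obtain s' where s: "s' \<ge> t'" "sgn_const J H {t'..s'}" "q s' > 0" using A by auto
        have "R t s'" using matching_sat[OF m R] s by auto
        then show ?thesis using s 1 by (auto intro!: exI[of _ s'])
      next
        case 2 then obtain s' where s: "s' \<le> t'" "sgn_const J H {s'..t'}" "q s' < 0" using B by auto
        have "R t s'" using matching_sat[OF m R] s by auto
        then show ?thesis using s 2 by (auto intro!: exI[of _ s'])
      next
        case 3
        obtain s1 where s1: "s1 \<ge> t'" "sgn_const J H {t'..s1}" "q s1 > 0" using A 3 by auto
        obtain s2 where s2: "s2 \<le> t'" "sgn_const J H {s2..t'}" "q s2 < 0" using B 3 by auto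
        have "\<exists>x\<ge>s2. x \<le> s1 \<and> q x = 0"
          by (rule IVT') (use s1 s2 continuous_on_subset[OF cq] in auto)
        then obtain x where x: "s2 \<le> x" "x \<le> s1" "q x = 0" by auto
        have "x \<le> t' \<and> sgn_const J H {x..t'} \<or> t' \<le> x \<and> sgn_const J H {t'..x}"
          using x sgn_const_mono[OF s1(2), of "{t'..x}"] sgn_const_mono[OF s2(2), of "{x..t'}"]
          by (cases "x \<le> t'") auto
        then have "R t x" by (rule matching_sat[OF m R])
        then show ?thesis using x 3 by (auto intro!: exI[of _ x])
      qed
    qed
    have "F k t \<noteq> 0" using un k nz unfolding mark_def by auto
    then consider "c * F k t > 0" | "- c * F k t > 0" using c
      by (cases "c * F k t > 0") (auto simp: not_less order_le_less)
    then show ?thesis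
    proof cases
      case 1 then show ?thesis by (rule main[OF st dp])
    next
      case 2
      have "\<exists>t'. R t t' \<and> sgn (- p t) = sgn (- q t')"
        by (rule main[OF extension_setup_uminus[OF st] _ 2]) (auto intro!: derivative_eq_intros dp)
      then show ?thesis by (simp add: sgn_minus)
    qed
  qed
qed

lemma sgn_const_if_monotone:
  fixes f :: "real \<Rightarrow> real"
  assumes "\<And>u v. a \<le> u \<Longrightarrow> u \<le> v \<Longrightarrow> v \<le> b \<Longrightarrow> f u \<le> f v" "sgn (f a) = sgn (f b)" "r \<in> {a..b}"
  shows "sgn (f r) = sgn (f a)"
  using assms(1)[of a r] assms(1)[of r b] assms(2,3) by (auto simp: sgn_if split: if_splits)

text \<open>
  The only remaining point is the order clause: on related cells both functions are monotone in the same
  direction, so related points in the wrong order squeeze both into constant sign.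
\<close>

lemma matching_extend:
  assumes st: "extension_setup J F H R (F l) (H l)"
    and dp: "\<And>t. (F l has_real_derivative F k t) (at t)"
    and dq: "\<And>t. (H l has_real_derivative H k t) (at t)"
    and k: "k \<in> J" and nz: "\<exists>r. F k r \<noteq> 0"
  shows "matching (insert l J) F H (\<lambda>t t'. R t t' \<and> sgn (F l t) = sgn (H l t'))"
proof (rule matching_insert)
  show m: "matching J F H R" using st unfolding extension_setup_def by auto
  show "\<exists>t'. R t t' \<and> sgn (F l t) = sgn (H l t')" for t
    by (rule extension_total[OF st, of 1 k]) (use dp k nz in auto)
  have nz': "\<exists>r. H k r \<noteq> 0" using st k nz unfolding extension_setup_def by auto
  show "\<exists>t. R t t' \<and> sgn (F l t) = sgn (H l t')" for t'
    using extension_total[OF extension_setup_swap[OF st], of 1 k t'] dq k nz' by auto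
  fix t t' s s'
  assume a: "R t t'" "R s s'" "t \<le> s" "s' \<le> t'" "sgn (F l t) = sgn (H l t')" "sgn (F l s) = sgn (H l s')"
      "sgn_const J F {t..s}" "sgn_const J H {s'..t'}"
  have sF: "sgn (F k x) = sgn (F k t)" if "x \<in> {t..s}" for x using sgn_constD[OF a(7) k that, of t] a(3) by auto
  have sH: "sgn (H k x) = sgn (F k t)" if "x \<in> {s'..t'}" for x
    using sgn_constD[OF a(8) k that, of t'] a(4) matching_sgn[OF m a(1) k] by auto
  show "sgn_const {l} F {t..s} \<and> sgn_const {l} H {s'..t'}"
  proof (cases "F k t \<ge> 0")
    case True
    have mF: "F l u \<le> F l v" if "t \<le> u" "u \<le> v" "v \<le> s" for u v
      by (rule DERIV_nonneg_imp_nondecreasing[OF that(2)])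
         (use sgn_eqD[OF sF] True that dp in \<open>force\<close>)
    have mH: "H l u \<le> H l v" if "s' \<le> u" "u \<le> v" "v \<le> t'" for u v
      by (rule DERIV_nonneg_imp_nondecreasing[OF that(2)])
         (use sgn_eqD[OF sH] True that dq in \<open>force\<close>)
    have e: "sgn (F l t) = sgn (F l s)" "sgn (H l s') = sgn (H l t')"
      using mF[of t s] mH[of s' t'] a by (auto simp: sgn_if split: if_splits)
    have "sgn (F l r) = sgn (F l t)" if "r \<in> {t..s}" for r
      by (rule sgn_const_if_monotone[OF mF e(1) that])
    moreover have "sgn (H l r) = sgn (H l s')" if "r \<in> {s'..t'}" for r
      by (rule sgn_const_if_monotone[OF mH e(2) that])
    ultimately show ?thesis by (intro conjI sgn_const_singletonI)
  next
    case False
    have negF: "F k x \<le> 0" if "x \<in> {t..s}" for x using sgn_eqD[OF sF[OF that]] False by simp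
    have negH: "H k x \<le> 0" if "x \<in> {s'..t'}" for x using sgn_eqD[OF sH[OF that]] False by simp
    have mF: "- F l u \<le> - F l v" if "t \<le> u" "u \<le> v" "v \<le> s" for u v
      by (simp, rule DERIV_nonpos_imp_nonincreasing[OF that(2)])
         (use negF that dp in \<open>meson order_trans atLeastAtMost_iff\<close>)
    have mH: "- H l u \<le> - H l v" if "s' \<le> u" "u \<le> v" "v \<le> t'" for u v
      by (simp, rule DERIV_nonpos_imp_nonincreasing[OF that(2)])
         (use negH that dq in \<open>meson order_trans atLeastAtMost_iff\<close>)
    have e: "sgn (- F l t) = sgn (- F l s)" "sgn (- H l s') = sgn (- H l t')"
      using mF[of t s] mH[of s' t'] a by (auto simp: sgn_if split: if_splits)
    have "sgn (F l r) = sgn (F l t)" if "r \<in> {t..s}" for r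
      using sgn_const_if_monotone[of t s "\<lambda>x. - F l x", OF mF e(1) that] by (simp add: sgn_minus)
    moreover have "sgn (H l r) = sgn (H l s')" if "r \<in> {s'..t'}" for r
      using sgn_const_if_monotone[of s' t' "\<lambda>x. - H l x", OF mH e(2) that] by (simp add: sgn_minus)
    ultimately show ?thesis by (intro conjI sgn_const_singletonI)
  qed
qed

section \<open>Families of polynomials with parameters\<close>

lemmas rpf_const = real_polynomial_function.intros(2)
lemmas rpf_add = real_polynomial_function.intros(3)
lemmas rpf_mult = real_polynomial_function.intros(4)
lemmas rpf_linear = real_polynomial_function.intros(1)

text \<open>
  The number \<open>n\<close> is a formal degree: the actual degree of \<open>P u\<close> may drop for special parameters \<open>u\<close>.
\<close>

definition parametric_poly :: "nat \<Rightarrow> ('a::real_normed_vector \<Rightarrow> real poly) \<Rightarrow> bool" where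
  "parametric_poly n P \<longleftrightarrow> (\<forall>u. degree (P u) \<le> n) \<and> (\<forall>i. real_polynomial_function (\<lambda>u. coeff (P u) i))"

lemma parametric_polyD:
  assumes "parametric_poly n P"
  shows "degree (P u) \<le> n" "real_polynomial_function (\<lambda>u. coeff (P u) i)" "i > n \<Longrightarrow> coeff (P u) i = 0"
proof -
  show d: "degree (P u) \<le> n" "real_polynomial_function (\<lambda>u. coeff (P u) i)"
    using assms unfolding parametric_poly_def by auto
  show "i > n \<Longrightarrow> coeff (P u) i = 0" using d(1) by (simp add: coeff_eq_0)
qed

lemma parametric_polyI:
  assumes "\<And>u i. i > n \<Longrightarrow> coeff (P u) i = 0" "\<And>i. real_polynomial_function (\<lambda>u. coeff (P u) i)"
  shows "parametric_poly n P"
  unfolding parametric_poly_def using assms by (simp add: degree_le)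

lemma parametric_poly_mono: "parametric_poly n P \<Longrightarrow> n \<le> m \<Longrightarrow> parametric_poly m P"
  unfolding parametric_poly_def using order_trans by blast

lemma parametric_poly_monom:
  assumes "real_polynomial_function a" "i \<le> n"
  shows "parametric_poly n (\<lambda>u. monom (a u) i)"
proof (rule parametric_polyI)
  show "real_polynomial_function (\<lambda>u. coeff (monom (a u) i) j)" for j
    using assms by (cases "i = j") (simp_all add: rpf_const)
qed (use assms in simp)

lemma parametric_poly_add:
  assumes "parametric_poly n P" "parametric_poly n Q" shows "parametric_poly n (\<lambda>u. P u + Q u)"
  using parametric_polyD[OF assms(1)] parametric_polyD[OF assms(2)]
  by (intro parametric_polyI) (simp_all add: rpf_add)

lemma parametric_poly_diff:
  assumes "parametric_poly n P" "parametric_poly n Q" shows "parametric_poly n (\<lambda>u. P u - Q u)"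
  using parametric_polyD[OF assms(1)] parametric_polyD[OF assms(2)]
  by (intro parametric_polyI) (simp_all add: real_polynomial_function_diff)

lemma parametric_poly_mult:
  assumes "parametric_poly n P" "parametric_poly m Q" shows "parametric_poly (n + m) (\<lambda>u. P u * Q u)"
  unfolding parametric_poly_def
proof (intro conjI allI)
  show "degree (P u * Q u) \<le> n + m" for u
    using degree_mult_le[of "P u"
        "Q u"] parametric_polyD(1)[OF assms(1), of u] parametric_polyD(1)[OF assms(2), of u] by simp
  show "real_polynomial_function (\<lambda>u. coeff (P u * Q u) i)" for i
    unfolding coeff_mult
    by (intro real_polynomial_function_sum rpf_mult parametric_polyD(2)[OF assms(1)] parametric_polyD(2)[OF assms(2)]) simp
qed

lemma parametric_poly_pderiv:
  assumes "parametric_poly (Suc n) P" shows "parametric_poly n (\<lambda>u. pderiv (P u))"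
  using parametric_polyD[OF assms]
  by (intro parametric_polyI) (simp_all add: coeff_pderiv rpf_mult rpf_const del: of_nat_Suc)

text \<open>
  Where the formal leading coefficient vanishes, the truncation has the same value and a smaller formal
  degree; this handles the dropping degrees.
\<close>

definition truncate_top :: "nat \<Rightarrow> ('a \<Rightarrow> real poly) \<Rightarrow> 'a \<Rightarrow> real poly" where
  "truncate_top n P u = P u - monom (coeff (P u) n) n"

lemma parametric_poly_truncate:
  assumes "parametric_poly (Suc n) P" shows "parametric_poly n (truncate_top (Suc n) P)"
  unfolding truncate_top_def
proof (rule parametric_polyI)
  show "coeff (P u - monom (coeff (P u) (Suc n)) (Suc n)) i = 0" if "n < i" for u i
    using that parametric_polyD(3)[OF assms, of i u] by (cases "i = Suc n") auto
  show "real_polynomial_function (\<lambda>u. coeff (P u - monom (coeff (P u) (Suc n)) (Suc n)) i)" for i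
    using parametric_polyD(2)[OF assms, of i] rpf_const by (cases "i = Suc n") auto
qed

text \<open>
  What is needed of division with remainder: at a zero of the divisor \<open>Q\<close> the sign of \<open>P\<close> can be read off \<open>r\<close>,
  whose formal degree will be below that of \<open>Q\<close>.
\<close>

definition sgn_remainder where
  "sgn_remainder m Q P r \<longleftrightarrow> (\<forall>u z. coeff (Q u) (Suc m) \<noteq> 0 \<longrightarrow> poly (Q u) z = 0 \<longrightarrow>
     sgn (poly (r u) z) = sgn (poly (P u) (z :: real)))"

lemma sgn_remainderD:
  "sgn_remainder m Q P r \<Longrightarrow> coeff (Q u) (Suc m) \<noteq> 0 \<Longrightarrow> poly (Q u) z = 0 \<Longrightarrow>
    sgn (poly (r u) z) = sgn (poly (P u) z)"
  unfolding sgn_remainder_def by blast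

text \<open>
  Pseudo-division. Each step multiplies by the square of the leading coefficient of \<open>Q\<close>, so
  signs at zeros of \<open>Q\<close> are kept.
\<close>

lemma pseudo_remainder_exists:
  fixes P Q :: "'a::real_normed_vector \<Rightarrow> real poly"
  assumes Q: "parametric_poly (Suc m) Q" and P: "parametric_poly n P"
  shows "\<exists>r. parametric_poly m r \<and> sgn_remainder m Q P r"
  using P
proof (induction n arbitrary: P)
  case 0
  then show ?case by (intro exI[of _ P]) (auto simp: sgn_remainder_def intro: parametric_poly_mono)
next
  case (Suc n)
  show ?case
  proof (cases "Suc n \<le> m")
    case True
    then show ?thesis using Suc.prems
        by (intro exI[of _ P]) (auto simp: sgn_remainder_def intro: parametric_poly_mono)
  next
    case False
    define c where "c u = coeff (Q u) (Suc m)" for u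
    define a where "a u = coeff (P u) (Suc n)" for u
    \<comment> \<open>The leading terms cancel, and at zeros of \<open>Q\<close> only a square factor is added.\<close>
    define P1 where "P1 u = monom (c u * c u) 0 * P u - monom (c u * a u) (n - m) * Q u" for u
    have c: "real_polynomial_function c" and a: "real_polynomial_function a"
      unfolding c_def[abs_def] a_def[abs_def] using parametric_polyD(2)[OF Q] parametric_polyD(2)[OF Suc.prems]
          by auto
    have "parametric_poly (0 + Suc n) (\<lambda>u. monom (c u * c u) 0 * P u)"
      by (intro parametric_poly_mult parametric_poly_monom rpf_mult c Suc.prems) simp
    moreover have "parametric_poly ((n - m) + Suc m) (\<lambda>u. monom (c u * a u) (n - m) * Q u)"
      by (intro parametric_poly_mult parametric_poly_monom rpf_mult c a Q) simp
    ultimately have P1': "parametric_poly (Suc n) P1"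
      unfolding P1_def[abs_def] using False by (intro parametric_poly_diff) auto
    have top: "coeff (P1 u) (Suc n) = 0" for u
      using False unfolding P1_def
          by (simp add: coeff_monom_mult a_def[symmetric] c_def[symmetric] Suc_diff_le Suc_diff_diff)
    have "parametric_poly n P1"
    proof (rule parametric_polyI)
      show "coeff (P1 u) i = 0" if "n < i" for u i
        using that parametric_polyD(3)[OF P1', of i u] top[of u] by (cases "i = Suc n") auto
    qed (rule parametric_polyD(2)[OF P1'])
    from Suc.IH[OF this] obtain r where r: "parametric_poly m r" "sgn_remainder m Q P1 r" by blast
    have "sgn (poly (P1 u) z) = sgn (poly (P u) z)" if "coeff (Q u) (Suc m) \<noteq> 0" "poly (Q u) z = 0" for u z
    proof -
      have "sgn (c u) * sgn (c u) = 1" using that(1) by (simp add: c_def sgn_if)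
      then show ?thesis using that(2) by (simp add: P1_def poly_monom sgn_mult)
    qed
    then have "sgn_remainder m Q P r" using sgn_remainderD[OF r(2)] unfolding sgn_remainder_def by auto
    then show ?thesis using r(1) by blast
  qed
qed

text \<open>
  Closure under everything that the matching of a member consults: derivative, truncation, and remainders.
  Members carry their formal degree, called level.
\<close>

definition level_closed :: "nat \<Rightarrow> (nat \<times> ('a::real_normed_vector \<Rightarrow> real poly)) set \<Rightarrow> bool" where
  "level_closed l G \<longleftrightarrow> (\<forall>m P. (Suc m, P) \<in> G \<longrightarrow> l \<le> m \<longrightarrow>
      (m, truncate_top (Suc m) P) \<in> G \<and> (m, \<lambda>u. pderiv (P u)) \<in> G \<and>
      (\<forall>n Q. (n, Q) \<in> G \<longrightarrow> Suc m \<le> n \<longrightarrow> (\<exists>r. (m, r) \<in> G \<and> sgn_remainder m P Q r)))"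

text \<open>
  A new member of level \<open>l\<close> is required only by members of higher levels, because a remainder has smaller
  level than its divisor. So the closure is reached by one pass through the levels in descending order and stays
  finite.
\<close>

lemma level_closed_exists_aux:
  assumes "finite \<Phi>" and \<Phi>: "\<And>P. P \<in> \<Phi> \<Longrightarrow> parametric_poly n P" and "k \<le> n"
  shows "\<exists>G. finite G \<and> {n} \<times> \<Phi> \<subseteq> G \<and> (\<forall>(m, P)\<in>G. parametric_poly m P \<and> n - k \<le> m) \<and> level_closed (n - k) G"
  using \<open>k \<le> n\<close>
proof (induction k)
  case 0
  show ?case
    by (rule exI[of _ "{n} \<times> \<Phi>"]) (use assms in \<open>auto simp: level_closed_def\<close>)
next
  case (Suc k)
  then have "k \<le> n" by simp
  from Suc.IH[OF this] obtain G where G0: "finite G" "{n} \<times> \<Phi> \<subseteq> G"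
    "\<forall>(m, P)\<in>G. parametric_poly m P \<and> n - k \<le> m" "level_closed (n - k) G" by blast
  then have G: "finite G" "{n} \<times> \<Phi> \<subseteq> G" "\<And>m P. (m, P) \<in> G \<Longrightarrow> parametric_poly m P \<and> n - k \<le> m"
    "level_closed (n - k) G" by blast+
  define l where "l = n - Suc k"
  have nk: "n - k = Suc l" using Suc.prems unfolding l_def by simp
  define is_rem where "is_rem r P Q \<longleftrightarrow> parametric_poly l r \<and> sgn_remainder l P Q r"
    for r P and Q :: "'a \<Rightarrow> real poly"
  define rem where "rem P Q = (SOME r. is_rem r P Q)" for P Q
  have rem: "is_rem (rem P Q) P Q" if "(Suc l, P) \<in> G" "(m, Q) \<in> G" for m P Q
  proof -
    have "\<exists>r. is_rem r P Q" unfolding is_rem_def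
      by (rule pseudo_remainder_exists) (use G(3)[OF that(1)] G(3)[OF that(2)] in auto)
    then show ?thesis unfolding rem_def by (rule someI_ex)
  qed
  define N where "N = (\<lambda>(m, P). truncate_top (Suc l) P) ` (G \<inter> {Suc l} \<times> UNIV) \<union>
     (\<lambda>(m, P) u. pderiv (P u)) ` (G \<inter> {Suc l} \<times> UNIV) \<union> (\<lambda>((_, P), (_, Q)). rem P Q) ` ((G \<inter> {Suc l} \<times> UNIV) \<times> G)"
  define G' where "G' = G \<union> {l} \<times> N"
  have fin: "finite N" unfolding N_def using G(1) by auto
  have N: "parametric_poly l P" if "P \<in> N" for P
  proof -
    from that consider Q where "(Suc l, Q) \<in> G" "P = truncate_top (Suc l) Q"
      | Q where "(Suc l, Q) \<in> G" "P = (\<lambda>u. pderiv (Q u))"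
      | Q m Q' where "(Suc l, Q) \<in> G" "(m, Q') \<in> G" "P = rem Q Q'"
      unfolding N_def by auto
    then show ?thesis
    proof cases
      case 1 then show ?thesis using G(3) parametric_poly_truncate by blast
    next
      case 2 then show ?thesis using G(3) parametric_poly_pderiv by blast
    next
      case 3 then show ?thesis using rem is_rem_def by blast
    qed
  qed
  have inN: "truncate_top (Suc l) P \<in> N" "(\<lambda>u. pderiv (P u)) \<in> N" "(m, Q) \<in> G \<Longrightarrow> rem P Q \<in> N"
    if "(Suc l, P) \<in> G" for P m Q
  proof -
    show "truncate_top (Suc l) P \<in> N"
      unfolding N_def by (intro UnI1 rev_image_eqI[of "(Suc l, P)"]) (use that in auto)
    show "(\<lambda>u. pderiv (P u)) \<in> N"
      unfolding N_def by (intro UnI1 UnI2 rev_image_eqI[of "(Suc l, P)"]) (use that in auto)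
    show "(m, Q) \<in> G \<Longrightarrow> rem P Q \<in> N"
      unfolding N_def by (intro UnI2 rev_image_eqI[of "((Suc l, P), (m, Q))"]) (use that in auto)
  qed
  have "level_closed l G'"
    unfolding level_closed_def
  proof (intro allI impI)
    fix m P assume P: "(Suc m, P) \<in> G'" and lm: "l \<le> m"
    then have PG: "(Suc m, P) \<in> G" unfolding G'_def by auto
    show "(m, truncate_top (Suc m) P) \<in> G' \<and> (m, \<lambda>u. pderiv (P u)) \<in> G' \<and>
      (\<forall>n Q. (n, Q) \<in> G' \<longrightarrow> Suc m \<le> n \<longrightarrow> (\<exists>r. (m, r) \<in> G' \<and> sgn_remainder m P Q r))"
    proof (cases "m = l")
      case True
      have "\<exists>r. (m, r) \<in> G' \<and> sgn_remainder m P Q r" if "(n, Q) \<in> G'" "Suc m \<le> n" for n Q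
      proof -
        have "(n, Q) \<in> G" using that True unfolding G'_def by auto
        then show ?thesis 
          using rem[of P n Q] inN(3)[of P n Q] PG True unfolding G'_def is_rem_def
              by (intro exI[of _ "rem P Q"]) simp
      qed
      then show ?thesis using PG inN True unfolding G'_def by blast
    next
      case False
      then have "Suc l \<le> m" using lm by simp
      have *: "(n, Q) \<in> G" if "(n, Q) \<in> G'" "Suc m \<le> n" for n Q using that lm unfolding G'_def by auto
      show ?thesis
        using G(4)[unfolded nk level_closed_def, rule_format, OF PG \<open>Suc l \<le> m\<close>] * unfolding G'_def by blast
    qed
  qed
  then show ?case
    using fin G N nk unfolding l_def[symmetric]
    by (intro exI[of _ G']) (auto simp: G'_def l_def[symmetric] dest: G(3))
qed

lemma level_closed_exists:
  assumes "finite \<Phi>" and "\<And>P. P \<in> \<Phi> \<Longrightarrow> parametric_poly n P"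
  shows "\<exists>G. finite G \<and> {n} \<times> \<Phi> \<subseteq> G \<and> (\<forall>(m, P)\<in>G. parametric_poly m P) \<and> level_closed 0 G"
  using level_closed_exists_aux[OF assms, of n] by fastforce

lemma poly_sgn_at_top: "\<exists>M. \<forall>s\<ge>M. sgn (poly p s) = sgn (lead_coeff (p :: real poly))"
proof -
  consider "lead_coeff p > 0" | "lead_coeff p < 0" | "p = 0"
      by (metis leading_coeff_0_iff linorder_neqE_linordered_idom)
  then show ?thesis
  proof cases
    case 1
    then obtain n where n: "\<And>x. x \<ge> n \<Longrightarrow> lead_coeff p \<le> poly p x" using poly_pinfty_gt_lc by blast
    have "poly p x > 0" if "x \<ge> n" for x using less_le_trans[OF 1 n[OF that]] .
    then show ?thesis using 1 by (intro exI[of _ n]) simp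
  next
    case 2
    then have l: "lead_coeff (- p) > 0" by (simp add: lead_coeff_minus)
    then obtain n where n: "\<And>x. x \<ge> n \<Longrightarrow> lead_coeff (- p) \<le> poly (- p) x" using poly_pinfty_gt_lc by blast
    have "poly (- p) x > 0" if "x \<ge> n" for x using less_le_trans[OF l n[OF that]] .
    then show ?thesis using 2 by (intro exI[of _ n]) simp
  qed simp
qed

lemma poly_sgn_at_bot: "\<exists>M. \<forall>s\<le>M. sgn (poly p s) = sgn (lead_coeff (p :: real poly) * (- 1) ^ degree p)"
proof -
  let ?q = "pcompose p [:0, - 1:]"
  have "lead_coeff ?q = lead_coeff p * (- 1) ^ degree p" by (subst lead_coeff_comp) auto
  then obtain M where M: "\<And>s. s \<ge> M \<Longrightarrow> sgn (poly p (- s)) = sgn (lead_coeff p * (- 1) ^ degree p)"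
    using poly_sgn_at_top[of ?q] by (auto simp: poly_pcompose)
  show ?thesis using M[of "- _"] by (intro exI[of _ "- M"]) (metis add.inverse_inverse le_minus_iff)
qed

lemma sgn_coeffs_degree:
  fixes p q :: "real poly"
  assumes "\<And>i. sgn (coeff p i) = sgn (coeff q i)"
  shows "degree p = degree q" "sgn (lead_coeff p) = sgn (lead_coeff q)" "p = 0 \<longleftrightarrow> q = 0"
proof -
  have z: "coeff p i = 0 \<longleftrightarrow> coeff q i = 0" for i using assms[of i] by (metis sgn_zero_iff)
  then show "p = 0 \<longleftrightarrow> q = 0" by (simp add: poly_eq_iff)
  show d: "degree p = degree q" unfolding degree_def using z by simp
  show "sgn (lead_coeff p) = sgn (lead_coeff q)" using assms d by simp
qed

lemma sgn_at_infinity: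
  fixes p q :: "real poly"
  assumes s: "\<And>i. sgn (coeff p i) = sgn (coeff q i)"
  shows "\<exists>M. \<forall>s\<ge>M. \<forall>s'\<ge>M. sgn (poly p s) = sgn (poly q s')"
    and "\<exists>M. \<forall>s\<le>M. \<forall>s'\<le>M. sgn (poly p s) = sgn (poly q s')"
proof -
  note d = sgn_coeffs_degree[OF s]
  obtain M1 M2 where "\<forall>s\<ge>M1. sgn (poly p s) = sgn (lead_coeff p)" "\<forall>s\<ge>M2. sgn (poly q s) = sgn (lead_coeff q)"
    using poly_sgn_at_top by metis
  then show "\<exists>M. \<forall>s\<ge>M. \<forall>s'\<ge>M. sgn (poly p s) = sgn (poly q s')"
    using d by (intro exI[of _ "max M1 M2"]) auto
  obtain M1 M2 where "\<forall>s\<le>M1. sgn (poly p s) = sgn (lead_coeff p * (- 1) ^ degree p)"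
     "\<forall>s\<le>M2. sgn (poly q s) = sgn (lead_coeff q * (- 1) ^ degree q)"
    using poly_sgn_at_bot by metis
  then show "\<exists>M. \<forall>s\<le>M. \<forall>s'\<le>M. sgn (poly p s) = sgn (poly q s')"
    using d by (intro exI[of _ "min M1 M2"]) (auto simp: sgn_mult)
qed

lemma tame_poly: "finite J \<Longrightarrow> tame J (\<lambda>j. poly (p j))"
proof -
  have "finite {r. poly (p j) r = 0}" if "\<exists>r. poly (p j) r \<noteq> 0" for j
    by (rule poly_roots_finite) (use that in auto)
  then show "finite J \<Longrightarrow> tame J (\<lambda>j. poly (p j))" unfolding tame_def by (auto intro: continuous_intros)
qed

lemma sgn_const_transfer:
  assumes "sgn_const J F I" "k \<in> J" "F j = F k" shows "sgn_const {j} F I"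
  unfolding sgn_const_def
proof (intro ballI)
  fix i r s assume "i \<in> {j}" "r \<in> I" "s \<in> I"
  then show "sgn (F i r) = sgn (F i s)" using sgn_constD[OF assms(1,2), of r s] assms(3) by simp
qed

text \<open>
  Members are added in the order of their levels. When a member of level \<open>n\<close> is added, its derivative and its
  truncation are already present, and so is its remainder at every member already present; the remainders give the
  sign agreement at marked points, and the coefficients the agreement at infinity.
\<close>

lemma matching_exists:
  fixes G :: "(nat \<times> ('a::real_normed_vector \<Rightarrow> real poly)) set"
  assumes fin: "finite G" and pp: "\<And>m P. (m, P) \<in> G \<Longrightarrow> parametric_poly m P" and cl: "level_closed 0 G"
    and sg: "\<And>m P i. (m, P) \<in> G \<Longrightarrow> sgn (coeff (P u) i) = sgn (coeff (P u') i)"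
  shows "\<exists>R. matching G (\<lambda>(m, P). poly (P u)) (\<lambda>(m, P). poly (P u')) R"
proof -
  define F :: "nat \<times> ('a \<Rightarrow> real poly) \<Rightarrow> real \<Rightarrow> real" where "F = (\<lambda>(m, P). poly (P u))"
  define H :: "nat \<times> ('a \<Rightarrow> real poly) \<Rightarrow> real \<Rightarrow> real" where "H = (\<lambda>(m, P). poly (P u'))"
  have zero: "P u = 0 \<longleftrightarrow> P u' = 0" if "(m, P) \<in> G" for m P using sgn_coeffs_degree(3)[OF sg[OF that]] .
  define low where "low n = {(m, P) \<in> G. m < n}" for n
  have step: "\<exists>R. matching (insert (n, P) K) F H R"
    if K: "low n \<subseteq> K" "K \<subseteq> G" "\<And>m Q. (m, Q) \<in> K \<Longrightarrow>
        m \<le> n" and P: "(n, P) \<in> G" and R: "matching K F H R" for n P K R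
  proof -
    have finK: "finite K" using K(2) fin finite_subset by blast
    consider "n = 0" | m where "n = Suc m" "coeff (P u) n = 0" | m where "n = Suc m" "coeff (P u) n \<noteq> 0"
      by (cases n) auto
    then show ?thesis
    proof cases
      case 1
      have "degree (P v) = 0" for v using parametric_polyD(1)[OF pp[OF P], of v] 1 by simp
      then have c: "poly (P v) t = coeff (P v) 0" for v t using degree_eq_zeroE[of "P v"] by force
      have e: "sgn (F (n, P) t) = sgn (coeff (P u) 0)" "sgn (H (n, P) t) = sgn (coeff (P u) 0)" for t
        unfolding F_def H_def using c sg[OF P, of 0] by auto
      show ?thesis
        by (rule exI, rule matching_insert[OF R])
           (use e matching_total[OF R] matching_surj[OF R] in \<open>auto simp: sgn_const_def\<close>)
    next
      case (2 m)
      have c': "coeff (P u') n = 0" using sg[OF P, of n] 2 by (metis sgn_zero_iff)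
      let ?k = "(m, truncate_top (Suc m) P)"
      have "?k \<in> G" using cl P 2 unfolding level_closed_def by blast
      then have k: "?k \<in> K" using K(1) 2(1) unfolding low_def by auto
      have e: "F (n, P) = F ?k" "H (n, P) = H ?k" unfolding F_def H_def truncate_top_def using 2 c' by auto
      show ?thesis
      proof (rule exI, rule matching_insert[OF R])
        show "\<exists>t'. R t t' \<and> sgn (F (n, P) t) = sgn (H (n, P) t')" for t
          using matching_total[OF R, of t] matching_sgn[OF R _ k] e by auto
        show "\<exists>t. R t t' \<and> sgn (F (n, P) t) = sgn (H (n, P) t')" for t'
          using matching_surj[OF R, of t'] matching_sgn[OF R _ k] e by auto
        show "sgn_const {(n, P)} F {t..s} \<and> sgn_const {(n, P)} H {s'..t'}"
          if "sgn_const K F {t..s}" "sgn_const K H {s'..t'}" for t s s' t'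
          using sgn_const_transfer[OF that(1) k e(1)] sgn_const_transfer[OF that(2) k e(2)] by blast
      qed
    next
      case (3 m)
      let ?k = "(m, \<lambda>u. pderiv (P u))"
      have "?k \<in> G" using cl P 3 unfolding level_closed_def by blast
      then have k: "?k \<in> K" using K(1) 3(1) unfolding low_def by auto
      have nz: "\<exists>r. F ?k r \<noteq> 0"
      proof -
        have "coeff (pderiv (P u)) m \<noteq> 0" using 3 by (simp add: coeff_pderiv)
        then have "pderiv (P u) \<noteq> 0" by force
        then show ?thesis unfolding F_def using poly_all_0_iff_0 by auto
      qed
      have marks: "\<forall>z z'. R z z' \<longrightarrow> mark K F z \<longrightarrow> sgn (F (n, P) z) = sgn (H (n, P) z')"
      proof (intro allI impI)
        fix z z' assume Rz: "R z z'" and mk: "mark K F z"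
        define good where "good = (\<lambda>l. \<exists>Q. (l, Q) \<in> K \<and> Q u \<noteq> 0 \<and> poly (Q u) z = 0)"
        have ex: "\<exists>l. good l" using mk unfolding good_def mark_def F_def by fastforce
        \<comment> \<open>At the least level the formal leading coefficient is nonzero: otherwise the truncation would be marked too.\<close>
        define l where "l = (LEAST l. good l)"
        have "good l" unfolding l_def using ex by (rule LeastI_ex)
        then obtain Q where Q: "(l, Q) \<in> K" "Q u \<noteq> 0" "poly (Q u) z = 0" unfolding good_def by blast
        have QG: "(l, Q) \<in> G" using Q K by auto
        have "l \<noteq> 0"
        proof
          assume "l = 0"
          then have "degree (Q u) = 0" using parametric_polyD(1)[OF pp[OF QG], of u] by simp
          then show False using Q(2,3) degree_eq_zeroE[of "Q u"] by force
        qed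
        then obtain l' where l': "l = Suc l'" by (cases l) auto
        have ln: "l \<le> n" using K(3) Q(1) .
        have lc: "coeff (Q u) l \<noteq> 0"
        proof
          assume c: "coeff (Q u) l = 0"
          have "(l', truncate_top (Suc l') Q) \<in> G" using cl QG l' unfolding level_closed_def by blast
          then have "(l', truncate_top (Suc l') Q) \<in> K" using K(1) l' ln unfolding low_def by auto
          moreover have "truncate_top (Suc l') Q u = Q u" using c l' by (simp add: truncate_top_def)
          ultimately have "good l'" unfolding good_def using Q by metis
          then show False using l' unfolding l_def[symmetric] using not_less_Least[of l' good] l_def by simp
        qed
        have lc': "coeff (Q u') l \<noteq> 0" using sg[OF QG, of l] lc by (metis sgn_zero_iff)
        have z': "poly (Q u') z' = 0"
          using matching_sgn[OF R Rz Q(1)] Q(3) unfolding F_def H_def by (simp add: sgn_zero_iff)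
        obtain r where r: "(l', r) \<in> G" "sgn_remainder l' Q P r"
          using cl QG P ln unfolding l' level_closed_def by blast
        have "(l', r) \<in> K" using r(1) K(1) l' ln unfolding low_def by auto
        then have "sgn (poly (r u) z) = sgn (poly (r u') z')"
          using matching_sgn[OF R Rz] unfolding F_def H_def by fastforce
        then show "sgn (F (n, P) z) = sgn (H (n, P) z')"
          using sgn_remainderD[OF r(2), of u z] sgn_remainderD[OF r(2), of u' z'] lc lc' Q(3) z'
              unfolding F_def H_def l' by simp
      qed
      have tF: "tame K F" "tame K H" unfolding F_def H_def case_prod_unfold using tame_poly[OF finK] by auto
      have zz: "\<forall>j\<in>K. (\<forall>r. F j r = 0) \<longleftrightarrow> (\<forall>r. H j r = 0)"
      proof
        fix j assume "j \<in> K"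
        moreover obtain m Q where j: "j = (m, Q)" by (cases j)
        ultimately have "Q u = 0 \<longleftrightarrow> Q u' = 0" using zero K(2) by blast
        then show "(\<forall>r. F j r = 0) \<longleftrightarrow> (\<forall>r. H j r = 0)"
          using poly_all_0_iff_0[of "Q u"] poly_all_0_iff_0[of "Q u'"] unfolding F_def H_def j by simp
      qed
      have st: "extension_setup K F H R (F (n, P)) (H (n, P))"
        unfolding extension_setup_def
        by (intro conjI R tF zz marks)
           (use sgn_at_infinity[OF sg[OF P]] in \<open>auto simp: F_def H_def intro: continuous_intros\<close>)
      show ?thesis
        by (rule exI, rule matching_extend[OF st _ _ k nz]) (auto simp: F_def H_def poly_DERIV)
    qed
  qed
  have lev: "\<exists>R. matching (low n \<union> K) F H R" if "finite K" "K \<subseteq> {(m, P) \<in> G. m = n}"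
      "\<exists>R. matching (low n) F H R" for n K
    using that
  proof (induction K rule: finite_induct)
    case (insert x K)
    obtain P where x: "x = (n, P)" "(n, P) \<in> G" using insert.prems by auto
    obtain R where R: "matching (low n \<union> K) F H R" using insert by auto
    have "\<exists>R. matching (insert (n, P) (low n \<union> K)) F H R"
      by (rule step[OF _ _ _ x(2) R]) (use insert.prems in \<open>auto simp: low_def\<close>)
    then show ?case using x by simp
  qed simp
  have "\<exists>R. matching (low n) F H R" for n
  proof (induction n)
    case 0
    have "matching {} F H (\<lambda>_ _. True)" unfolding matching_def sgn_const_def by simp
    moreover have "low 0 = {}" unfolding low_def by auto
    ultimately show ?case by auto
  next
    case (Suc n)
    have "low (Suc n) = low n \<union> {(m, P) \<in> G. m = n}" unfolding low_def by auto
    moreover have "finite {(m, P) \<in> G. m = n}" using fin by (rule rev_finite_subset) auto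
    ultimately show ?case using lev[OF _ order_refl Suc] by simp
  qed
  moreover have "G = low (Suc (Max (fst ` G)))" unfolding low_def using fin
      by (auto simp: less_Suc_eq_le intro!: Max_ge rev_image_eqI)
  ultimately show ?thesis unfolding F_def H_def by metis
qed

section \<open>Definable sets and quantifier elimination\<close>

lemma poly_function_real_mult:
  fixes f g :: "'a::real_normed_vector \<Rightarrow> real"
  assumes "polynomial_function f" "polynomial_function g" shows "polynomial_function (\<lambda>x. f x * g x)"
  using assms by (simp add: real_polynomial_function_eq[symmetric] rpf_mult)

lemma poly_function_linear: "bounded_linear h \<Longrightarrow> polynomial_function f \<Longrightarrow> polynomial_function (\<lambda>x. h (f x))"
  using polynomial_function_compose[OF _ polynomial_function_bounded_linear, of f h] by (simp add: o_def)

lemma poly_function_inner2: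
  fixes f g :: "'a::real_normed_vector \<Rightarrow> 'b::euclidean_space"
  assumes "polynomial_function f" "polynomial_function g" shows "polynomial_function (\<lambda>x. f x \<bullet> g x)"
proof -
  have "(\<lambda>x. f x \<bullet> g x) = (\<lambda>x. \<Sum>b\<in>Basis. (f x \<bullet> b) * (g x \<bullet> b))"
    by (rule ext) (rule euclidean_inner)
  then show ?thesis using assms
      by (simp add: polynomial_function_sum poly_function_real_mult polynomial_function_inner)
qed

lemma poly_function_Pair:
  fixes f :: "'a::real_normed_vector \<Rightarrow> 'b::euclidean_space" and g :: "'a \<Rightarrow> 'c::euclidean_space"
  assumes "polynomial_function f" "polynomial_function g" shows "polynomial_function (\<lambda>x. (f x, g x))"
  using assms by (auto simp: polynomial_function_iff_Basis_inner Basis_prod_def)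

lemma poly_function_real_power:
  fixes f :: "'a::real_normed_vector \<Rightarrow> real"
  assumes "polynomial_function f" shows "polynomial_function (\<lambda>x. f x ^ n)"
  using assms by (simp add: real_polynomial_function_eq[symmetric] real_polynomial_function_power)

lemmas poly_function_intros = polynomial_function_id polynomial_function_const poly_function_Pair
  poly_function_linear[OF bounded_linear_fst] poly_function_linear[OF bounded_linear_snd]
  poly_function_inner2 poly_function_real_mult polynomial_function_add polynomial_function_diff
  polynomial_function_minus polynomial_function_mult poly_function_real_power

text \<open>
  Semialgebraic sets, generated as a Boolean algebra, which is the form needed for induction.
\<close>

inductive definable :: "'a::euclidean_space set \<Rightarrow> bool" where
  definable_pos: "polynomial_function p \<Longrightarrow> definable {x. (0::real) < p x}"
| definable_Compl: "definable S \<Longrightarrow> definable (- S)"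
| definable_Int: "definable S \<Longrightarrow> definable T \<Longrightarrow> definable (S \<inter> T)"

lemma definable_vimage:
  assumes "definable S" "polynomial_function m" shows "definable {x. m x \<in> S}"
  using assms(1)
proof induction
  case (definable_pos p)
  have "polynomial_function (\<lambda>x. p (m x))"
    using polynomial_function_compose[OF assms(2) definable_pos] by (simp add: o_def)
  from definable.definable_pos[OF this] show ?case by simp
next
  case (definable_Compl S)
  have "{x. m x \<in> - S} = - {x. m x \<in> S}" by auto
  then show ?case using definable_Compl definable.definable_Compl by metis
next
  case (definable_Int S T)
  have "{x. m x \<in> S \<inter> T} = {x. m x \<in> S} \<inter> {x. m x \<in> T}" by auto
  then show ?case using definable_Int definable.definable_Int by metis
qed

lemma definable_not: "definable {x. P x} \<Longrightarrow> definable {x. \<not> P x}"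
  using definable_Compl[of "{x. P x}"] by (simp add: Collect_neg_eq)

lemma definable_conj: "definable {x. P x} \<Longrightarrow> definable {x. Q x} \<Longrightarrow> definable {x. P x \<and> Q x}"
  using definable_Int[of "{x. P x}" "{x. Q x}"] by (simp add: Collect_conj_eq)

lemma definable_disj: "definable {x. P x} \<Longrightarrow> definable {x. Q x} \<Longrightarrow> definable {x. P x \<or> Q x}"
  using definable_not[OF definable_conj[OF definable_not[of P] definable_not[of Q]]] by simp

lemma definable_imp: "definable {x. P x} \<Longrightarrow> definable {x. Q x} \<Longrightarrow> definable {x. P x \<longrightarrow> Q x}"
  unfolding imp_conv_disj by (intro definable_disj definable_not)

lemma definable_const: "definable {x::'a::euclidean_space. c}"
proof -
  have "definable {x::'a. (0::real) < (if c then 1 else - 1)}"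
      by (rule definable_pos) (rule polynomial_function_const)
  then show ?thesis by (cases c) auto
qed

lemma definable_finite_Inter: "finite I \<Longrightarrow> (\<And>i. i \<in> I \<Longrightarrow> definable {x. P i x}) \<Longrightarrow> definable {x. \<forall>i\<in>I. P i x}"
  by (induction I rule: finite_induct) (use definable_const[of True] in \<open>simp_all add: definable_conj\<close>)

lemma definable_finite_Union: "finite I \<Longrightarrow> (\<And>i. i \<in> I \<Longrightarrow> definable {x. P i x}) \<Longrightarrow> definable {x. \<exists>i\<in>I. P i x}"
  using definable_not[OF definable_finite_Inter[of I "\<lambda>i x. \<not> P i x", OF _ definable_not]] by simp

lemma definable_sgn_eq:
  assumes "polynomial_function (p :: 'a::euclidean_space \<Rightarrow> real)" shows "definable {x. sgn (p x) = c}"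
proof -
  have pos: "definable {x. 0 < p x}" and neg: "definable {x. 0 < - p x}"
    by (intro definable_pos assms polynomial_function_minus)+
  have "{x. sgn (p x) = c} = {x. (0 < p x \<and> c = 1) \<or> (0 < - p x \<and> c = - 1) \<or> ((\<not> 0 < p x \<and> \<not> 0 < - p x) \<and>
      c = 0)}"
    by (auto simp: sgn_if split: if_splits)
  also have "definable \<dots>" by (intro definable_disj definable_conj definable_not definable_const pos neg)
  finally show ?thesis .
qed

text \<open>
  Such a set is a union of sign classes of \<open>B\<close>, of which there are finitely many.
\<close>

lemma definable_if_sign_invariant:
  fixes B :: "('a::euclidean_space \<Rightarrow> real) set"
  assumes B: "finite B" "\<And>b. b \<in> B \<Longrightarrow> polynomial_function b"
    and inv: "\<And>u v. (\<And>b. b \<in> B \<Longrightarrow> sgn (b u) = sgn (b v)) \<Longrightarrow> u \<in> X \<Longrightarrow> v \<in> X"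
  shows "definable X"
proof -
  define sig where "sig u = restrict (\<lambda>b. sgn (b u)) B" for u
  have "sgn (r :: real) \<in> {- 1, 0, 1}" for r by (simp add: sgn_if)
  then have "sig ` X \<subseteq> B \<rightarrow>\<^sub>E {- 1, 0, 1}" unfolding sig_def
      by (intro image_subsetI restrict_PiE_iff[THEN iffD2]) blast
  then have fin: "finite (sig ` X)" by (rule finite_subset) (simp add: finite_PiE B)
  have "X = {v. \<exists>c\<in>sig ` X. \<forall>b\<in>B. sgn (b v) = c b}"
  proof (intro set_eqI iffI)
    fix v assume "v \<in> X" then show "v \<in> {v. \<exists>c\<in>sig ` X. \<forall>b\<in>B. sgn (b v) = c b}"
      by (auto simp: sig_def intro!: bexI[of _ v])
  next
    fix v assume "v \<in> {v. \<exists>c\<in>sig ` X. \<forall>b\<in>B. sgn (b v) = c b}"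
    then obtain u where u: "u \<in> X" "\<And>b. b \<in> B \<Longrightarrow> sgn (b v) = sig u b" by auto
    show "v \<in> X" by (rule inv[OF _ u(1)]) (use u(2) in \<open>simp add: sig_def\<close>)
  qed
  also have "definable \<dots>" by (intro definable_finite_Union definable_finite_Inter fin B definable_sgn_eq)
  finally show ?thesis .
qed

lemma polynomial_as_parametric_poly:
  fixes p :: "'a::euclidean_space \<times> real \<Rightarrow> real"
  assumes "real_polynomial_function p"
  shows "\<exists>n P. parametric_poly n P \<and> (\<forall>u t. p (u, t) = poly (P u) t)"
  using assms
proof induction
  case (linear f)
  interpret bounded_linear f by fact
  have f: "f (u, t) = f (u, 0) + t * f (0, 1)" for u t
  proof -
    have "f (u, t) = f ((u, 0) + t *\<^sub>R (0, 1))" by simp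
    also have "\<dots> = f (u, 0) + t * f (0, 1)" by (simp only: add scaleR real_scaleR_def)
    finally show ?thesis .
  qed
  have "bounded_linear (\<lambda>u. f (u, 0))"
    using bounded_linear_compose[OF bounded_linear_axioms bounded_linear_Pair[OF bounded_linear_ident bounded_linear_zero]] .
  then have "parametric_poly 1 (\<lambda>u. monom (f (u, 0)) 0 + monom (f (0, 1)) 1)"
    by (intro parametric_poly_add parametric_poly_monom rpf_linear rpf_const) auto
  moreover have "f (u, t) = poly (monom (f (u, 0)) 0 + monom (f (0, 1)) 1) t" for u t
    unfolding poly_add poly_monom using f[of u t] by simp
  ultimately show ?case by blast
next
  case (const c)
  have "parametric_poly 0 (\<lambda>u :: 'a. monom c 0)" by (intro parametric_poly_monom rpf_const) auto
  moreover have "c = poly (monom c 0) t" for t by (simp add: poly_monom)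
  ultimately show ?case by blast
next
  case (add f g)
  then obtain n P m Q where "parametric_poly n P" "\<And>u t. f (u, t) = poly (P u) t"
      "parametric_poly m Q" "\<And>u t. g (u, t) = poly (Q u) t" by blast
  then show ?case
    by (intro exI[of _ "max n m"] exI[of _ "\<lambda>u. P u + Q u"])
       (auto intro!: parametric_poly_add elim: parametric_poly_mono)
next
  case (mult f g)
  then obtain n P m Q where "parametric_poly n P" "\<And>u t. f (u, t) = poly (P u) t"
      "parametric_poly m Q" "\<And>u t. g (u, t) = poly (Q u) t" by blast
  then show ?case
    by (intro exI[of _ "n + m"] exI[of _ "\<lambda>u. P u * Q u"]) (auto intro!: parametric_poly_mult)
qed

text \<open>
  Membership of \<open>(u, t)\<close> depends only on the signs of finitely many polynomials in the last coordinate. This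
  is all that quantifier elimination has to know about a definable set.
\<close>

definition determined_by_signs ::
  "('a \<times> real) set \<Rightarrow> ('a \<Rightarrow> real poly) set \<Rightarrow> bool" where
  "determined_by_signs S \<Phi> \<longleftrightarrow>
     (\<forall>u t u' t'. (\<forall>P\<in>\<Phi>. sgn (poly (P u) t) = sgn (poly (P u') t')) \<longrightarrow> (u, t) \<in> S \<longrightarrow> (u', t') \<in> S)"

lemma determined_by_signsD:
  "determined_by_signs S \<Phi> \<Longrightarrow> (\<And>P. P \<in> \<Phi> \<Longrightarrow> sgn (poly (P u) t) = sgn (poly (P u') t')) \<Longrightarrow>
    (u, t) \<in> S \<Longrightarrow> (u', t') \<in> S"
  unfolding determined_by_signs_def by blast

lemma definable_determined_by_signs:
  fixes S :: "('a::euclidean_space \<times> real) set"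
  assumes "definable S"
  shows "\<exists>n \<Phi>. finite \<Phi> \<and> (\<forall>P\<in>\<Phi>. parametric_poly n P) \<and> determined_by_signs S \<Phi>"
  using assms
proof (induction S rule: definable.induct)
  case (definable_pos p)
  then have "real_polynomial_function p" by (simp add: real_polynomial_function_eq)
  from polynomial_as_parametric_poly[OF this]
  obtain n P where P: "parametric_poly n P" "\<And>u t. p (u, t) = poly (P u) t" by blast
  have "determined_by_signs {x. 0 < p x} {P}"
    unfolding determined_by_signs_def
  proof (intro allI impI)
    fix u t u' t' assume "\<forall>P\<in>{P}. sgn (poly (P u) t) = sgn (poly (P u') t')" "(u, t) \<in> {x. 0 < p x}"
    then have "0 < poly (P u') t'" using sgn_eqD[of "poly (P u) t" "poly (P u') t'"] P(2) by simp
    then show "(u', t') \<in> {x. 0 < p x}" using P(2) by simp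
  qed
  then show ?case using P(1) by (intro exI[of _ n] exI[of _ "{P}"]) simp
next
  case (definable_Compl S)
  then obtain n \<Phi> where P: "finite \<Phi>" "\<forall>P\<in>\<Phi>. parametric_poly n P" "determined_by_signs S \<Phi>" by blast
  have "determined_by_signs (- S) \<Phi>"
    unfolding determined_by_signs_def
  proof (intro allI impI)
    fix u t u' t' assume a: "\<forall>P\<in>\<Phi>. sgn (poly (P u) t) = sgn (poly (P u') t')" "(u, t) \<in> - S"
    show "(u', t') \<in> - S"
    proof
      assume "(u', t') \<in> S"
      then have "(u, t) \<in> S" using a(1) by (intro determined_by_signsD[OF P(3), of u' t' u t]) simp_all
      then show False using a(2) by simp
    qed
  qed
  then show ?case using P(1,2) by blast
next
  case (definable_Int S T)
  then obtain n \<Phi> m \<Psi> where P: "finite \<Phi>" "\<forall>P\<in>\<Phi>. parametric_poly n P" "determined_by_signs S \<Phi>"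
    and Q: "finite \<Psi>" "\<forall>P\<in>\<Psi>. parametric_poly m P" "determined_by_signs T \<Psi>" by blast
  have "\<forall>P\<in>\<Phi> \<union> \<Psi>. parametric_poly (max n m) P"
    using P(2) Q(2) parametric_poly_mono[of n _ "max n m"] parametric_poly_mono[of m _ "max n m"] by auto
  moreover have "determined_by_signs (S \<inter> T) (\<Phi> \<union> \<Psi>)"
    unfolding determined_by_signs_def[of "S \<inter> T"]
  proof (intro allI impI IntI)
    fix u t u' t' assume a: "\<forall>P\<in>\<Phi> \<union> \<Psi>. sgn (poly (P u) t) = sgn (poly (P u') t')" "(u, t) \<in> S \<inter> T"
    show "(u', t') \<in> S" by (rule determined_by_signsD[OF P(3), of u t]) (use a in auto)
    show "(u', t') \<in> T" by (rule determined_by_signsD[OF Q(3), of u t]) (use a in auto)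
  qed
  ultimately show ?case using P(1) Q(1) by blast
qed

text \<open>
  The Tarski--Seidenberg theorem for one coordinate. If all coefficients of a level-closed family have the same
  signs at \<open>u\<close> and at \<open>v\<close>, a matching turns a witness over \<open>u\<close> into a witness over \<open>v\<close>; so the projection is invariant
  under the signs of finitely many polynomials.
\<close>

lemma definable_ex_real:
  fixes S :: "('a::euclidean_space \<times> real) set"
  assumes "definable S" shows "definable {u. \<exists>t. (u, t) \<in> S}"
proof -
  obtain n \<Phi> where \<Phi>: "finite \<Phi>" "\<And>P. P \<in> \<Phi> \<Longrightarrow> parametric_poly n P"
     and S: "determined_by_signs S \<Phi>"
    using definable_determined_by_signs[OF assms] by blast
  obtain G where G: "finite G" "{n} \<times> \<Phi> \<subseteq> G" "\<forall>(m, P)\<in>G. parametric_poly m P" "level_closed 0 G"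
    using level_closed_exists[OF \<Phi>] by blast
  \<comment> \<open>The polynomials whose signs determine the projection: all coefficients of the closed family.\<close>
  define B where "B = (\<lambda>((m, P), i) u. coeff (P u) i) ` (SIGMA (m, P):G. {..m})"
  have pp: "parametric_poly m P" if "(m, P) \<in> G" for m P using G(3) that by blast
  have inB: "(\<lambda>u. coeff (P u) i) \<in> B" if "(m, P) \<in> G" "i \<le> m" for m P i
    unfolding B_def by (rule rev_image_eqI[of "((m, P), i)"]) (use that in auto)
  show ?thesis
  proof (rule definable_if_sign_invariant)
    show "finite B" unfolding B_def using G(1) by (intro finite_imageI finite_SigmaI) auto
    show "polynomial_function b" if "b \<in> B" for b
      using that parametric_polyD(2)[OF pp] unfolding B_def real_polynomial_function_eq[symmetric] by auto
    fix u v assume sg: "\<And>b. b \<in> B \<Longrightarrow> sgn (b u) = sgn (b v)" and "u \<in> {u. \<exists>t. (u, t) \<in> S}"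
    then obtain t where t: "(u, t) \<in> S" by auto
    have "sgn (coeff (P u) i) = sgn (coeff (P v) i)" if "(m, P) \<in> G" for m P i
      using sg[OF inB[OF that, of i]] parametric_polyD(3)[OF pp[OF that]] by (cases "i \<le> m") auto
    then have "\<exists>R. matching G (\<lambda>(m, P). poly (P u)) (\<lambda>(m, P). poly (P v)) R"
      by (intro matching_exists[OF G(1) _ G(4)] pp)
    then obtain R where R: "matching G (\<lambda>(m, P). poly (P u)) (\<lambda>(m, P). poly (P v)) R" by blast
    obtain t' where "R t t'" using matching_total[OF R] by blast
    then have "sgn (poly (P u) t) = sgn (poly (P v) t')" if "P \<in> \<Phi>" for P
      using matching_sgn[OF R, of t t' "(n, P)"] G(2) that by auto
    then show "v \<in> {u. \<exists>t. (u, t) \<in> S}" using determined_by_signsD[OF S _ t] by blast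
  qed
qed

text \<open>
  The remaining coordinates are eliminated one basis vector at a time: a point of the span of
  \<open>insert b B\<close> is a point of the span of \<open>B\<close> moved by a real multiple of \<open>b\<close>.
\<close>

lemma definable_ex_set:
  fixes S :: "('a::euclidean_space \<times> 'b::euclidean_space) set"
  assumes "definable S" shows "definable {u. \<exists>v. (u, v) \<in> S}"
proof -
  have "definable {u. \<exists>v\<in>span B. (u, v) \<in> S}" if "finite B" "definable S" for B and S :: "('a \<times> 'b) set"
    using that
  proof (induction B arbitrary: S rule: finite_induct)
    case empty
    have "definable {u. (u, 0) \<in> S}" by (rule definable_vimage[OF empty]) (intro poly_function_intros)
    then show ?case by simp
  next
    case (insert b B)
    let ?T = "{w :: ('a \<times> 'b) \<times> real. (fst (fst w), snd (fst w) + snd w *\<^sub>R b) \<in> S}"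
    have "definable ?T" by (rule definable_vimage[OF insert.prems]) (intro poly_function_intros)
    from definable_ex_real[OF this]
    have "definable {u. \<exists>v\<in>span B. (u, v) \<in> {w. \<exists>t. (w, t) \<in> ?T}}" by (rule insert.IH)
    moreover have "(\<exists>v\<in>span (insert b B). (u, v) \<in> S) \<longleftrightarrow> (\<exists>v\<in>span B. \<exists>t. (u, v + t *\<^sub>R b) \<in> S)" for u
    proof -
      have "v + t *\<^sub>R b \<in> span (insert b B)" if "v \<in> span B" for v t
      proof (intro span_add span_scale)
        show "v \<in> span (insert b B)" using that span_mono[of B "insert b B"] by auto
      qed (simp add: span_base)
      moreover have "\<exists>w\<in>span B. \<exists>t. v = w + t *\<^sub>R b" if "v \<in> span (insert b B)" for v
      proof -
        obtain k where "v - k *\<^sub>R b \<in> span B" using \<open>v \<in> span (insert b B)\<close> unfolding span_insert by blast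
        then show ?thesis by (intro bexI[of _ "v - k *\<^sub>R b"] exI[of _ k]) auto
      qed
      ultimately show ?thesis by (intro iffI) (elim bexE, blast, blast)
    qed
    ultimately show ?case by simp
  qed
  from this[OF finite_Basis assms] show ?thesis by simp
qed

lemma definable_ex:
  fixes P :: "'a::euclidean_space \<Rightarrow> 'b::euclidean_space \<Rightarrow> bool"
  assumes "definable {z. P (fst z) (snd z)}" shows "definable {x. \<exists>y. P x y}"
  using definable_ex_set[OF assms] by simp

lemma definable_all:
  fixes P :: "'a::euclidean_space \<Rightarrow> 'b::euclidean_space \<Rightarrow> bool"
  assumes "definable {z. P (fst z) (snd z)}" shows "definable {x. \<forall>y. P x y}"
  using definable_not[OF definable_ex[of "\<lambda>x y. \<not> P x y"]] definable_not[OF assms] by simp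

text \<open>
  From here on, semialgebraic sets are handled through formulas: the set defined by a formula is
  definable because it is built from polynomial inequalities by connectives and quantifiers.
\<close>

lemma semialgebraic_imp_definable: 
  assumes "semialgebraic_set S" shows "definable S"
proof -
  obtain F where F0: "finite F"
      "\<forall>C\<in>F. finite C \<and> (\<forall>(p, q)\<in>C. real_polynomial_function p \<and> real_polynomial_function q)"
      "S = (\<Union>C\<in>F. \<Inter>(p, q)\<in>C. {u. p u = 0 \<and> q u < 0})"
    using assms unfolding semialgebraic_set_def by (elim exE conjE) (rule that)
  then have F: "finite F" "\<And>C. C \<in> F \<Longrightarrow> finite C"
      "\<And>C p q. C \<in> F \<Longrightarrow> (p, q) \<in> C \<Longrightarrow> real_polynomial_function p \<and> real_polynomial_function q"
      "S = (\<Union>C\<in>F. \<Inter>(p, q)\<in>C. {u. p u = 0 \<and> q u < 0})" by blast+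
  have "definable {u. fst c u = 0 \<and> snd c u < 0}" if "C \<in> F" "c \<in> C" for C c
  proof -
    have "polynomial_function (fst c)" "polynomial_function (snd c)"
      using F(3)[OF that(1), of "fst c" "snd c"] that(2) by (auto simp: real_polynomial_function_eq)
    from definable_conj[OF definable_sgn_eq[OF this(1), of 0] definable_sgn_eq[OF this(2), of "- 1"]]
    show ?thesis by (simp add: sgn_zero_iff sgn_1_neg)
  qed
  then have "definable {u. \<exists>C\<in>F. \<forall>c\<in>C. fst c u = 0 \<and> snd c u < 0}"
    using F(1,2) by (intro definable_finite_Union definable_finite_Inter)
  moreover have "S = {u. \<exists>C\<in>F. \<forall>c\<in>C. fst c u = 0 \<and> snd c u < 0}" 
    unfolding F(4) case_prod_unfold by blast
  ultimately show ?thesis by simp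
qed

definition definable_fun :: "('a::euclidean_space \<Rightarrow> real) \<Rightarrow> bool" where
  "definable_fun h \<longleftrightarrow> definable {z. snd z = h (fst z)}"

lemma definable_zero: "polynomial_function (p :: 'a::euclidean_space \<Rightarrow> real) \<Longrightarrow> definable {x. p x = 0}"
  using definable_sgn_eq[of p 0] by (simp add: sgn_zero_iff)

lemma poly_function_comp:
  "polynomial_function h \<Longrightarrow> polynomial_function m \<Longrightarrow> polynomial_function (\<lambda>x. h (m x))"
  using polynomial_function_compose[of m h] by (simp add: o_def)

lemma definable_fun_poly:
  fixes h :: "'a::euclidean_space \<Rightarrow> real"
  assumes "polynomial_function h" shows "definable_fun h"
proof -
  have "polynomial_function (\<lambda>z :: 'a \<times> real. snd z - h (fst z))"
    by (intro poly_function_intros poly_function_comp[OF assms])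
  from definable_zero[OF this] show ?thesis unfolding definable_fun_def by simp
qed

lemma definable_fun_subst:
  fixes h :: "'a::euclidean_space \<Rightarrow> real"
  assumes "definable_fun h" "definable {z. P (fst z) (snd z)}" shows "definable {x. P x (h x)}"
  using definable_ex[of "\<lambda>x t. t = h x \<and> P x t"] definable_conj[OF assms(1)[unfolded definable_fun_def] assms(2)] by simp

lemma definable_fun_vimage:
  fixes m :: "'b::euclidean_space \<Rightarrow> 'a::euclidean_space"
  assumes "definable_fun h" "polynomial_function m" shows "definable_fun (\<lambda>x. h (m x))"
proof -
  have "definable {x. (m (fst x), snd x) \<in> {z. snd z = h (fst z)}}"
    using assms(1)[unfolded definable_fun_def] 
    by (rule definable_vimage) (intro poly_function_intros poly_function_comp[OF assms(2)])
  then show ?thesis unfolding definable_fun_def by simp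
qed

lemma definable_fun_subst_vimage:
  fixes h :: "'a::euclidean_space \<Rightarrow> real" and m :: "'b::euclidean_space \<Rightarrow> 'a"
  assumes "definable_fun h" "definable {z. P (fst z) (snd z)}" "polynomial_function m"
      shows "definable {x. P x (h (m x))}"
  by (rule definable_fun_subst[OF definable_fun_vimage[OF assms(1,3)] assms(2)])

lemma definable_fun_poly2:
  fixes h k :: "'a::euclidean_space \<Rightarrow> real" and q :: "real \<times> real \<Rightarrow> real"
  assumes h: "definable_fun h" and k: "definable_fun k" and q: "polynomial_function q"
  shows "definable_fun (\<lambda>x. q (h x, k x))"
  unfolding definable_fun_def
proof (rule definable_fun_subst_vimage[OF h _ poly_function_intros(4)[OF polynomial_function_id]],
       rule definable_fun_subst_vimage[OF k])
  show "polynomial_function (\<lambda>z :: ('a \<times> real) \<times> real. fst (fst z))" by (intro poly_function_intros)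
  have "polynomial_function (\<lambda>z :: (('a \<times> real) \<times> real) \<times> real. snd (fst (fst z)) - q (snd (fst z), snd z))"
    by (intro poly_function_intros poly_function_comp[OF q])
  from definable_zero[OF this]
  show "definable {z :: (('a \<times> real) \<times> real) \<times> real. snd (fst (fst z)) = q (snd (fst z), snd z)}" by simp
qed

lemma definable_fun_add: "definable_fun h \<Longrightarrow> definable_fun k \<Longrightarrow> definable_fun (\<lambda>x. h x + k x)"
  using definable_fun_poly2[of h k "\<lambda>z. fst z + snd z"] by (simp add: poly_function_intros)

lemma definable_fun_diff: "definable_fun h \<Longrightarrow> definable_fun k \<Longrightarrow> definable_fun (\<lambda>x. h x - k x)"
  using definable_fun_poly2[of h k "\<lambda>z. fst z - snd z"] by (simp add: poly_function_intros)

lemma definable_fun_mult: "definable_fun h \<Longrightarrow> definable_fun k \<Longrightarrow> definable_fun (\<lambda>x. h x * k x)"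
  using definable_fun_poly2[of h k "\<lambda>z. fst z * snd z"] by (simp add: poly_function_intros)

lemma definable_fun_const: "definable_fun (\<lambda>x. c)"
  by (intro definable_fun_poly poly_function_intros)

lemma definable_fun_minus: "definable_fun h \<Longrightarrow> definable_fun (\<lambda>x. - h x)"
  using definable_fun_diff[OF definable_fun_const[of 0]] by simp

lemma definable_fun_pos:
  fixes h :: "'a::euclidean_space \<Rightarrow> real"
  assumes "definable_fun h" shows "definable {x. 0 < h x}"
  by (rule definable_fun_subst[OF assms]) (intro definable_pos poly_function_intros)

lemma definable_less: "definable_fun h \<Longrightarrow> definable_fun k \<Longrightarrow> definable {x. h x < k x}"
  using definable_fun_pos[OF definable_fun_diff[of k h]] by simp

lemma definable_le: "definable_fun h \<Longrightarrow> definable_fun k \<Longrightarrow> definable {x. h x \<le> k x}"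
  using definable_not[OF definable_less[of k h]] by (simp add: not_less)

lemma definable_eq: "definable_fun h \<Longrightarrow> definable_fun k \<Longrightarrow> definable {x. h x = k x}"
  using definable_conj[OF definable_le[of h k] definable_le[of k h]] by (simp add: order_eq_iff)

lemmas definable_intros = definable_ex definable_all definable_conj definable_disj definable_imp definable_not
  definable_less definable_le definable_eq

lemma definable_fun_abs: 
  assumes "definable_fun h" shows "definable_fun (\<lambda>x. \<bar>h x\<bar>)"
proof -
  have h: "definable_fun (\<lambda>z. h (fst z))"
    by (rule definable_fun_vimage[OF assms]) (intro poly_function_intros)
  have s: "definable_fun (\<lambda>z :: 'a \<times> real. snd z)" by (intro definable_fun_poly poly_function_intros)
  have "definable {z. (0 \<le> h (fst z) \<and> snd z = h (fst z)) \<or> (h (fst z) < 0 \<and> snd z = - h (fst z))}"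
    by (intro definable_intros h s definable_fun_minus definable_fun_const)
  moreover have "(0 \<le> h (fst z) \<and> snd z = h (fst z)) \<or> (h (fst z) < 0 \<and> snd z = - h (fst z)) \<longleftrightarrow>
      snd z = \<bar>h (fst z)\<bar>" for z :: "'a \<times> real"
    by auto
  ultimately show ?thesis unfolding definable_fun_def by simp
qed

section \<open>Definable functions of one variable\<close>

lemma rpf_real_poly:
  fixes p :: "real \<Rightarrow> real"
  assumes "real_polynomial_function p" shows "\<exists>q. \<forall>x. p x = poly q x"
proof -
  from real_polynomial_function_imp_sum[OF assms] obtain c n where c: "p = (\<lambda>x. \<Sum>i\<le>n. c i * x ^ i)" by blast
  show ?thesis unfolding c by (intro exI[of _ "\<Sum>i\<le>n. monom (c i) i"]) (simp add: poly_sum poly_monom)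
qed

text \<open>
  One-dimensional definable sets cannot oscillate, since polynomials have finitely many zeros. This dichotomy
  and its mirror image are the only form of o-minimality used below.
\<close>

lemma definable_germ_right:
  assumes "definable {t::real. P t}"
  shows "eventually P (at_right a) \<or> eventually (\<lambda>t. \<not> P t) (at_right a)"
proof -
  have "eventually (\<lambda>t. t \<in> S) (at_right a) \<or> eventually (\<lambda>t. t \<notin> S) (at_right a)"
      if "definable S" for S :: "real set"
    using that
  proof (induction S rule: definable.induct)
    case (definable_pos p)
    then have "real_polynomial_function p" by (simp add: real_polynomial_function_eq)
    from rpf_real_poly[OF this] obtain q where q: "\<And>x. p x = poly q x" by blast
    show ?case
    proof (cases "q = 0")
      case False
      then have "finite {x. poly q x = 0}" by (rule poly_roots_finite)
      then have "eventually (\<lambda>x. poly q x \<noteq> 0) (at a)"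
        using islimpt_finite[of "{x. poly q x = 0}" a] unfolding islimpt_iff_eventually by simp
      then have "eventually (\<lambda>x. poly q x \<noteq> 0) (at_right a)" by (simp add: eventually_at_split)
      then obtain b where b: "a < b" "\<And>x. a < x \<Longrightarrow> x < b \<Longrightarrow> poly q x \<noteq> 0"
        unfolding eventually_at_right_field by blast
      define m where "m = (a + b) / 2"
      have m: "a < m" "m < b" using b(1) unfolding m_def by auto
      have cont: "continuous_on X (poly q)" for X by (intro continuous_intros)
      have "sgn (poly q x) = sgn (poly q m)" if "a < x" "x < b" for x
      proof (cases "x \<le> m")
        case True
        show ?thesis by (rule sgn_eq_if_no_zero[OF cont True]) (use b(2) m that in auto)
      next
        case False
        then have "m \<le> x" by simp
        have "sgn (poly q m) = sgn (poly q x)"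
            by (rule sgn_eq_if_no_zero[OF cont \<open>m \<le> x\<close>]) (use b(2) m that in auto)
        then show ?thesis by simp
      qed
      then have s: "0 < poly q x \<longleftrightarrow> 0 < poly q m" if "a < x" "x < b" for x using sgn_eqD that by blast
      have "eventually (\<lambda>x. 0 < poly q x \<longleftrightarrow> 0 < poly q m) (at_right a)"
        unfolding eventually_at_right_field using b(1) s by blast
      then show ?thesis unfolding q by (cases "0 < poly q m") auto
    qed (simp add: q)
  next
    case (definable_Int S T)
    then show ?case
    proof (elim disjE)
      assume "eventually (\<lambda>t. t \<in> S) (at_right a)" "eventually (\<lambda>t. t \<in> T) (at_right a)"
      then have "eventually (\<lambda>t. t \<in> S \<inter> T) (at_right a)" by eventually_elim simp
      then show ?thesis by simp
    qed (rule disjI2, erule eventually_mono, simp)+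
  qed auto
  from this[OF assms] show ?thesis by simp
qed

lemma definable_germ_left:
  assumes "definable {t::real. P t}"
  shows "eventually P (at_left a) \<or> eventually (\<lambda>t. \<not> P t) (at_left a)"
proof -
  have "definable {t. - t \<in> {t. P t}}" by (rule definable_vimage[OF assms]) (intro poly_function_intros)
  then have "definable {t. P (- t)}" by simp
  from definable_germ_right[OF this, of "- a"] show ?thesis
    unfolding at_left_minus[of a] eventually_filtermap .
qed

text \<open>
  Each point of the set is followed by a gap, and the gap contains a rational number that belongs to no other gap.
\<close>

lemma countable_if_right_isolated:
  fixes D :: "real set"
  assumes iso: "\<And>a. eventually (\<lambda>t. t \<notin> D) (at_right a)" shows "countable D"
proof -
  have "\<exists>q\<in>\<rat>. a < q \<and> (\<forall>t. a < t \<and> t \<le> q \<longrightarrow> t \<notin> D)" for a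
  proof -
    obtain b where b: "a < b" "\<And>t. a < t \<Longrightarrow> t < b \<Longrightarrow> t \<notin> D"
      using iso[of a] unfolding eventually_at_right_field by blast
    obtain q where "q \<in> \<rat>" "a < q" "q < b" using Rats_dense_in_real[OF b(1)] by blast
    then show ?thesis using b(2) by (intro bexI[of _ q]) auto
  qed
  then obtain q where q: "\<And>a. q a \<in> \<rat>" "\<And>a. a < q a" "\<And>a t. a < t \<Longrightarrow> t \<le> q a \<Longrightarrow> t \<notin> D"
    by metis
  have "inj_on q D"
  proof (rule linorder_inj_onI')
    fix a b assume ab: "a \<in> D" "b \<in> D" "a < b"
    then have "q a < b" using q(3)[of a b] by force
    then show "q a \<noteq> q b" using q(2)[of b] by simp
  qed
  moreover have "countable (q ` D)" by (rule countable_subset[OF _ countable_rat]) (use q(1) in auto)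
  ultimately show ?thesis by (simp add: countable_image_inj_eq)
qed

text \<open>
  The limit is the supremum of the numbers that the function eventually exceeds; the dichotomy makes the
  function eventually stay below every larger number.
\<close>

lemma definable_limit_right:
  fixes h :: "real \<Rightarrow> real"
  assumes h: "definable_fun h" and M: "\<And>t. \<bar>h t\<bar> \<le> M"
  shows "\<exists>L. (h \<longlongrightarrow> L) (at_right a)"
proof -
  define A where "A = {c. eventually (\<lambda>t. c < h t) (at_right a)}"
  have dich: "c \<in> A \<or> eventually (\<lambda>t. h t \<le> c) (at_right a)" for c
    using definable_germ_right[OF definable_less[OF definable_fun_const[of c] h], of a]
    unfolding A_def by (simp add: not_less)
  have "- M - 1 < h t" for t using M[of t] by simp
  then have ne: "- M - 1 \<in> A" unfolding A_def by simp
  have bd: "c \<le> M" if "c \<in> A" for c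
  proof -
    from that have "eventually (\<lambda>t. c < h t) (at_right a)" unfolding A_def by simp
    then obtain t where "c < h t" using eventually_happens'[OF trivial_limit_at_right_real] by blast
    then show ?thesis using M[of t] by simp
  qed
  then have bdd: "bdd_above A" by (rule bdd_aboveI)
  have "(h \<longlongrightarrow> Sup A) (at_right a)"
  proof (rule order_tendstoI)
    fix c assume "c < Sup A"
    then obtain c' where "c' \<in> A" "c < c'" using less_cSup_iff[OF _ bdd] ne by blast
    then show "eventually (\<lambda>t. c < h t) (at_right a)" unfolding A_def by (auto elim: eventually_mono)
  next
    fix c assume "Sup A < c"
    then obtain c' where c': "Sup A < c'" "c' < c" using dense by blast
    then have "c' \<notin> A" using cSup_upper[OF _ bdd] by force
    then have "eventually (\<lambda>t. h t \<le> c') (at_right a)" using dich by blast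
    then show "eventually (\<lambda>t. h t < c) (at_right a)" using c' by (auto elim: eventually_mono)
  qed
  then show ?thesis by blast
qed

text \<open>
  Otherwise every point of some interval \<open>(0, d)\<close> is a jump, and by uncountability jumps of some fixed size \<open>\<eta>\<close> fill
  a whole interval \<open>(a, b)\<close>. That contradicts the existence of the right limit at \<open>a\<close>.
\<close>

lemma definable_right_continuous:
  fixes h :: "real \<Rightarrow> real"
  assumes h: "definable_fun h" and M: "\<And>t. \<bar>h t\<bar> \<le> M"
  shows "eventually (\<lambda>s. (h \<longlongrightarrow> h s) (at_right s)) (at_right 0)"
proof -
  define jump where "jump = (\<lambda>\<eta> s. \<exists>\<epsilon>. 0 < \<epsilon> \<and> (\<forall>s'. s < s' \<and> s' < s + \<epsilon> \<longrightarrow> \<eta> < \<bar>h s' - h s\<bar>))"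
  have cont: "(h \<longlongrightarrow> h s) (at_right s)" if "\<And>\<eta>. 0 < \<eta> \<Longrightarrow> \<not> jump \<eta> s" for s
  proof (rule tendstoI)
    fix e :: real assume "0 < e"
    then have nj: "\<not> jump (e / 2) s" using that by simp
    have "definable {s'. e / 2 < \<bar>h s' - h s\<bar>}"
      by (intro definable_less definable_fun_abs definable_fun_diff h definable_fun_const)
    from definable_germ_right[OF this, of s]
    have "eventually (\<lambda>s'. \<not> e / 2 < \<bar>h s' - h s\<bar>) (at_right s)"
    proof
      assume "eventually (\<lambda>s'. e / 2 < \<bar>h s' - h s\<bar>) (at_right s)"
      then obtain b where "s < b" "\<And>s'. s < s' \<Longrightarrow> s' < b \<Longrightarrow> e / 2 < \<bar>h s' - h s\<bar>"
        unfolding eventually_at_right_field by blast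
      then have "jump (e / 2) s" unfolding jump_def by (intro exI[of _ "b - s"]) auto
      then show ?thesis using nj by simp
    qed
    then show "eventually (\<lambda>s'. dist (h s') (h s) < e) (at_right s)"
      by eventually_elim (use \<open>0 < e\<close> in \<open>auto simp: dist_real_def\<close>)
  qed
  have djump: "definable {z :: real \<times> real. jump (snd z) (fst z)}"
    unfolding jump_def
    by (intro definable_intros definable_fun_abs definable_fun_diff definable_fun_add definable_fun_vimage[OF h]
        definable_fun_poly poly_function_intros)
  have "definable {s. \<exists>\<eta>. 0 < \<eta> \<and> jump \<eta> s}"
    by (intro definable_ex definable_conj djump definable_less definable_fun_poly poly_function_intros)
  from definable_germ_right[OF this, of 0] show ?thesis
  proof
    assume "eventually (\<lambda>s. \<exists>\<eta>. 0 < \<eta> \<and> jump \<eta> s) (at_right 0)"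
    then obtain d where d: "0 < d" "\<And>s. 0 < s \<Longrightarrow> s < d \<Longrightarrow> \<exists>\<eta>. 0 < \<eta> \<and> jump \<eta> s"
      unfolding eventually_at_right_field by blast
    \<comment> \<open>Jumps larger than \<open>1 / (n + 1)\<close>.\<close>
    define D where "D n = {s. jump (1 / real (Suc n)) s}" for n
    have "{0<..<d} \<subseteq> (\<Union>n. D n)"
    proof
      fix s assume "s \<in> {0<..<d}"
      then obtain \<eta> where \<eta>: "0 < \<eta>" "jump \<eta> s" using d(2) by auto
      obtain n where "1 / real (Suc n) < \<eta>" using nat_approx_posE[OF \<eta>(1)] .
      then have "jump (1 / real (Suc n)) s" using \<eta>(2) unfolding jump_def by (meson less_trans)
      then show "s \<in> (\<Union>n. D n)" unfolding D_def by blast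
    qed
    moreover have "uncountable {0<..<d}" using d(1) by (simp add: uncountable_open_interval)
    ultimately have "uncountable (\<Union>n. D n)" using countable_subset by blast
    then obtain n where n: "uncountable (D n)" by (auto simp: countable_UN)
    define \<eta> where "\<eta> = 1 / real (Suc n)"
    have "\<exists>a. \<not> eventually (\<lambda>t. t \<notin> D n) (at_right a)" using countable_if_right_isolated[of "D n"] n by blast
    then obtain a where a: "\<not> eventually (\<lambda>t. t \<notin> D n) (at_right a)" ..
    have "definable {s :: real. (s, \<eta>) \<in> {z. jump (snd z) (fst z)}}"
      by (rule definable_vimage[OF djump]) (intro poly_function_intros)
    then have "definable {s. jump \<eta> s}" by simp
    from definable_germ_right[OF this, of a] a
    have ev: "eventually (\<lambda>s. jump \<eta> s) (at_right a)" unfolding D_def \<eta>_def by simp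
    obtain l where l: "(h \<longlongrightarrow> l) (at_right a)" using definable_limit_right[OF h M] by blast
    have \<eta>: "0 < \<eta>" unfolding \<eta>_def by simp
    have "eventually (\<lambda>s. dist (h s) l < \<eta> / 2) (at_right a)" 
      by (rule tendstoD[OF l]) (use \<eta> in simp)
    with ev have "eventually (\<lambda>s. jump \<eta> s \<and> dist (h s) l < \<eta> / 2) (at_right a)" by eventually_elim simp
    then obtain b where b: "a < b" "\<And>s. a < s \<Longrightarrow> s < b \<Longrightarrow> jump \<eta> s \<and> dist (h s) l < \<eta> / 2"
      unfolding eventually_at_right_field by blast
    define s where "s = (a + b) / 2"
    have s: "a < s" "s < b" using b(1) unfolding s_def by auto
    obtain e where e: "0 < e" "\<And>s'. s < s' \<Longrightarrow> s' < s + e \<Longrightarrow> \<eta> < \<bar>h s' - h s\<bar>"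
      using b(2)[OF s] unfolding jump_def by blast
    define s' where "s' = min (s + e / 2) ((s + b) / 2)"
    have s': "s < s'" "s' < s + e" "s' < b" using e(1) s unfolding s'_def by (auto simp: min_def field_simps)
    have "\<eta> < \<bar>h s' - h s\<bar>" using e(2) s' by blast
    moreover have "dist (h s) l < \<eta> / 2" "dist (h s') l < \<eta> / 2" using b(2) s s' by auto
    ultimately have False unfolding dist_real_def by linarith
    then show ?thesis ..
  next
    assume "eventually (\<lambda>s. \<not> (\<exists>\<eta>. 0 < \<eta> \<and> jump \<eta> s)) (at_right 0)"
    then show ?thesis by eventually_elim (use cont in blast)
  qed
qed

lemma definable_fun_power: "definable_fun h \<Longrightarrow> definable_fun (\<lambda>x. h x ^ n)"
  by (induction n) (simp_all add: definable_fun_const definable_fun_mult)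

lemma definable_fun_sum: "finite I \<Longrightarrow> (\<And>i. i \<in> I \<Longrightarrow> definable_fun (f i)) \<Longrightarrow> definable_fun (\<lambda>x. \<Sum>i\<in>I. f i x)"
  by (induction I rule: finite_induct) (simp_all add: definable_fun_const definable_fun_add)

text \<open>
  The graph is described by the signs of finitely many polynomials. If none of those that are nonzero at \<open>t\<close> vanished at
  \<open>h t\<close>, these signs would not change near \<open>h t\<close>, and the graph would contain a whole segment over \<open>t\<close>. The dichotomy
  selects one polynomial for all small \<open>t\<close>.
\<close>

lemma definable_fun_algebraic:
  fixes h :: "real \<Rightarrow> real"
  assumes h: "definable_fun h"
  shows "\<exists>n P. parametric_poly n P \<and> eventually (\<lambda>t. P t \<noteq> 0 \<and> poly (P t) (h t) = 0) (at_right 0)"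
proof -
  obtain n \<Phi> where \<Phi>: "finite \<Phi>" "\<And>P. P \<in> \<Phi> \<Longrightarrow>
      parametric_poly n P" and S: "determined_by_signs {z. snd z = h (fst z)} \<Phi>"
    using definable_determined_by_signs[OF h[unfolded definable_fun_def]] by blast
  have root: "\<exists>P\<in>\<Phi>. P t \<noteq> 0 \<and> poly (P t) (h t) = 0" for t
  proof (rule ccontr)
    assume no: "\<not> (\<exists>P\<in>\<Phi>. P t \<noteq> 0 \<and> poly (P t) (h t) = 0)"
    let ?F = "\<lambda>P. poly (P t)"
    have tm: "tame \<Phi> ?F" by (rule tame_poly[OF \<Phi>(1)])
    have nm: "\<not> mark \<Phi> ?F (h t)" using no unfolding mark_def by force
    have "eventually (\<lambda>y. \<not> mark \<Phi> ?F y) (at (h t))"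
      using islimpt_finite[OF finite_marks[OF tm], of "h t"] unfolding islimpt_iff_eventually by simp
    then have "eventually (\<lambda>y. \<not> mark \<Phi> ?F y) (at_right (h t))" by (simp add: eventually_at_split)
    then obtain b where b: "h t < b" "\<And>y. h t < y \<Longrightarrow> y < b \<Longrightarrow> \<not> mark \<Phi> ?F y"
      unfolding eventually_at_right_field by blast
    define y where "y = (h t + b) / 2"
    have y: "h t < y" "y < b" using b(1) unfolding y_def by auto
    have "sgn_const \<Phi> ?F {h t..y}"
    proof (rule sgn_const_if_no_mark[OF tm])
      show "\<not> mark \<Phi> ?F z" if "z \<in> {h t..y}" for z using that b(2)[of z] y nm by (cases "z = h t") auto
    qed
    then have "sgn (poly (P t) (h t)) = sgn (poly (P t) y)" if "P \<in> \<Phi>" for P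
      using sgn_constD[of \<Phi> ?F "{h t..y}" P "h t" y] that y by auto
    then have "(t, y) \<in> {z. snd z = h (fst z)}" using determined_by_signsD[OF S, of t "h t" t y] by simp
    then show False using y by simp
  qed
  have def: "definable {t. P t \<noteq> 0 \<and> poly (P t) (h t) = 0}" if "P \<in> \<Phi>" for P
  proof -
    have c: "definable_fun (\<lambda>t. coeff (P t) i)" for i
      using parametric_polyD(2)[OF \<Phi>(2)[OF that]]
          by (intro definable_fun_poly) (simp add: real_polynomial_function_eq)
    have e: "poly (P t) y = (\<Sum>i\<le>n. coeff (P t) i * y ^ i)" for t y
      using parametric_polyD(3)[OF \<Phi>(2)[OF that], of _ t] parametric_polyD(1)[OF \<Phi>(2)[OF that], of t]
      unfolding poly_altdef by (intro sum.mono_neutral_left) (auto simp: coeff_eq_0)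
    have z: "P t \<noteq> 0 \<longleftrightarrow> (\<exists>i\<in>{..n}. coeff (P t) i \<noteq> 0)" for t
      using parametric_polyD(3)[OF \<Phi>(2)[OF that], of _ t] by (auto simp: poly_eq_iff not_le[symmetric])
    show ?thesis unfolding z e
      by (intro definable_conj definable_finite_Union definable_not definable_eq definable_fun_sum definable_fun_mult
          definable_fun_power c h definable_fun_const) auto
  qed
  have "\<exists>P\<in>\<Phi>. eventually (\<lambda>t. P t \<noteq> 0 \<and> poly (P t) (h t) = 0) (at_right 0)"
  proof (rule ccontr)
    assume "\<not> ?thesis"
    then have "\<forall>P\<in>\<Phi>. eventually (\<lambda>t. \<not> (P t \<noteq> 0 \<and> poly (P t) (h t) = 0)) (at_right 0)"
      using definable_germ_right[OF def] by blast
    then have "eventually (\<lambda>t. \<forall>P\<in>\<Phi>. \<not> (P t \<noteq> 0 \<and> poly (P t) (h t) = 0)) (at_right 0)"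
      by (rule eventually_ball_finite[OF \<Phi>(1)])
    then have "eventually (\<lambda>t. False) (at_right (0 :: real))" by eventually_elim (use root in blast)
    then show False by simp
  qed
  then show ?thesis using \<Phi>(2) by blast
qed

section \<open>Growth of definable functions at the origin\<close>

text \<open>
  Dividing out the largest common power of the variable, so that the equation survives at \<open>0\<close>.
\<close>

lemma common_order:
  fixes \<alpha> :: "nat \<Rightarrow> real poly"
  assumes "\<exists>i\<le>n. \<alpha> i \<noteq> 0"
  shows "\<exists>e b. (\<forall>i\<le>n. \<alpha> i = [:0, 1:] ^ e * b i) \<and> (\<exists>i\<le>n. poly (b i) 0 \<noteq> 0)"
proof -
  let ?I = "{i. i \<le> n \<and> \<alpha> i \<noteq> 0}"
  define e where "e = Min ((\<lambda>i. order 0 (\<alpha> i)) ` ?I)"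
  have fin: "finite ?I" by simp
  have ne: "?I \<noteq> {}" using assms by auto
  have le: "e \<le> order 0 (\<alpha> i)" if "i \<in> ?I" for i unfolding e_def using fin that by (intro Min_le) auto
  have "e \<in> (\<lambda>i. order 0 (\<alpha> i)) ` ?I" unfolding e_def using fin ne by (intro Min_in) auto
  then obtain k where k: "k \<in> ?I" "order 0 (\<alpha> k) = e" by auto
  have "[:0, 1:] ^ e dvd \<alpha> i" if "i \<le> n" for i
  proof (cases "\<alpha> i = 0")
    case False
    have "[:- 0, 1:] ^ order 0 (\<alpha> i) dvd \<alpha> i" by (rule order_1)
    moreover have "[:0, 1::real:] ^ e dvd [:- 0, 1:] ^ order 0 (\<alpha> i)" using le[of i] False that
        by (simp add: le_imp_power_dvd)
    ultimately show ?thesis by (rule dvd_trans[rotated])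
  qed simp
  then have "\<forall>i. \<exists>c. i \<le> n \<longrightarrow> \<alpha> i = [:0, 1:] ^ e * c" by (auto elim: dvdE)
  then obtain b where b: "\<And>i. i \<le> n \<Longrightarrow> \<alpha> i = [:0, 1:] ^ e * b i" by metis
  have "poly (b k) 0 \<noteq> 0"
  proof
    assume "poly (b k) 0 = 0"
    then have "[:- 0, 1:] dvd b k" by (simp only: poly_eq_0_iff_dvd)
    then obtain c where "b k = [:0, 1:] * c" by (auto elim: dvdE)
    then have "\<alpha> k = [:- 0, 1:] ^ Suc e * c" using b[of k] k by (simp add: mult.assoc)
    then have "[:- 0, 1:] ^ Suc (order 0 (\<alpha> k)) dvd \<alpha> k" using k by (metis dvd_triv_left)
    then show False using order_2[of "\<alpha> k" 0] k by auto
  qed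
  then show ?thesis using b k by blast
qed

lemma poly_Lipschitz_at_0:
  fixes b :: "real poly"
  shows "\<exists>K\<ge>0. \<forall>t\<in>{0..1}. \<bar>poly b t - poly b 0\<bar> \<le> K * t"
proof -
  obtain a d where b: "b = pCons a d" by (cases b)
  have "compact (poly d ` {0..1})" by (intro compact_continuous_image continuous_intros) auto
  then have "bounded (poly d ` {0..1})" by (rule compact_imp_bounded)
  then obtain K where K: "K > 0" "\<And>x. x \<in> poly d ` {0..1} \<Longrightarrow> norm x \<le> K" using bounded_normE by metis
  have "\<bar>poly b t - poly b 0\<bar> \<le> K * t" if "t \<in> {0..1}" for t
    using K(2)[of "poly d t"] that unfolding b by (simp add: abs_mult mult.commute[of K] mult_left_mono)
  then show ?thesis using K(1) by (intro exI[of _ K]) auto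
qed

text \<open>
  A weak form of the Puiseux expansion. Divide the equation for \<open>h\<close> by the common power of \<open>t\<close>; at \<open>t = 0\<close> a nonzero
  polynomial \<open>B = y ^ k * C\<close> with \<open>C 0 \<noteq> 0\<close> remains, and \<open>B (h t)\<close> differs from \<open>0\<close> by at most a multiple of
  \<open>t\<close>. Hence \<open>\<bar>h t\<bar> ^ k\<close> is bounded by a multiple of \<open>t\<close>.
\<close>

lemma algebraic_growth:
  fixes h :: "real \<Rightarrow> real"
  assumes P: "parametric_poly n P" and ev: "eventually (\<lambda>t. P t \<noteq> 0 \<and> poly (P t) (h t) = 0) (at_right 0)"
    and lim: "(h \<longlongrightarrow> 0) (at_right 0)"
  shows "\<exists>A m. A > 0 \<and> m \<ge> (2::nat) \<and> eventually (\<lambda>t. \<bar>h t\<bar> \<le> A * root m t) (at_right 0)"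
proof -
  obtain \<alpha> where \<alpha>: "\<And>i t. coeff (P t) i = poly (\<alpha> i) t"
    using rpf_real_poly[OF parametric_polyD(2)[OF P]] by metis
  obtain t0 where "P t0 \<noteq> 0" using eventually_happens'[OF trivial_limit_at_right_real ev] by blast
  then obtain i where "coeff (P t0) i \<noteq> 0" by (auto simp: poly_eq_iff)
  then have "i \<le> n" "\<alpha> i \<noteq> 0" using parametric_polyD(3)[OF P, of i t0] \<alpha>[of t0 i]
      by (auto simp: not_less[symmetric])
  then have "\<exists>i\<le>n. \<alpha> i \<noteq> 0" by blast
  from common_order[OF this] obtain e b where b: "\<And>i. i \<le> n \<Longrightarrow> \<alpha> i = [:0, 1:] ^ e * b i"
      and b0: "\<exists>i\<le>n. poly (b i) 0 \<noteq> 0" by blast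
  have rel: "(\<Sum>i\<le>n. poly (b i) t * h t ^ i) = 0" if "0 < t" "poly (P t) (h t) = 0" for t
  proof -
    have "poly (P t) (h t) = (\<Sum>i\<le>n. coeff (P t) i * h t ^ i)"
      using parametric_polyD(3)[OF P, of _ t] parametric_polyD(1)[OF P, of t]
      unfolding poly_altdef by (intro sum.mono_neutral_left) (auto simp: coeff_eq_0)
    also have "\<dots> = (\<Sum>i\<le>n. t ^ e * (poly (b i) t * h t ^ i))"
      by (intro sum.cong) (auto simp: \<alpha> b mult.assoc)
    also have "\<dots> = t ^ e * (\<Sum>i\<le>n. poly (b i) t * h t ^ i)" by (simp add: sum_distrib_left)
    finally show ?thesis using that by simp
  qed
  define B where "B = (\<Sum>i\<le>n. monom (poly (b i) 0) i)"
  have pB: "poly B y = (\<Sum>i\<le>n. poly (b i) 0 * y ^ i)" for y unfolding B_def by (simp add: poly_sum poly_monom)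
  have "coeff B i = (if i \<le> n then poly (b i) 0 else 0)" for i
    unfolding B_def by (simp add: coeff_sum coeff_monom if_distrib sum.delta cong: if_cong)
  then have B0: "B \<noteq> 0" using b0 by (metis coeff_0)
  define k where "k = order 0 B"
  obtain C where C: "B = [:- 0, 1:] ^ k * C" "\<not> [:- 0, 1:] dvd C" using order_decomp[OF B0, of 0]
      unfolding k_def by blast
  have C0: "poly C 0 \<noteq> 0" using C(2) by (simp only: poly_eq_0_iff_dvd not_False_eq_True)
  have pBC: "poly B y = y ^ k * poly C y" for y unfolding C(1) by simp
  obtain K where K: "\<And>i. K i \<ge> 0" "\<And>i t. t \<in> {0..1} \<Longrightarrow> \<bar>poly (b i) t - poly (b i) 0\<bar> \<le> K i * t"
    using poly_Lipschitz_at_0[of "b _"] by metis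
  define c where "c = \<bar>poly C 0\<bar> / 2"
  define K' where "K' = (\<Sum>i\<le>n. K i) / c + 1"
  have c: "c > 0" using C0 unfolding c_def by simp
  have K': "K' > 0" using K(1) c unfolding K'_def by (intro add_nonneg_pos divide_nonneg_pos sum_nonneg) auto
  have "((\<lambda>t. \<bar>poly C (h t)\<bar>) \<longlongrightarrow> \<bar>poly C 0\<bar>) (at_right 0)" by (intro tendsto_intros lim)
  moreover have "c < \<bar>poly C 0\<bar>" using C0 unfolding c_def by simp
  ultimately have ev1: "eventually (\<lambda>t. c < \<bar>poly C (h t)\<bar>) (at_right 0)" by (rule order_tendstoD(1))
  have "((\<lambda>t. \<bar>h t\<bar>) \<longlongrightarrow> \<bar>0\<bar>) (at_right 0)" by (intro tendsto_intros lim)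
  then have ev2: "eventually (\<lambda>t. \<bar>h t\<bar> < 1) (at_right 0)" by (rule order_tendstoD(2)) simp
  have ev3: "eventually (\<lambda>t. t \<in> {0<..<1::real}) (at_right 0)" by (rule eventually_at_right_real) simp
  \<comment> \<open>The exponent \<open>k + 2\<close> instead of \<open>k\<close> weakens the bound but excludes the exponents \<open>0\<close> and \<open>1\<close>.\<close>
  have "eventually (\<lambda>t. \<bar>h t\<bar> \<le> root (k + 2) K' * root (k + 2) t) (at_right 0)"
    using ev ev1 ev2 ev3
  proof eventually_elim
    case (elim t)
    have "\<bar>poly B (h t)\<bar> = \<bar>\<Sum>i\<le>n. (poly (b i) t - poly (b i) 0) * h t ^ i\<bar>"
      using rel[of t] elim unfolding pB by (simp add: left_diff_distrib sum_subtractf)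
    also have "\<dots> \<le> (\<Sum>i\<le>n. \<bar>(poly (b i) t - poly (b i) 0) * h t ^ i\<bar>)" by (rule sum_abs)
    also have "\<dots> \<le> (\<Sum>i\<le>n. K i * t)"
    proof (rule sum_mono)
      fix i
      have "\<bar>h t ^ i\<bar> \<le> 1" using elim by (simp add: power_abs power_le_one)
      then have "\<bar>poly (b i) t - poly (b i) 0\<bar> * \<bar>h t ^ i\<bar> \<le> (K i * t) * 1"
        using K(2)[of t i] elim by (intro mult_mono) auto
      then show "\<bar>(poly (b i) t - poly (b i) 0) * h t ^ i\<bar> \<le> K i * t" by (simp add: abs_mult)
    qed
    finally have 1: "\<bar>h t\<bar> ^ k * \<bar>poly C (h t)\<bar> \<le> (\<Sum>i\<le>n. K i) * t"
      unfolding pBC by (simp add: abs_mult power_abs sum_distrib_right)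
    have "\<bar>h t\<bar> ^ k * c \<le> \<bar>h t\<bar> ^ k * \<bar>poly C (h t)\<bar>" using elim by (intro mult_left_mono) auto
    with 1 have "\<bar>h t\<bar> ^ k * c \<le> (\<Sum>i\<le>n. K i) * t" by simp
    then have "\<bar>h t\<bar> ^ k \<le> (\<Sum>i\<le>n. K i) / c * t" using c by (simp add: field_simps)
    also have "\<dots> \<le> K' * t" unfolding K'_def using elim by (intro mult_right_mono) auto
    finally have "\<bar>h t\<bar> ^ k \<le> K' * t" .
    moreover have "\<bar>h t\<bar> ^ (k + 2) \<le> \<bar>h t\<bar> ^ k" using elim by (intro power_decreasing) auto
    ultimately have "\<bar>h t\<bar> ^ (k + 2) \<le> K' * t" by simp
    then have "root (k + 2) (\<bar>h t\<bar> ^ (k + 2)) \<le> root (k + 2) (K' * t)" by (simp only: real_root_le_iff)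
    moreover have "root (k + 2) (\<bar>h t\<bar> ^ (k + 2)) = \<bar>h t\<bar>" by (rule real_root_power_cancel) auto
    ultimately show ?case by (simp add: real_root_mult)
  qed
  moreover have "root (k + 2) K' > 0" using K' by simp
  ultimately show ?thesis by (intro exI[of _ "root (k + 2) K'"] exI[of _ "k + 2"]) auto
qed

text \<open>
  The root cut off at \<open>0\<close>, so that its graph is given by one formula for every \<open>m\<close>.
\<close>

definition pos_root :: "nat \<Rightarrow> real \<Rightarrow> real" where
  "pos_root m s = (if 0 < s then root m s else 0)"

lemma definable_pos_root: assumes "m > 0" shows "definable_fun (pos_root m)"
proof -
  have "snd z = pos_root m (fst z) \<longleftrightarrow> (0 < fst z \<and> 0 < snd z \<and> snd z ^ m = fst z) \<or> (\<not> 0 < fst z \<and> snd z = 0)"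
    for z :: "real \<times> real"
    using assms
        by (auto simp: pos_root_def real_root_pos_unique[symmetric] real_root_pow_pos2 real_root_gt_zero real_root_power_cancel)
  moreover have "definable {z :: real \<times> real. (0 < fst z \<and> 0 < snd z \<and> snd z ^ m = fst z) \<or> (\<not> 0 < fst z \<and>
      snd z = 0)}"
    by (intro definable_intros definable_fun_const definable_fun_poly poly_function_intros)
  ultimately show ?thesis unfolding definable_fun_def by simp
qed

lemma root_quotient_mono:
  assumes "0 < s" "s \<le> b" "0 < m" shows "root m b / b \<le> root m s / s"
proof -
  obtain k where m: "m = Suc k" using assms(3) by (cases m) auto
  define x y where "x = root m s" and "y = root m b"
  have x: "x > 0" "x ^ m = s" and y: "x \<le> y" "y ^ m = b"
    using assms unfolding x_def y_def by (auto simp: real_root_pow_pos2)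
  have "y * s = (x * y) * x ^ k" using x m by (simp add: x(2)[symmetric])
  also have "\<dots> \<le> (x * y) * y ^ k" using x y by (intro mult_left_mono power_mono) auto
  also have "\<dots> = x * b" using y m by (simp add: y(2)[symmetric])
  finally show ?thesis using assms unfolding x_def[symmetric] y_def[symmetric] by (simp add: divide_simps)
qed

text \<open>
  By the dichotomy, the bound holds for all small \<open>s\<close> or fails for all small \<open>s\<close>. If it failed, then \<open>h\<close> would rise at
  a rate above \<open>5 * A * root m b / b\<close> at every point of \<open>[b / 2, b]\<close>, and right continuity would integrate this to a
  rise of \<open>5 / 2 * A * root m b\<close> over the interval; but \<open>h\<close> stays within \<open>A * root m b\<close> of \<open>L\<close> there.
\<close>

lemma left_quotient_bound_aux:
  fixes h :: "real \<Rightarrow> real"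
  assumes h: "definable_fun h" and M: "\<And>t. \<bar>h t\<bar> \<le> M"
    and gr: "eventually (\<lambda>t. \<bar>h t - L\<bar> \<le> A * root m t) (at_right 0)" and A: "A > 0" and m: "m > 0"
  shows "eventually (\<lambda>s. eventually (\<lambda>s'. s * (h s - h s') \<le>
      5 * A * pos_root m s * (s - s')) (at_left s)) (at_right 0)"
proof -
  define T where "T = (\<lambda>s. \<exists>\<epsilon>. 0 < \<epsilon> \<and> (\<forall>s'. s - \<epsilon> < s' \<and> s' < s \<longrightarrow>
      5 * A * pos_root m s * (s - s') < s * (h s - h s')))"
  have notT: "eventually (\<lambda>s'. s * (h s - h s') \<le> 5 * A * pos_root m s * (s - s')) (at_left s)" if "\<not> T s" for s
  proof -
    have "definable {s'. 5 * A * pos_root m s * (s - s') < s * (h s - h s')}"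
      by (intro definable_less definable_fun_mult definable_fun_diff h definable_fun_const definable_fun_poly poly_function_intros)
    from definable_germ_left[OF this, of s] show ?thesis
    proof
      assume "eventually (\<lambda>s'. 5 * A * pos_root m s * (s - s') < s * (h s - h s')) (at_left s)"
      then obtain b where "b < s" "\<And>s'. b < s' \<Longrightarrow> s' < s \<Longrightarrow> 5 * A * pos_root m s * (s - s') < s * (h s - h s')"
        unfolding eventually_at_left_field by blast
      then have "T s" unfolding T_def by (intro exI[of _ "s - b"]) auto
      then show ?thesis using that by simp
    qed (simp add: not_less)
  qed
  have "definable {s. T s}" unfolding T_def
    by (intro definable_intros definable_fun_mult definable_fun_diff definable_fun_vimage[OF h]
      definable_fun_vimage[OF definable_pos_root[OF m]] definable_fun_const definable_fun_poly poly_function_intros)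
  from definable_germ_right[OF this, of 0] show ?thesis
  proof
    assume T: "eventually T (at_right 0)"
    have "eventually (\<lambda>s. T s \<and> (h \<longlongrightarrow> h s) (at_right s) \<and> \<bar>h s - L\<bar> \<le> A * root m s) (at_right 0)"
      using T definable_right_continuous[OF h M] gr by eventually_elim simp
    then obtain b0 where b0: "0 < b0" "\<And>s. 0 < s \<Longrightarrow> s < b0 \<Longrightarrow>
        T s \<and> (h \<longlongrightarrow> h s) (at_right s) \<and> \<bar>h s - L\<bar> \<le> A * root m s"
      unfolding eventually_at_right_field by blast
    define b where "b = b0 / 2"
    define a where "a = b / 2"
    have ab: "0 < a" "a < b" "b < b0" using b0(1) unfolding a_def b_def by auto
    define K where "K = 5 * A * (root m b / b)"
    have K: "K \<ge> 0" unfolding K_def using A ab m by simp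
    have loc: "\<exists>\<epsilon>>0. \<forall>s'. s - \<epsilon> < s' \<and> s' < s \<longrightarrow> K * (s - s') \<le> h s - h s'" if "a \<le> s" "s \<le> b" for s
    proof -
      have s: "0 < s" "s < b0" using that ab by auto
      obtain e where e: "0 < e" "\<And>s'. s - e < s' \<Longrightarrow> s' < s \<Longrightarrow> 5 * A * pos_root m s * (s - s') < s * (h s - h s')"
        using b0(2)[OF s] unfolding T_def by blast
      have "K * (s - s') \<le> h s - h s'" if "s - e < s'" "s' < s" for s'
      proof -
        have "K * (s - s') \<le> 5 * A * (root m s / s) * (s - s')"
          unfolding K_def using root_quotient_mono[of s b m] s \<open>s \<le> b\<close> m A that
              by (intro mult_right_mono mult_left_mono) auto
        also have "\<dots> = 5 * A * pos_root m s * (s - s') / s" using s by (simp add: pos_root_def)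
        also have "\<dots> \<le> s * (h s - h s') / s" using e(2)[OF that] s by (intro divide_right_mono) auto
        also have "\<dots> = h s - h s'" using s by simp
        finally show ?thesis .
      qed
      then show ?thesis using e(1) by blast
    qed
    \<comment> \<open>Points down to which the rise from the right end has been established; its infimum is shown to be \<open>a\<close>.\<close>
    define X where "X = {x. a \<le> x \<and> x \<le> b \<and> (\<forall>w. x \<le> w \<and> w \<le> b \<longrightarrow> K * (b - w) \<le> h b - h w)}"
    have bX: "b \<in> X" unfolding X_def using ab by auto
    have bdd: "bdd_below X" unfolding X_def by (auto intro: bdd_belowI[of _ a])
    define x0 where "x0 = Inf X"
    have x0: "a \<le> x0" "x0 \<le> b" unfolding x0_def using bX bdd
        by (auto simp: X_def intro!: cInf_greatest cInf_lower)
    have above: "K * (b - w) \<le> h b - h w" if w: "x0 < w" "w \<le> b" for w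
    proof -
      obtain x where "x \<in> X" "x < w" using cInf_less_iff[of X w] bX bdd w unfolding x0_def by blast
      then show ?thesis using w unfolding X_def by auto
    qed
    have at0: "K * (b - x0) \<le> h b - h x0"
    proof (cases "x0 = b")
      case False
      then have lt: "x0 < b" using x0 by simp
      have "(h \<longlongrightarrow> h x0) (at_right x0)" using b0(2)[of x0] x0 ab by auto
      then have l1: "((\<lambda>w. h b - h w) \<longlongrightarrow> h b - h x0) (at_right x0)" by (intro tendsto_intros)
      have l2: "((\<lambda>w. K * (b - w)) \<longlongrightarrow> K * (b - x0)) (at_right x0)" by (intro tendsto_intros)
      have "eventually (\<lambda>w. w \<in> {x0<..<b}) (at_right x0)" by (rule eventually_at_right_real[OF lt])
      then have "eventually (\<lambda>w. K * (b - w) \<le> h b - h w) (at_right x0)" by eventually_elim (use above in auto)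
      then show ?thesis by (rule tendsto_le[OF trivial_limit_at_right_real l1 l2])
    qed simp
    have "x0 = a"
    proof (rule ccontr)
      assume "x0 \<noteq> a"
      then have lt: "a < x0" using x0 by simp
      obtain e where e: "0 < e" "\<And>s'. x0 - e < s' \<Longrightarrow> s' < x0 \<Longrightarrow> K * (x0 - s') \<le> h x0 - h s'"
        using loc[OF x0] by blast
      define x1 where "x1 = max a (x0 - e / 2)"
      have x1: "a \<le> x1" "x1 < x0" "x0 - e < x1" using lt e(1) unfolding x1_def by auto
      have "K * (b - w) \<le> h b - h w" if "x1 \<le> w" "w \<le> b" for w
      proof -
        consider "x0 < w" | "w = x0" | "w < x0" by linarith
        then show ?thesis
        proof cases
          case 3
          then have "K * (x0 - w) \<le> h x0 - h w" using e(2) x1 that by auto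
          with at0 show ?thesis by (simp add: algebra_simps)
        qed (use above at0 that in auto)
      qed
      then have "x1 \<in> X" unfolding X_def using x1 x0 by auto
      then have "x0 \<le> x1" unfolding x0_def using bdd by (rule cInf_lower)
      then show False using x1 by simp
    qed
    then have "K * (b - a) \<le> h b - h a" using at0 by simp
    also have "\<dots> \<le> A * root m b + A * root m a" using b0(2)[of a] b0(2)[of b] ab by auto
    also have "\<dots> \<le> A * root m b + A * root m b" using ab m A by (intro add_left_mono mult_left_mono) auto
    finally have "K * (b - a) \<le> 2 * (A * root m b)" by simp
    moreover have "K * (b - a) = 5 / 2 * (A * root m b)" unfolding K_def a_def using ab
        by (simp add: field_simps)
    moreover have "A * root m b > 0" using A ab m by simp
    ultimately show ?thesis by simp
  next
    assume "eventually (\<lambda>s. \<not> T s) (at_right 0)"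
    then show ?thesis by eventually_elim (rule notT)
  qed
qed

lemma pos_root_mono_exp:
  assumes "0 < s" "s \<le> 1" "0 < m" "m \<le> k" shows "pos_root m s \<le> pos_root k s"
  using real_root_increasing[of m k s] assms unfolding pos_root_def by (cases "m = k") auto

text \<open>
  This replaces the statement that the derivative of a bounded semialgebraic function grows at most like a power
  \<open>s powr (1 / m - 1)\<close>. The exponent above \<open>-1\<close> is what makes the Lojasiewicz exponent smaller than \<open>1\<close>.
\<close>

lemma definable_left_quotient_bound:
  fixes h :: "real \<Rightarrow> real"
  assumes h: "definable_fun h" and M: "\<And>t. \<bar>h t\<bar> \<le> M"
  shows "\<exists>C m. C > 0 \<and> m \<ge> (2::nat) \<and>
    eventually (\<lambda>s. eventually (\<lambda>s'. s * \<bar>h s - h s'\<bar> \<le> C * pos_root m s * (s - s')) (at_left s)) (at_right 0)"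
proof -
  obtain L where L: "(h \<longlongrightarrow> L) (at_right 0)" using definable_limit_right[OF h M] by blast
  have dL: "definable_fun (\<lambda>t. h t - L)" by (intro definable_fun_diff h definable_fun_const)
  obtain n P where P: "parametric_poly n P" "eventually (\<lambda>t. P t \<noteq> 0 \<and> poly (P t) (h t - L) = 0) (at_right 0)"
    using definable_fun_algebraic[OF dL] by blast
  have "((\<lambda>t. h t - L) \<longlongrightarrow> L - L) (at_right 0)" by (intro tendsto_intros L)
  then have lim: "((\<lambda>t. h t - L) \<longlongrightarrow> 0) (at_right 0)" by simp
  obtain A m where A: "A > 0" and m: "m \<ge> (2::nat)" and gr: "eventually (\<lambda>t. \<bar>h t - L\<bar> \<le>
      A * root m t) (at_right 0)"
    using algebraic_growth[OF P lim] by blast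
  have gr': "eventually (\<lambda>t. \<bar>- h t - (- L)\<bar> \<le> A * root m t) (at_right 0)"
    using gr by eventually_elim (simp add: abs_minus_commute)
  have m0: "m > 0" using m by simp
  have M': "\<bar>- h t\<bar> \<le> M" for t using M by simp
  from left_quotient_bound_aux[OF h M gr A m0] left_quotient_bound_aux[OF definable_fun_minus[OF h] M' gr' A m0]
  have "eventually (\<lambda>s. eventually (\<lambda>s'. s * \<bar>h s - h s'\<bar> \<le>
      5 * A * pos_root m s * (s - s')) (at_left s)) (at_right 0)"
  proof eventually_elim
    case (elim s)
    then show ?case
    proof eventually_elim
      case (elim s')
      have "s * \<bar>h s - h s'\<bar> = s * (h s - h s') \<or> s * \<bar>h s - h s'\<bar> = s * (- h s - - h s')"
          by (auto simp: abs_if)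
      then show ?case using elim by auto
    qed
  qed
  then show ?thesis using A m by (intro exI[of _ "5 * A"] exI[of _ m]) auto
qed

section \<open>The Kurdyka--Lojasiewicz inequality\<close>

text \<open>
  Minimizing one coordinate after the other keeps the fibers compact and definable.
\<close>

lemma definable_fiber_minimum:
  fixes W :: "(real \<times> 'e::euclidean_space) set"
  assumes W: "definable W" and comp: "\<And>t. t \<in> {0<..<\<delta>} \<Longrightarrow> compact {v. (t, v) \<in> W} \<and> {v. (t, v) \<in> W} \<noteq> {}"
    and B: "finite B"
  shows "\<exists>W'\<subseteq>W. definable W' \<and> (\<forall>t\<in>{0<..<\<delta>}. compact {v. (t, v) \<in> W'} \<and> {v. (t, v) \<in> W'} \<noteq> {}) \<and>
     (\<forall>t v v'. (t, v) \<in> W' \<longrightarrow> (t, v') \<in> W' \<longrightarrow> (\<forall>b\<in>B. v \<bullet> b = v' \<bullet> b))"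
  using B
proof (induction B rule: finite_induct)
  case empty
  show ?case using W comp by (intro exI[of _ W]) auto
next
  case (insert b B)
  then obtain W' where W': "W' \<subseteq> W" "definable W'"
      "\<And>t. t \<in> {0<..<\<delta>} \<Longrightarrow> compact {v. (t, v) \<in> W'} \<and> {v. (t, v) \<in> W'} \<noteq> {}"
      "\<And>t v v' b. (t, v) \<in> W' \<Longrightarrow> (t, v') \<in> W' \<Longrightarrow> b \<in> B \<Longrightarrow> v \<bullet> b = v' \<bullet> b" by (smt (verit))
  define X where "X = {z. z \<in> W' \<and> (\<forall>v'. (fst z, v') \<in> W' \<longrightarrow> snd z \<bullet> b \<le> v' \<bullet> b)}"
  have "definable X" unfolding X_def
    by (intro definable_intros definable_vimage[OF W'(2)] definable_fun_poly poly_function_intros)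
  moreover have "compact {v. (t, v) \<in> X} \<and> {v. (t, v) \<in> X} \<noteq> {}" if t: "t \<in> {0<..<\<delta>}" for t
  proof -
    have c: "compact {v. (t, v) \<in> W'}" and ne: "{v. (t, v) \<in> W'} \<noteq> {}" using W'(3)[OF t] by auto
    have "continuous_on {v. (t, v) \<in> W'} (\<lambda>v. v \<bullet> b)" by (intro continuous_intros)
    from continuous_attains_inf[OF c ne this] obtain u where u: "(t, u) \<in> W'" "\<And>v. (t, v) \<in> W' \<Longrightarrow> u \<bullet> b \<le> v \<bullet> b"
        by auto
    have e: "{v. (t, v) \<in> X} = {v. (t, v) \<in> W'} \<inter> {v. v \<bullet> b \<le> u \<bullet> b}"
      unfolding X_def using u by (auto intro: order_trans)
    have "closed {v. v \<bullet> b \<le> u \<bullet> b}" by (intro closed_Collect_le continuous_intros)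
    then have "compact {v. (t, v) \<in> X}" unfolding e using c by (intro compact_Int_closed)
    moreover have "u \<in> {v. (t, v) \<in> X}" unfolding e using u by simp
    ultimately show ?thesis by blast
  qed
  moreover have "v \<bullet> c = v' \<bullet> c" if "(t, v) \<in> X" "(t, v') \<in> X" "c \<in> insert b B" for t v v' c
  proof (cases "c = b")
    case True
    show ?thesis unfolding True using that(1,2) unfolding X_def by (intro order_antisym) auto
  next
    case False
    then show ?thesis using W'(4)[of t v v' c] that unfolding X_def by auto
  qed
  moreover have "X \<subseteq> W" using W'(1) unfolding X_def by auto
  ultimately show ?case by (intro exI[of _ X]) blast
qed

text \<open>
  The selected point is the lexicographic minimum of the fiber.
\<close>

lemma definable_selection:
  fixes W :: "(real \<times> 'e::euclidean_space) set"
  assumes W: "definable W" and comp: "\<And>t. t \<in> {0<..<\<delta>} \<Longrightarrow> compact {v. (t, v) \<in> W} \<and> {v. (t, v) \<in> W} \<noteq> {}"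
  shows "\<exists>z. (\<forall>t\<in>{0<..<\<delta>}. (t, z t) \<in> W) \<and> (\<forall>t. t \<notin> {0<..<\<delta>} \<longrightarrow> z t = 0) \<and>
      (\<forall>b\<in>Basis. definable_fun (\<lambda>t. z t \<bullet> b))"
proof -
  obtain W' where W': "W' \<subseteq> W" "definable W'"
      "\<And>t. t \<in> {0<..<\<delta>} \<Longrightarrow> {v. (t, v) \<in> W'} \<noteq> {}"
      "\<And>t v v' b. (t, v) \<in> W' \<Longrightarrow> (t, v') \<in> W' \<Longrightarrow> b \<in> Basis \<Longrightarrow> v \<bullet> b = v' \<bullet> b"
    using definable_fiber_minimum[OF W comp finite_Basis] by (smt (verit))
  define z where "z t = (if t \<in> {0<..<\<delta>} then SOME v. (t, v) \<in> W' else 0)" for t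
  have z: "(t, z t) \<in> W'" if "t \<in> {0<..<\<delta>}" for t
    using W'(3)[OF that] that unfolding z_def by (auto intro: someI_ex)
  have "definable_fun (\<lambda>t. z t \<bullet> b)" if "b \<in> Basis" for b
  proof -
    have "snd w = z (fst w) \<bullet> b \<longleftrightarrow> ((0 < fst w \<and> fst w < \<delta>) \<and> (\<exists>v. (fst w, v) \<in> W' \<and> snd w = v \<bullet> b)) \<or>
        (\<not> (0 < fst w \<and> fst w < \<delta>) \<and> snd w = 0)" for w :: "real \<times> real"
    proof (cases "fst w \<in> {0<..<\<delta>}")
      case True
      have "v \<bullet> b = z (fst w) \<bullet> b" if "(fst w, v) \<in> W'" for v
        using W'(4)[OF that z[OF True] \<open>b \<in> Basis\<close>] .
      then show ?thesis using z[OF True] True by (metis greaterThanLessThan_iff)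
    next
      case False
      then have "z (fst w) = 0" unfolding z_def by (rule if_not_P)
      then show ?thesis using False by auto
    qed
    moreover have "definable {w :: real \<times> real. ((0 < fst w \<and> fst w < \<delta>) \<and> (\<exists>v. (fst w, v) \<in> W' \<and>
        snd w = v \<bullet> b)) \<or>
        (\<not> (0 < fst w \<and> fst w < \<delta>) \<and> snd w = 0)}"
      by (intro definable_intros definable_vimage[OF W'(2)] definable_fun_const definable_fun_poly poly_function_intros)
    ultimately show ?thesis unfolding definable_fun_def by simp
  qed
  moreover have "(t, z t) \<in> W" if "t \<in> {0<..<\<delta>}" for t using z[OF that] W'(1) by blast
  moreover have "z t = 0" if "t \<notin> {0<..<\<delta>}" for t using that unfolding z_def by (rule if_not_P)
  ultimately show ?thesis by blast
qed

text \<open>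
  The exponents of the coordinates differ; the largest one serves all, because roots of numbers below \<open>1\<close> increase
  with the order of the root.
\<close>

lemma definable_curve_left_bound:
  fixes \<xi> :: "real \<Rightarrow> 'e::euclidean_space"
  assumes h: "\<And>b. b \<in> Basis \<Longrightarrow> definable_fun (\<lambda>t. \<xi> t \<bullet> b)" and M: "\<And>t. norm (\<xi> t) \<le> M"
  shows "\<exists>C m. C > 0 \<and> m \<ge> (2::nat) \<and>
    eventually (\<lambda>s. eventually (\<lambda>s'. s * norm (\<xi> s - \<xi> s') \<le> C * pos_root m s * (s - s')) (at_left s)) (at_right 0)"
proof -
  have "\<exists>C m. C > 0 \<and> m \<ge> (2::nat) \<and>
    eventually (\<lambda>s. eventually (\<lambda>s'. s * (\<Sum>b\<in>B. \<bar>\<xi> s \<bullet> b - \<xi> s' \<bullet> b\<bar>) \<le> C * pos_root m s * (s - s')) (at_left s)) (at_right 0)"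
    if "finite B" "B \<subseteq> Basis" for B
    using that
  proof (induction B rule: finite_induct)
    case empty
    have "eventually (\<lambda>s'. 0 \<le> 1 * pos_root 2 s * (s - s')) (at_left s)" for s :: real
    proof -
      have "eventually (\<lambda>s'. s' < s) (at_left s)" by (simp add: eventually_at_filter)
      then show ?thesis by eventually_elim (simp add: pos_root_def)
    qed
    then show ?case by (intro exI[of _ 1] exI[of _ 2]) simp
  next
    case (insert b B)
    then obtain C m where 1: "C > 0" "m \<ge> (2::nat)"
      "eventually (\<lambda>s. eventually (\<lambda>s'. s * (\<Sum>b\<in>B. \<bar>\<xi> s \<bullet> b - \<xi> s' \<bullet> b\<bar>) \<le>
          C * pos_root m s * (s - s')) (at_left s)) (at_right 0)"
      by auto
    have "\<bar>\<xi> t \<bullet> b\<bar> \<le> M" for t using Basis_le_norm[of b "\<xi> t"] insert.prems M[of t] by auto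
    from definable_left_quotient_bound[OF h this] insert.prems obtain C' m' where 2: "C' > 0" "m' \<ge> (2::nat)"
      "eventually (\<lambda>s. eventually (\<lambda>s'. s * \<bar>\<xi> s \<bullet> b - \<xi> s' \<bullet> b\<bar> \<le>
          C' * pos_root m' s * (s - s')) (at_left s)) (at_right 0)"
      by auto
    let ?k = "max m m'"
    have "eventually (\<lambda>s. s \<in> {0<..<1::real}) (at_right 0)" by (rule eventually_at_right_real) simp
    with 1(3) 2(3)
    have "eventually (\<lambda>s. eventually (\<lambda>s'. s * (\<Sum>b\<in>insert b B. \<bar>\<xi> s \<bullet> b - \<xi> s' \<bullet> b\<bar>) \<le>
        (C + C') * pos_root ?k s * (s - s')) (at_left s)) (at_right 0)"
    proof eventually_elim
      case (elim s)
      have p: "pos_root m s \<le> pos_root ?k s" "pos_root m' s \<le> pos_root ?k s"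
        using elim(3) 1(2) 2(2) by (auto intro!: pos_root_mono_exp)
      have "eventually (\<lambda>s'. s' < s) (at_left s)" by (simp add: eventually_at_filter)
      with elim(1,2) show ?case
      proof eventually_elim
        case (elim s')
        have "C * pos_root m s * (s - s') \<le> C * pos_root ?k s * (s - s')"
             "C' * pos_root m' s * (s - s') \<le> C' * pos_root ?k s * (s - s')"
          using p 1(1) 2(1) elim by (auto intro!: mult_right_mono mult_left_mono)
        then show ?case using elim insert.hyps by (simp add: algebra_simps)
      qed
    qed
    then show ?case using 1 2 by (intro exI[of _ "C + C'"] exI[of _ ?k]) auto
  qed
  from this[OF finite_Basis order_refl] obtain C m where 1: "C > 0" "m \<ge> (2::nat)"
      "eventually (\<lambda>s. eventually (\<lambda>s'. s * (\<Sum>b\<in>Basis. \<bar>\<xi> s \<bullet> b - \<xi> s' \<bullet> b\<bar>) \<le>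
          C * pos_root m s * (s - s')) (at_left s)) (at_right 0)"
    by blast
  have "eventually (\<lambda>s. s \<in> {0<..<1::real}) (at_right 0)" by (rule eventually_at_right_real) simp
  with 1(3)
  have "eventually (\<lambda>s. eventually (\<lambda>s'. s * norm (\<xi> s - \<xi> s') \<le>
      C * pos_root m s * (s - s')) (at_left s)) (at_right 0)"
  proof eventually_elim
    case (elim s)
    from elim(1) show ?case
    proof eventually_elim
      case (elim s')
      have "s * norm (\<xi> s - \<xi> s') \<le> s * (\<Sum>b\<in>Basis. \<bar>\<xi> s \<bullet> b - \<xi> s' \<bullet> b\<bar>)"
        using norm_le_l1[of "\<xi> s - \<xi> s'"] \<open>s \<in> {0<..<1}\<close> by (intro mult_left_mono) (auto simp: inner_diff_left)
      then show ?case using elim by simp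
    qed
  qed
  then show ?thesis using 1 by blast
qed

text \<open>
  Here \<open>G\<close> is the graph of a function where it is finite, and \<open>V\<close> is a proximal subgradient at \<open>z\<close> whose
  quadratic constant \<open>\<rho>\<close> is fixed in advance and whose inequality holds globally. Proximal steps produce
  such slopes, and the condition is a first-order formula.
\<close>

definition proximal_slope :: "('e::real_inner \<times> real) set \<Rightarrow> real \<Rightarrow> 'e \<Rightarrow> real \<Rightarrow> 'e \<Rightarrow> bool" where
  "proximal_slope G \<rho> z t V \<longleftrightarrow> (z, t) \<in> G \<and>
     (\<forall>w \<tau>. (w, \<tau>) \<in> G \<longrightarrow> t + V \<bullet> (w - z) - \<rho> * ((w - z) \<bullet> (w - z)) \<le> \<tau>)"

text \<open>
  For each small \<open>s > 0\<close> take, among the slopes over the ball at level \<open>lev + s\<close>, one of least norm \<open>V s\<close>, at a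
  point \<open>\<xi> s\<close>; a definable selection makes \<open>\<xi>\<close> a bounded definable curve. The proximal inequality between the levels \<open>s\<close>
  and \<open>s'\<close> reads \<open>s - s' \<le> norm (V s) * norm (\<xi> s - \<xi> s') + \<rho> * (norm (\<xi> s - \<xi> s'))\<^sup>2\<close>. As \<open>s'\<close> tends to \<open>s\<close> from the
  left, the bound on difference quotients of \<open>\<xi>\<close> gives \<open>1 \<le> norm (V s) * C * root m s / s\<close>. Minima are taken over
  closures, where the proximal inequality still holds. The estimate is uniform on
  a ball and holds at every level, critical or not.
\<close>

theorem definable_Kurdyka_Lojasiewicz:
  fixes G :: "('e::euclidean_space \<times> real) set"
  assumes G: "definable G" and \<rho>: "\<rho> \<ge> 0"
  shows "\<exists>c \<theta> \<eta>. 0 < c \<and> 0 < \<theta> \<and> \<theta> < 1 \<and> 0 < \<eta> \<and>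
     (\<forall>z t V. norm z \<le> r \<longrightarrow> lev < t \<longrightarrow> t < lev + \<eta> \<longrightarrow> proximal_slope G \<rho> z t V \<longrightarrow> c * (t - lev) powr \<theta> \<le> norm V)"
proof -
  define Val where "Val s = {v. norm (fst v) \<le> r \<and> proximal_slope G \<rho> (fst v) (lev + s) (snd v)}" for s
  have normeq: "norm x \<le> r \<longleftrightarrow> 0 \<le> r \<and> x \<bullet> x \<le> r * r" for x :: 'e
    using norm_le_square[of x r] by (auto simp: power2_eq_square intro: order_trans[OF norm_ge_zero])
  have dVal: "definable {w :: real \<times> ('e \<times> 'e). snd w \<in> Val (fst w)}"
    unfolding Val_def proximal_slope_def mem_Collect_eq normeq
    by (intro definable_intros definable_vimage[OF G] definable_fun_const definable_fun_poly poly_function_intros)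
  define Y where "Y s \<longleftrightarrow> (\<exists>v. v \<in> Val s)" for s
  have "definable {s. Y s}" unfolding Y_def by (intro definable_ex dVal)
  from definable_germ_right[OF this, of 0] show ?thesis
  proof
    assume "eventually (\<lambda>s. \<not> Y s) (at_right 0)"
    then obtain \<eta> where \<eta>: "0 < \<eta>" "\<And>s. 0 < s \<Longrightarrow> s < \<eta> \<Longrightarrow> \<not> Y s"
      unfolding eventually_at_right_field by blast
    have "\<not> proximal_slope G \<rho> z t V" if "norm z \<le> r" "lev < t" "t < lev + \<eta>" for z t V
      using \<eta>(2)[of "t - lev"] that unfolding Y_def Val_def by auto
    then show ?thesis using \<eta>(1) by (intro exI[of _ 1] exI[of _ "1 / 2"] exI[of _ \<eta>]) auto
  next
    assume "eventually Y (at_right 0)"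
    then obtain \<delta> where \<delta>: "0 < \<delta>" "\<And>s. 0 < s \<Longrightarrow> s < \<delta> \<Longrightarrow> Y s"
      unfolding eventually_at_right_field by blast
    \<comment> \<open>Least slopes need not be attained among actual slopes, so closures are used.\<close>
    define K where "K s = closure (Val s)" for s
    have Keq: "v \<in> K s \<longleftrightarrow> (\<forall>e. 0 < e \<longrightarrow> (\<exists>v'. v' \<in> Val s \<and> (v' - v) \<bullet> (v' - v) < e * e))" for v s
    proof -
      have "dist v' v < e \<longleftrightarrow> (v' - v) \<bullet> (v' - v) < e * e" if "0 < e" for e v'
        using that norm_lt_square[of "v' - v" e] by (simp add: dist_norm power2_eq_square)
      then show ?thesis unfolding K_def closure_approachable by blast
    qed
    have dVal': "definable {x. m x \<in> Val (k x)}" if "polynomial_function m" "polynomial_function k"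
      for m :: "'x::euclidean_space \<Rightarrow> 'e \<times> 'e" and k
      using definable_vimage[OF dVal poly_function_Pair[OF that(2,1)]] by simp
    have dK: "definable {w :: real \<times> ('e \<times> 'e). snd w \<in> K (fst w)}"
      unfolding Keq
          by (intro definable_intros dVal' definable_fun_const definable_fun_poly poly_function_intros)
    have dK': "definable {x. m x \<in> K (k x)}" if "polynomial_function m" "polynomial_function k"
      for m :: "'x::euclidean_space \<Rightarrow> 'e \<times> 'e" and k
      using definable_vimage[OF dK poly_function_Pair[OF that(2,1)]] by simp
    define W where "W = {w :: real \<times> ('e \<times> 'e). snd w \<in> K (fst w) \<and>
       (\<forall>v'. v' \<in> K (fst w) \<longrightarrow> snd (snd w) \<bullet> snd (snd w) \<le> snd v' \<bullet> snd v')}"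
    have dW: "definable W" unfolding W_def
      by (intro definable_intros dK' definable_fun_poly poly_function_intros)
    have Kfst: "norm (fst v) \<le> r" if "v \<in> K s" for v s
    proof -
      have "closed {v :: 'e \<times> 'e. norm (fst v) \<le> r}" by (intro closed_Collect_le continuous_intros)
      then have "K s \<subseteq> {v. norm (fst v) \<le> r}" unfolding K_def by (intro closure_minimal) (auto simp: Val_def)
      then show ?thesis using that by auto
    qed
    have bdd: "compact (K s \<inter> {v. snd v \<bullet> snd v \<le> M})" for s M
    proof -
      have "closed {v :: 'e \<times> 'e. snd v \<bullet> snd v \<le> M}" by (intro closed_Collect_le continuous_intros)
      then have "closed (K s \<inter> {v. snd v \<bullet> snd v \<le> M})" unfolding K_def by auto
      moreover have "bounded (K s \<inter> {v. snd v \<bullet> snd v \<le> M})"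
      proof (rule boundedI)
        fix v assume v: "v \<in> K s \<inter> {v. snd v \<bullet> snd v \<le> M}"
        have "norm v \<le> norm (fst v) + norm (snd v)" using norm_Pair_le[of "fst v" "snd v"] by simp
        moreover have "norm (snd v) \<le> sqrt M" using v by (auto simp: norm_eq_sqrt_inner)
        ultimately show "norm v \<le> r + sqrt M" using Kfst[of v s] v by auto
      qed
      ultimately show ?thesis by (simp add: compact_eq_bounded_closed)
    qed
    have "compact {v. (s, v) \<in> W} \<and> {v. (s, v) \<in> W} \<noteq> {}" if s: "s \<in> {0<..<\<delta>}" for s
    proof -
      obtain v0 where "v0 \<in> Val s" using \<delta>(2)[of s] s unfolding Y_def by auto
      then have v0: "v0 \<in> K s" unfolding K_def using closure_subset by blast
      let ?C = "K s \<inter> {v. snd v \<bullet> snd v \<le> snd v0 \<bullet> snd v0}"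
      have "?C \<noteq> {}" using v0 by auto
      moreover have "continuous_on ?C (\<lambda>v. snd v \<bullet> snd v)" by (intro continuous_intros)
      ultimately obtain u where u: "u \<in> ?C" "\<And>v. v \<in> ?C \<Longrightarrow> snd u \<bullet> snd u \<le> snd v \<bullet> snd v"
        using continuous_attains_inf[OF bdd] by blast
      have umin: "snd u \<bullet> snd u \<le> snd v \<bullet> snd v" if "v \<in> K s" for v
      proof (cases "snd v \<bullet> snd v \<le> snd v0 \<bullet> snd v0")
        case True then show ?thesis using u(2) that by auto
      next
        case False then show ?thesis using u(1) by auto
      qed
      have e: "{v. (s, v) \<in> W} = K s \<inter> {v. snd v \<bullet> snd v \<le> snd u \<bullet> snd u}"
      proof (intro set_eqI iffI)
        fix x assume "x \<in> {v. (s, v) \<in> W}"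
        then show "x \<in> K s \<inter> {v. snd v \<bullet> snd v \<le> snd u \<bullet> snd u}" unfolding W_def using u(1)
            by (simp del: split_paired_All)
      next
        fix x assume x: "x \<in> K s \<inter> {v. snd v \<bullet> snd v \<le> snd u \<bullet> snd u}"
        have "snd x \<bullet> snd x \<le> snd v' \<bullet> snd v'" if "v' \<in> K s" for v' using umin[OF that] x by simp
        then show "x \<in> {v. (s, v) \<in> W}" unfolding W_def using x by (simp del: split_paired_All)
      qed
      show ?thesis unfolding e using bdd u(1) by auto
    qed
    from definable_selection[OF dW this] obtain v where v: "\<And>t. t \<in> {0<..<\<delta>} \<Longrightarrow> (t, v t) \<in> W"
       "\<And>t. t \<notin> {0<..<\<delta>} \<Longrightarrow> v t = 0" "\<And>b. b \<in> Basis \<Longrightarrow> definable_fun (\<lambda>t. v t \<bullet> b)" by blast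
    define \<xi> where "\<xi> t = fst (v t)" for t
    have "definable_fun (\<lambda>t. \<xi> t \<bullet> b)" if "b \<in> Basis" for b
    proof -
      have "v t \<bullet> (b, 0) = \<xi> t \<bullet> b" for t unfolding \<xi>_def by (simp add: inner_prod_def)
      then show ?thesis using v(3)[of "(b, 0)"] that by (simp add: Basis_prod_def)
    qed
    moreover have "norm (\<xi> t) \<le> \<bar>r\<bar>" for t
    proof (cases "t \<in> {0<..<\<delta>}")
      case True
      then show ?thesis using Kfst[of "v t" t] v(1)[OF True] unfolding W_def \<xi>_def by auto
    qed (simp add: \<xi>_def v(2))
    ultimately obtain C m where C: "C > 0" and m: "m \<ge> (2::nat)" and
      ev: "eventually (\<lambda>s. eventually (\<lambda>s'. s * norm (\<xi> s - \<xi> s') \<le>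
          C * pos_root m s * (s - s')) (at_left s)) (at_right 0)"
      using definable_curve_left_bound by blast
    \<comment> \<open>The proximal inequality between a slope at level \<open>lev + s\<close> and a point at level \<open>lev + s'\<close>; it is closed in both.\<close>
    define supp where "supp s u s' u' \<longleftrightarrow>
        s + snd u \<bullet> (fst u' - fst u) - \<rho> * ((fst u' - fst u) \<bullet> (fst u' - fst u)) \<le> s'"
      for s s' :: real and u u' :: "'e \<times> 'e"
    have cross: "supp s u s' u'"
      if "u \<in> K s" "u' \<in> K s'" for s s' u u'
    proof -
      have 1: "supp s u s' u'"
        if "u \<in> Val s" "u' \<in> Val s'" for u u'
        using that unfolding Val_def proximal_slope_def supp_def by fastforce
      have 2: "supp s u s' u'"
        if "u \<in> K s" "u' \<in> Val s'" for u u'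
      proof -
        have "closed {u. supp s u s' u'}"
          unfolding supp_def by (intro closed_Collect_le continuous_intros)
        then have "K s \<subseteq> {u. supp s u s' u'}"
          unfolding K_def using 1[OF _ that(2)] by (intro closure_minimal subsetI CollectI)
        then show ?thesis using that by auto
      qed
      have "closed {u'. supp s u s' u'}"
        unfolding supp_def by (intro closed_Collect_le continuous_intros)
      then have "K s' \<subseteq> {u'. supp s u s' u'}"
        unfolding K_def[of s'] using 2[OF that(1)] by (intro closure_minimal subsetI CollectI)
      then show ?thesis using that by auto
    qed
    have low: "1 \<le> norm (snd (v s)) * (C * pos_root m s / s)"
      if s: "0 < s" "s < \<delta>" and ev: "eventually (\<lambda>s'. s * norm (\<xi> s - \<xi> s') \<le>
          C * pos_root m s * (s - s')) (at_left s)" for s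
    proof -
      define \<kappa> where "\<kappa> = C * pos_root m s / s"
      have \<kappa>: "\<kappa> \<ge> 0" unfolding \<kappa>_def using C s m by (simp add: pos_root_def)
      have vs: "v s \<in> K s" using v(1)[of s] s unfolding W_def by auto
      have "eventually (\<lambda>s'. s' \<in> {0<..<s}) (at_left s)" by (rule eventually_at_left_real[OF s(1)])
      with ev have "eventually (\<lambda>s'. 1 \<le> norm (snd (v s)) * \<kappa> + \<rho> * (\<kappa> * \<kappa>) * (s - s')) (at_left s)"
      proof eventually_elim
        case (elim s')
        have vs': "v s' \<in> K s'" using v(1)[of s'] elim(2) s unfolding W_def by auto
        define d where "d = norm (\<xi> s' - \<xi> s)"
        have d0: "0 \<le> d" unfolding d_def by simp
        have d: "d \<le> \<kappa> * (s - s')" using elim(1) s unfolding \<kappa>_def d_def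
            by (simp add: field_simps norm_minus_commute)
        have "s - s' \<le> - (snd (v s) \<bullet> (\<xi> s' - \<xi> s)) + \<rho> * (d * d)"
          using cross[OF vs vs'] unfolding supp_def \<xi>_def d_def by (simp add: dot_square_norm power2_eq_square)
        also have "\<dots> \<le> norm (snd (v s)) * d + \<rho> * (d * d)"
          using norm_cauchy_schwarz[of "- snd (v s)" "\<xi> s' - \<xi> s"] unfolding d_def by simp
        also have "\<dots> \<le> norm (snd (v s)) * (\<kappa> * (s - s')) + \<rho> * ((\<kappa> * (s - s')) * (\<kappa> * (s - s')))"
          using d d0 \<rho> \<kappa> elim by (intro add_mono mult_left_mono mult_mono) auto
        also have "\<dots> = (norm (snd (v s)) * \<kappa> + \<rho> * (\<kappa> * \<kappa>) * (s - s')) * (s - s')" by (simp add: algebra_simps)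
        finally have "1 * (s - s') \<le> (norm (snd (v s)) * \<kappa> + \<rho> * (\<kappa> * \<kappa>) * (s - s')) * (s - s')" by simp
        then show ?case using elim by (subst (asm) mult_le_cancel_right) auto
      qed
      moreover have "((\<lambda>s'. norm (snd (v s)) * \<kappa> + \<rho> * (\<kappa> * \<kappa>) * (s - s')) \<longlongrightarrow> norm (snd (v s)) * \<kappa> + \<rho> * (\<kappa> * \<kappa>) * (s - s)) (at_left s)"
        by (intro tendsto_intros)
      ultimately have "1 \<le> norm (snd (v s)) * \<kappa> + \<rho> * (\<kappa> * \<kappa>) * (s - s)"
        by (intro tendsto_lowerbound[OF _ _ trivial_limit_at_left_real])
      then show ?thesis unfolding \<kappa>_def by simp
    qed
    define \<theta> where "\<theta> = 1 - 1 / real m"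
    have \<theta>: "0 < \<theta>" "\<theta> < 1" using m unfolding \<theta>_def by auto
    obtain \<eta>0 where \<eta>0: "0 < \<eta>0" "\<And>s. 0 < s \<Longrightarrow> s < \<eta>0 \<Longrightarrow>
        eventually (\<lambda>s'. s * norm (\<xi> s - \<xi> s') \<le> C * pos_root m s * (s - s')) (at_left s)"
      using ev unfolding eventually_at_right_field by blast
    define \<eta> where "\<eta> = min \<eta>0 \<delta>"
    have "1 / C * (t - lev) powr \<theta> \<le> norm V"
      if "norm z \<le> r" "lev < t" "t < lev + \<eta>" "proximal_slope G \<rho> z t V" for z t V
    proof -
      define s where "s = t - lev"
      have s: "0 < s" "s < \<delta>" "s < \<eta>0" using that unfolding s_def \<eta>_def by auto
      have "(z, V) \<in> Val s" using that unfolding Val_def s_def by simp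
      then have "(z, V) \<in> K s" unfolding K_def using closure_subset by blast
      then have "snd (v s) \<bullet> snd (v s) \<le> V \<bullet> V" using v(1)[of s] s unfolding W_def by force
      then have nV: "norm (snd (v s)) \<le> norm V" by (simp add: norm_le)
      have r0: "root m s > 0" using s m by simp
      have "s powr \<theta> = s / root m s"
        using s m unfolding \<theta>_def by (simp add: powr_diff root_powr_inverse)
      moreover have "1 \<le> norm (snd (v s)) * (C * root m s / s)"
        using low[OF s(1,2) \<eta>0(2)[OF s(1,3)]] s by (simp add: pos_root_def)
      ultimately have "root m s * s powr \<theta> \<le> root m s * (C * norm (snd (v s)))" using s r0 C
          by (simp add: field_simps)
      then have "s powr \<theta> \<le> C * norm (snd (v s))" using r0 by (simp only: mult_le_cancel_left_pos)
      then have "1 / C * s powr \<theta> \<le> norm (snd (v s))" using C by (simp add: field_simps)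
      then show ?thesis using nV unfolding s_def by simp
    qed
    then show ?thesis using C \<theta> \<eta>0(1) \<delta>(1)
        by (intro exI[of _ "1 / C"] exI[of _ \<theta>] exI[of _ \<eta>]) (auto simp: \<eta>_def)
  qed
qed

section \<open>Sequences with descent and a Lojasiewicz inequality\<close>

text \<open>
  Half of each term is absorbed by the preceding one, and the potential \<open>\<psi>\<close> telescopes.
\<close>

lemma summable_if_halving:
  fixes d u \<psi> :: "nat \<Rightarrow> real"
  assumes d: "\<And>k. d k \<ge> 0" and u: "summable u" "\<And>k. u k \<ge> 0" and \<psi>: "\<And>k. \<psi> k \<ge> 0"
    and rec: "\<And>k. d (Suc k) \<le> d k / 2 + u k + (\<psi> k - \<psi> (Suc k))"
  shows "summable d"
proof (rule summableI_nonneg_bounded[OF d])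
  fix n
  have 1: "(\<Sum>k<n. d (Suc k)) \<le> (\<Sum>k<n. d k) / 2 + (\<Sum>k<n. u k) + (\<psi> 0 - \<psi> n)"
    by (induction n) (use rec in \<open>auto simp: add_divide_distrib intro!: order_trans[OF add_mono[OF _ rec]]\<close>)
  have 2: "(\<Sum>k<Suc n. d k) = d 0 + (\<Sum>k<n. d (Suc k))" by (rule sum.lessThan_Suc_shift)
  have 3: "(\<Sum>k<n. u k) \<le> suminf u" using u by (intro sum_le_suminf) auto
  have 4: "(\<Sum>k<Suc n. d k) = (\<Sum>k<n. d k) + d n" by simp
  show "(\<Sum>k<n. d k) \<le> 2 * (d 0 + suminf u + \<psi> 0)" using 1 2 3 4 d[of n] \<psi>[of n] by simp
qed

text \<open>
  The squared noise is paid for by decrements of \<open>k powr (1 - 2 * p)\<close>; the mean value theorem compares the two.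
\<close>

lemma powr_tail_decrement:
  fixes p :: real
  assumes p: "p > 1" and C: "C \<ge> 0"
  shows "\<exists>E\<ge>0. \<forall>k\<ge>(1::nat). C * (real k powr - p)\<^sup>2 \<le>
      E * real k powr (1 - 2 * p) - E * real (Suc k) powr (1 - 2 * p)"
proof -
  define q where "q = 2 * p - 1"
  have q: "q > 1" using p unfolding q_def by simp
  define E where "E = C * 2 powr (2 * p) / q"
  have E: "E \<ge> 0" unfolding E_def using C q by simp
  have "C * (real k powr - p)\<^sup>2 \<le> E * real k powr (1 - 2 * p) - E * real (Suc k) powr (1 - 2 * p)"
      if k: "k \<ge> 1" for k :: nat
  proof -
    let ?x = "real k"
    have k0: "?x > 0" using k by simp
    have der: "((\<lambda>t. t powr (- q)) has_real_derivative - q * t powr (- q - 1)) (at t)" if "?x \<le> t" for t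
      using k0 that by (auto intro!: derivative_eq_intros)
    have "\<exists>z. ?x < z \<and> z < ?x + 1 \<and> (?x + 1) powr (- q) - ?x powr (- q) = (?x + 1 - ?x) * (- q * z powr (- q - 1))"
      by (rule MVT2) (use der in auto)
    then obtain z where z: "?x < z" "z < ?x + 1" "?x powr (- q) - (?x + 1) powr (- q) = q * z powr (- q - 1)"
        by auto
    have "(2 * ?x) powr (- q - 1) \<le> z powr (- q - 1)"
      using z k k0 q by (intro powr_mono2') auto
    then have z2: "2 powr (- q - 1) * ?x powr (- q - 1) \<le> z powr (- q - 1)" using k0 by (simp add: powr_mult)
    have e: "(real k powr - p)\<^sup>2 = ?x powr (- q - 1)" unfolding q_def power2_eq_square
        by (simp add: powr_add[symmetric])
    have c: "2 powr (2 * p) * 2 powr (- q - 1) = (1::real)" unfolding q_def by (simp add: powr_add[symmetric])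
    have "C * (real k powr - p)\<^sup>2 = E * q * (2 powr (- q - 1) * ?x powr (- q - 1))"
      unfolding e E_def using c q by (simp add: field_simps)
    also have "\<dots> \<le> E * q * z powr (- q - 1)" using z2 E q by (intro mult_left_mono) auto
    also have "\<dots> = E * (?x powr (- q) - (?x + 1) powr (- q))" using z(3) by simp
    also have "\<dots> = E * real k powr (1 - 2 * p) - E * real (Suc k) powr (1 - 2 * p)"
      unfolding q_def by (simp add: right_diff_distrib add.commute)
    finally show ?thesis .
  qed
  then show ?thesis using E by blast
qed

text \<open>
  Concavity of \<open>t powr (1 - \<theta>)\<close>, multiplied out so that it makes sense at \<open>x = 0\<close>; it is Young's inequality.
\<close>

lemma powr_concave_step:
  fixes x y \<theta> :: real
  assumes "0 \<le> y" "y \<le> x" "0 < \<theta>" "\<theta> < 1"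
  shows "(1 - \<theta>) * (x - y) \<le> x powr \<theta> * (x powr (1 - \<theta>) - y powr (1 - \<theta>))"
proof (cases "y = 0")
  case True
  show ?thesis
  proof (cases "x = 0")
    case False
    then have "x powr \<theta> * x powr (1 - \<theta>) = x" using assms by (simp add: powr_add[symmetric])
    then show ?thesis using True assms by (simp add: mult_left_le_one_le)
  qed (use True in simp)
next
  case False
  then have xy: "0 < y" "0 < x" using assms by auto
  have "y powr (1 - \<theta>) * x powr \<theta> \<le> (1 - \<theta>) * y + \<theta> * x"
    using Youngs_inequality_0[of "1 - \<theta>" \<theta> y x] assms xy by simp
  moreover have "x powr \<theta> * x powr (1 - \<theta>) = x" using xy by (simp add: powr_add[symmetric])
  ultimately show ?thesis by (simp add: algebra_simps)
qed

lemma square_le_product_imp: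
  fixes d u v :: real
  assumes "d\<^sup>2 \<le> u * v" "0 \<le> u" "0 \<le> v" shows "d \<le> (u + v) / 2"
proof -
  have "d\<^sup>2 \<le> ((u + v) / 2)\<^sup>2" 
    using assms(1) zero_le_power2[of "u - v"] by (simp add: power2_eq_square field_simps)
  then show ?thesis by (rule power2_le_imp_le) (use assms in simp)
qed

text \<open>
  Let \<open>r k = F k + E * k powr (1 - 2 * p)\<close>, which decreases to a limit \<open>l\<close>. The inequality at level \<open>l\<close> bounds a
  power \<open>\<phi>\<close> of \<open>r - l\<close> by the step, the noise and \<open>(E * k powr (1 - 2 * p)) powr \<phi>\<close>. The last term is summable as soon
  as \<open>\<phi> > 1 / (2 * p - 1)\<close>; since \<open>p > 1\<close>, this is compatible with \<open>\<phi> < 1\<close>, and a Lojasiewicz exponent may always be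
  enlarged. With the concave function \<open>t powr (1 - \<phi>)\<close> the descent then turns into the recursion of
  \<open>summable_if_halving\<close>.
\<close>

lemma summable_of_descent_and_KL:
  fixes F d \<delta> :: "nat \<Rightarrow> real" and a C D p :: real
  assumes a: "a > 0" and C: "C \<ge> 0" and p: "p > 1"
    and d: "\<And>k. d k \<ge> 0" and \<delta>: "\<And>k. \<delta> k \<ge> 0"
    and noise: "eventually (\<lambda>k. \<delta> k \<le> D * real k powr - p) sequentially"
    and descent: "eventually (\<lambda>k. F (Suc k) + a * (d k)\<^sup>2 \<le> F k + C * (\<delta> k)\<^sup>2) sequentially"
    and below: "eventually (\<lambda>k. m \<le> F k) sequentially"
    and KL: "\<And>l. \<exists>c \<theta> \<eta>. 0 < c \<and> 0 < \<theta> \<and> \<theta> < 1 \<and> 0 < \<eta> \<and>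
        eventually (\<lambda>k. l < F (Suc k) \<longrightarrow> F (Suc k) < l + \<eta> \<longrightarrow> c * (F (Suc k) - l) powr \<theta> \<le> d k + \<delta> k) sequentially"
  shows "summable d"
proof -
  have CD: "C * D\<^sup>2 \<ge> 0" using C by simp
  obtain E where E: "E \<ge> 0" "\<And>k. k \<ge> (1::nat) \<Longrightarrow>
      C * D\<^sup>2 * (real k powr - p)\<^sup>2 \<le> E * real k powr (1 - 2 * p) - E * real (Suc k) powr (1 - 2 * p)"
    using powr_tail_decrement[OF p CD] by blast
  define S where "S k = E * real k powr (1 - 2 * p)" for k :: nat
  have S0: "S k \<ge> 0" for k unfolding S_def using E by simp
  have S_lim: "S \<longlonglongrightarrow> 0"
  proof -
    have "((\<lambda>k. real k powr (1 - 2 * p)) \<longlongrightarrow> 0) sequentially"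
      using p by (intro tendsto_neg_powr filterlim_real_sequentially) auto
    from tendsto_mult_left[OF this, of E] show ?thesis unfolding S_def by simp
  qed
  define r where "r k = F k + S k" for k
  have "eventually (\<lambda>k. r (Suc k) + a * (d k)\<^sup>2 \<le> r k) sequentially"
    using noise descent eventually_ge_at_top[of 1]
  proof eventually_elim
    case (elim k)
    have "(\<delta> k)\<^sup>2 \<le> (D * real k powr - p)\<^sup>2" using elim \<delta>[of k] by (intro power_mono) auto
    then have "C * (\<delta> k)\<^sup>2 \<le> C * (D * real k powr - p)\<^sup>2" using C by (rule mult_left_mono)
    also have "\<dots> \<le> S k - S (Suc k)" using E(2)[of k] elim unfolding S_def
        by (simp add: power_mult_distrib mult.assoc)
    finally show ?case using elim unfolding r_def by simp
  qed
  with below have "eventually (\<lambda>k. r (Suc k) + a * (d k)\<^sup>2 \<le> r k \<and> m \<le> F k) sequentially"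
      by eventually_elim simp
  then obtain K1 where K1: "\<And>k. k \<ge> K1 \<Longrightarrow> r (Suc k) + a * (d k)\<^sup>2 \<le> r k" "\<And>k. k \<ge> K1 \<Longrightarrow> m \<le> F k"
    unfolding eventually_sequentially by blast
  have "decseq (\<lambda>k. r (k + K1))"
    by (rule decseq_SucI) (use K1(1) a in \<open>smt (verit) add_Suc le_add2 mult_nonneg_nonneg zero_le_power2\<close>)
  moreover have "m \<le> r (k + K1)" for k using K1(2)[of "k + K1"] S0[of "k + K1"] unfolding r_def by simp
  ultimately obtain l where "(\<lambda>k. r (k + K1)) \<longlonglongrightarrow> l" and lge: "\<And>k. l \<le> r (k + K1)"
    using decseq_convergent[of "\<lambda>k. r (k + K1)" m] by blast
  then have rl: "r \<longlonglongrightarrow> l" by (simp add: LIMSEQ_offset)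
  have "(\<lambda>k. r k - S k) \<longlonglongrightarrow> l - 0" by (intro tendsto_intros rl S_lim)
  then have Fl: "F \<longlonglongrightarrow> l" unfolding r_def by simp
  obtain c \<theta> \<eta> where c: "0 < c" and \<theta>: "0 < \<theta>" "\<theta> < 1" and \<eta>: "0 < \<eta>" and
    kl: "eventually (\<lambda>k. l < F (Suc k) \<longrightarrow> F (Suc k) < l + \<eta> \<longrightarrow>
        c * (F (Suc k) - l) powr \<theta> \<le> d k + \<delta> k) sequentially"
    using KL[of l] by blast
  define q where "q = 2 * p - 1"
  have q: "q > 1" using p unfolding q_def by simp
  \<comment> \<open>The enlarged exponent: at least \<open>\<theta>\<close>, below \<open>1\<close>, and above \<open>1 / q\<close>.\<close>
  define \<phi> where "\<phi> = max \<theta> ((1 + 1 / q) / 2)"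
  have \<phi>: "0 < \<phi>" "\<phi> < 1" "\<theta> \<le> \<phi>" using \<theta> q unfolding \<phi>_def by auto
  have "1 < q * ((1 + 1 / q) / 2)" using q by (simp add: field_simps)
  also have "\<dots> \<le> q * \<phi>" using q unfolding \<phi>_def by (intro mult_left_mono) auto
  finally have q\<phi>: "1 < q * \<phi>" .
  have "eventually (\<lambda>k. F (Suc k) < l + min \<eta> 1) sequentially"
    using order_tendstoD(2)[OF LIMSEQ_Suc[OF Fl], of "l + min \<eta> 1"] \<eta> by simp
  with kl noise eventually_ge_at_top[of "max K1 1"]
  have "eventually (\<lambda>k. (l < F (Suc k) \<longrightarrow> c * (F (Suc k) - l) powr \<phi> \<le> d k + \<delta> k) \<and>
      \<delta> k \<le> D * real k powr - p \<and> k \<ge> max K1 1) sequentially"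
  proof eventually_elim
    case (elim k)
    have "c * (F (Suc k) - l) powr \<phi> \<le> d k + \<delta> k" if "l < F (Suc k)"
    proof -
      have "(F (Suc k) - l) powr \<phi> \<le> (F (Suc k) - l) powr \<theta>"
        using elim that \<phi> by (intro powr_mono') auto
      then have "c * (F (Suc k) - l) powr \<phi> \<le> c * (F (Suc k) - l) powr \<theta>" using c by (intro mult_left_mono) auto
      then show ?thesis using elim that by auto
    qed
    then show ?case using elim by simp
  qed
  then obtain K where KK: "\<And>k. k \<ge> K \<Longrightarrow> (l < F (Suc k) \<longrightarrow> c * (F (Suc k) - l) powr \<phi> \<le> d k + \<delta> k) \<and>
      \<delta> k \<le> D * real k powr - p \<and> k \<ge> max K1 1"
    unfolding eventually_sequentially by blast
  have K: "\<And>k. k \<ge> K \<Longrightarrow> l < F (Suc k) \<Longrightarrow> c * (F (Suc k) - l) powr \<phi> \<le> d k + \<delta> k"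
     "\<And>k. k \<ge> K \<Longrightarrow> \<delta> k \<le> D * real k powr - p" "K \<ge> K1" "K \<ge> 1"
    using KK KK[of K] by auto
  define v where "v k = r (k + K) - l" for k
  have v0: "v k \<ge> 0" for k using lge[of "k + K - K1"] K(3) unfolding v_def by simp
  have vdec: "v (Suc k) + a * (d (k + K))\<^sup>2 \<le> v k" for k using K1(1)[of "k + K"] K(3) unfolding v_def by simp
  define B where "B = 2 / c + 2"
  define \<omega> where "\<omega> k = \<delta> (k + K) + S (Suc (k + K)) powr \<phi>" for k
  have B: "B > 0" unfolding B_def using c by (simp add: add_pos_pos)
  have \<omega>0: "\<omega> k \<ge> 0" for k unfolding \<omega>_def using \<delta> by simp
  have slope: "v (Suc k) powr \<phi> \<le> B * (d (k + K) + \<omega> k)" for k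
  proof -
    define A where "A = max 0 (F (Suc (k + K)) - l)"
    have A: "A powr \<phi> \<le> (d (k + K) + \<delta> (k + K)) / c"
    proof (cases "l < F (Suc (k + K))")
      case True
      then show ?thesis using K(1)[of "k + K"] c unfolding A_def by (simp add: field_simps max_def)
    next
      case False
      then have "A = 0" unfolding A_def by simp
      then show ?thesis using d \<delta> c by simp
    qed
    let ?s = "S (Suc (k + K))"
    let ?M = "max A ?s"
    have "v (Suc k) \<le> A + ?s" unfolding v_def r_def A_def by simp
    moreover have "A \<le> ?M" "?s \<le> ?M" by simp_all
    ultimately have "v (Suc k) \<le> 2 * ?M" by linarith
    then have "v (Suc k) powr \<phi> \<le> (2 * ?M) powr \<phi>" using v0 \<phi> by (intro powr_mono2) auto
    also have "\<dots> = 2 powr \<phi> * ?M powr \<phi>" unfolding A_def by (simp add: powr_mult)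
    also have "\<dots> \<le> 2 * ?M powr \<phi>"
      using powr_mono[of \<phi> 1 2] \<phi> by (intro mult_right_mono) auto
    also have "?M powr \<phi> \<le> A powr \<phi> + ?s powr \<phi>" by (simp add: max_def)
    also have "\<dots> \<le> (d (k + K) + \<delta> (k + K)) / c + ?s powr \<phi>" using A by simp
    finally have "v (Suc k) powr \<phi> \<le> 2 / c * (d (k + K) + \<delta> (k + K)) + 2 * ?s powr \<phi>" by simp
    also have "\<dots> \<le> B * (d (k + K) + \<delta> (k + K)) + B * ?s powr \<phi>"
      using d[of "k + K"] \<delta>[of "k + K"] c unfolding B_def by (intro add_mono mult_right_mono) auto
    finally show ?thesis unfolding \<omega>_def by (simp add: algebra_simps)
  qed
  define M where "M = B / ((1 - \<phi>) * a)"
  have M: "M > 0" unfolding M_def using B \<phi> a by simp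
  define \<psi> where "\<psi> k = M * v (Suc k) powr (1 - \<phi>) / 2" for k
  have \<psi>dec: "\<psi> (Suc k) \<le> \<psi> k" for k
  proof -
    have "v (Suc (Suc k)) \<le> v (Suc k)" using vdec[of "Suc k"] a
        by (smt (verit) mult_nonneg_nonneg zero_le_power2)
    then have "v (Suc (Suc k)) powr (1 - \<phi>) \<le> v (Suc k) powr (1 - \<phi>)" using \<phi> v0 by (intro powr_mono2) auto
    then show ?thesis unfolding \<psi>_def using M by simp
  qed
  have "d (Suc k + K) \<le> d (k + K) / 2 + \<omega> k / 2 + (\<psi> k - \<psi> (Suc k))" for k
  proof -
    let ?d = "d (Suc k + K)" and ?u = "d (k + K) + \<omega> k"
    have u0: "0 \<le> ?u" using d \<omega>0 by simp
    have dec: "v (Suc (Suc k)) \<le> v (Suc k)" using vdec[of "Suc k"] a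
        by (smt (verit) mult_nonneg_nonneg zero_le_power2)
    define \<Delta> where "\<Delta> = v (Suc k) powr (1 - \<phi>) - v (Suc (Suc k)) powr (1 - \<phi>)"
    have \<Delta>: "0 \<le> \<Delta>" unfolding \<Delta>_def using dec \<phi> v0 by (simp add: powr_mono2)
    have "(1 - \<phi>) * (a * ?d\<^sup>2) \<le> (1 - \<phi>) * (v (Suc k) - v (Suc (Suc k)))"
      using vdec[of "Suc k"] \<phi> by (intro mult_left_mono) auto
    also have "\<dots> \<le> v (Suc k) powr \<phi> * \<Delta>" unfolding \<Delta>_def by (rule powr_concave_step[OF v0 dec \<phi>(1,2)])
    also have "\<dots> \<le> B * ?u * \<Delta>" using slope[of k] \<Delta> by (intro mult_right_mono) auto
    finally have "?d\<^sup>2 \<le> ?u * (M * \<Delta>)" using \<phi> a unfolding M_def by (simp add: field_simps)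
    then have "?d \<le> (?u + M * \<Delta>) / 2" using u0 \<Delta> M by (intro square_le_product_imp) auto
    then show ?thesis unfolding \<psi>_def \<Delta>_def by (simp add: algebra_simps add_divide_distrib diff_divide_distrib)
  qed
  moreover have "summable (\<lambda>k. \<omega> k / 2)"
  proof -
    have "summable (\<lambda>k. D * real k powr - p)" using p
        by (intro summable_mult) (simp add: summable_real_powr_iff)
    then have "summable (\<lambda>k. D * real (k + K) powr - p)" by (rule summable_ignore_initial_segment)
    moreover have "norm (\<delta> (k + K)) \<le> D * real (k + K) powr - p" for k using \<delta>[of "k + K"] K(2)[of "k + K"]
        by simp
    ultimately have 1: "summable (\<lambda>k. \<delta> (k + K))" by (rule summable_comparison_test'[where N = 0])
    have "summable (\<lambda>k. E powr \<phi> * real k powr (- (q * \<phi>)))" using q\<phi>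
        by (intro summable_mult) (simp add: summable_real_powr_iff)
    then have "summable (\<lambda>k. E powr \<phi> * real (k + Suc K) powr (- (q * \<phi>)))"
        by (rule summable_ignore_initial_segment)
    moreover have "S (Suc (k + K)) powr \<phi> = E powr \<phi> * real (k + Suc K) powr (- (q * \<phi>))" for k
      unfolding S_def q_def using E by (simp add: powr_mult powr_powr algebra_simps)
    ultimately have "summable (\<lambda>k. S (Suc (k + K)) powr \<phi>)" by simp
    from summable_divide[OF summable_add[OF 1 this], of 2] show ?thesis unfolding \<omega>_def .
  qed
  moreover have "\<psi> k \<ge> 0" for k unfolding \<psi>_def using M by simp
  ultimately have "summable (\<lambda>k. d (k + K))"
    using summable_if_halving[of "\<lambda>k. d (k + K)" "\<lambda>k. \<omega> k / 2" \<psi>] d \<omega>0 by simp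
  then show ?thesis by (simp add: summable_iff_shift)
qed

section \<open>Single steps of the inexact ADMM\<close>

text \<open>
  The minimizing property, cleared of the scaling and of extended real arithmetic.
\<close>

lemma prox_scaled_minimizer:
  fixes f :: "'v::real_normed_vector \<Rightarrow> ereal"
  assumes proper: "proper_fun f" and \<rho>: "\<rho> > 0" and y: "y \<in> prox (\<lambda>u. f u / ereal \<rho>) c"
  shows "\<exists>a. f y = ereal a \<and> (\<forall>u b. f u = ereal b \<longrightarrow>
      a + \<rho> / 2 * (norm (y - c))\<^sup>2 \<le> b + \<rho> / 2 * (norm (u - c))\<^sup>2)"
proof -
  define h where "h u = f u / ereal \<rho> + ereal ((norm (u - c))\<^sup>2 / 2)" for u
  have min: "\<not> h u < h y" for u using y unfolding prox_def is_arg_min_def h_def by blast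
  have hfin: "h u = ereal (b / \<rho> + (norm (u - c))\<^sup>2 / 2)" if "f u = ereal b" for u b
    unfolding h_def that using \<rho> by simp
  obtain u0 where "f u0 \<noteq> \<infinity>" "f u0 \<noteq> - \<infinity>" using proper unfolding proper_fun_def by blast
  then obtain b0 where b0: "f u0 = ereal b0" by (cases "f u0") auto
  have "f y \<noteq> \<infinity>"
  proof
    assume "f y = \<infinity>"
    then have "h y = \<infinity>" unfolding h_def using \<rho> by (simp add: divide_ereal_def)
    then show False using min[of u0] hfin[OF b0] by simp
  qed
  then obtain a where a: "f y = ereal a" using proper unfolding proper_fun_def by (cases "f y") auto
  have "a + \<rho> / 2 * (norm (y - c))\<^sup>2 \<le> b + \<rho> / 2 * (norm (u - c))\<^sup>2" if "f u = ereal b" for u b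
  proof -
    have "a / \<rho> + (norm (y - c))\<^sup>2 / 2 \<le> b / \<rho> + (norm (u - c))\<^sup>2 / 2"
      using min[of u] hfin[OF that] hfin[OF a] by simp
    then have "\<rho> * (a / \<rho> + (norm (y - c))\<^sup>2 / 2) \<le> \<rho> * (b / \<rho> + (norm (u - c))\<^sup>2 / 2)"
      using \<rho> by (intro mult_left_mono) auto
    then show ?thesis using \<rho> by (simp add: distrib_left)
  qed
  then show ?thesis using a by blast
qed

lemma prox_gradient:
  fixes g :: "'v::euclidean_space \<Rightarrow> real"
  assumes y: "y \<in> prox (\<lambda>u. ereal (g u / \<beta>)) c" and D: "GDERIV g y :> D" and \<beta>: "\<beta> > 0"
  shows "D = \<beta> *\<^sub>R (c - y)"
proof -
  define h where "h u = g u / \<beta> + ((u - c) \<bullet> (u - c)) / 2" for u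
  have min: "h y \<le> h u" for u
    using y unfolding prox_def is_arg_min_def h_def by (auto simp: power2_norm_eq_inner not_less)
  have "(g has_derivative (\<lambda>v. v \<bullet> D)) (at y)" using D unfolding gderiv_def .
  then have "(h has_derivative (\<lambda>v. (v \<bullet> D) / \<beta> + v \<bullet> (y - c))) (at y)"
    using \<beta> unfolding h_def by (auto intro!: derivative_eq_intros simp: inner_commute)
  then have "(\<lambda>v. (v \<bullet> D) / \<beta> + v \<bullet> (y - c)) = (\<lambda>v. 0)"
    by (rule has_derivative_local_min) (simp add: min)
  then have "(v \<bullet> D) / \<beta> + v \<bullet> (y - c) = 0" for v by metis
  then have "v \<bullet> (D - \<beta> *\<^sub>R (c - y)) = 0" for v using \<beta>
      by (simp add: field_simps inner_diff_right inner_add_right)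
  from this[of "D - \<beta> *\<^sub>R (c - y)"] show ?thesis by simp
qed

text \<open>
  The tangent inequality of one variable, applied along the line from \<open>y\<close> to \<open>u\<close>.
\<close>

lemma convex_gradient_inequality:
  fixes g :: "'v::euclidean_space \<Rightarrow> real"
  assumes g: "convex_on UNIV g" and D: "GDERIV g y :> D"
  shows "g y + D \<bullet> (u - y) \<le> g u"
proof -
  define \<phi> where "\<phi> t = g (y + t *\<^sub>R (u - y))" for t :: real
  have "convex_on UNIV \<phi>"
  proof (rule convex_onI)
    fix t a b :: real assume t: "0 < t" "t < 1"
    have "y + ((1 - t) *\<^sub>R a + t *\<^sub>R b) *\<^sub>R (u - y) = (1 - t) *\<^sub>R (y + a *\<^sub>R (u - y)) + t *\<^sub>R (y + b *\<^sub>R (u - y))"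
      by (simp add: algebra_simps)
    then show "\<phi> ((1 - t) *\<^sub>R a + t *\<^sub>R b) \<le> (1 - t) * \<phi> a + t * \<phi> b"
      unfolding \<phi>_def using convex_onD[OF g, of t "y + a *\<^sub>R (u - y)" "y + b *\<^sub>R (u - y)"] t by simp
  qed simp
  moreover have "(\<phi> has_real_derivative D \<bullet> (u - y)) (at 0 within UNIV)"
  proof -
    have d: "(g has_derivative (\<lambda>v. v \<bullet> D)) (at (y + 0 *\<^sub>R (u - y)))" using D unfolding gderiv_def by simp
    have line: "((\<lambda>t. y + t *\<^sub>R (u - y)) has_derivative (\<lambda>t. t *\<^sub>R (u - y))) (at (0 :: real))"
      by (auto intro!: derivative_eq_intros)
    have "(\<phi> has_derivative (\<lambda>t. t * (D \<bullet> (u - y)))) (at 0)"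
      using has_derivative_compose[OF line d] unfolding \<phi>_def by (simp add: inner_commute)
    then show ?thesis by (rule has_derivative_imp_has_field_derivative) simp
  qed
  ultimately have "\<phi> 1 - \<phi> 0 \<ge> D \<bullet> (u - y) * (1 - 0)" by (intro convex_on_imp_above_tangent) auto
  then show ?thesis unfolding \<phi>_def by simp
qed

text \<open>
  The part of the augmented Lagrangian of \<open>x + y = 0\<close> that couples the variables.
\<close>

definition coupling :: "real \<Rightarrow> 'v::real_inner \<Rightarrow> 'v \<Rightarrow> 'v \<Rightarrow> real" where
  "coupling \<beta> x y \<gamma> = \<gamma> \<bullet> (x + y) + \<beta> / 2 * ((x + y) \<bullet> (x + y))"

lemma scaled_square_diff:
  fixes X x c :: "'v::real_inner"
  shows "\<rho> / 2 * (norm (X - c))\<^sup>2 - \<rho> / 2 * (norm (x - c))\<^sup>2 = \<rho> / 2 * (X \<bullet> X - x \<bullet> x) - (\<rho> *\<^sub>R c) \<bullet> (X - x)"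
  by (simp add: power2_norm_eq_inner inner_diff_left inner_diff_right inner_commute algebra_simps)

text \<open>
  All cross terms are absorbed into \<open>dx\<^sup>2\<close> and \<open>dy\<^sup>2\<close>. With \<open>L \<le> \<beta> / 3\<close> the multiplier step costs at most
  \<open>2 / 9\<close> and the noise \<open>1 / 9\<close> of \<open>\<beta> * dy\<^sup>2\<close>, which leaves \<open>1 / 6\<close> of the gain \<open>1 / 2\<close>.
\<close>

lemma real_descent_estimate:
  fixes \<alpha> \<beta> L dx dy n1 \<epsilon> G :: real
  assumes "\<alpha> > 0" "\<beta> > 0" "0 \<le> L" "3 * L \<le> \<beta>" "0 \<le> dx" "0 \<le> dy" "0 \<le> n1" "0 \<le> \<epsilon>" "0 \<le> G" "G \<le> L * dy + \<beta> * \<epsilon>"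
  shows "- \<alpha> / 2 * dx\<^sup>2 + (\<alpha> + \<beta>) * (n1 * dx) - \<beta> / 2 * dy\<^sup>2 + \<beta> * (\<epsilon> * dy) + G\<^sup>2 / \<beta>
     \<le> - min (\<alpha> / 8) (\<beta> / 12) * (dx + dy)\<^sup>2 + ((\<alpha> + \<beta>)\<^sup>2 / \<alpha> + 5 * \<beta>) * (n1 + \<epsilon>)\<^sup>2"
proof -
  define \<rho> where "\<rho> = \<alpha> + \<beta>"
  have 1: "\<rho> * (n1 * dx) \<le> \<alpha> / 4 * dx\<^sup>2 + \<rho>\<^sup>2 / \<alpha> * n1\<^sup>2"
  proof -
    have "0 \<le> (\<alpha> / 2 * dx - \<rho> * n1)\<^sup>2 / \<alpha>" using assms(1) by simp
    also have "\<dots> = \<alpha> / 4 * dx\<^sup>2 + \<rho>\<^sup>2 / \<alpha> * n1\<^sup>2 - \<rho> * (n1 * dx)"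
      using assms(1) by (simp add: power2_eq_square field_simps)
    finally show ?thesis by simp
  qed
  have "G \<le> \<beta> / 3 * dy + \<beta> * \<epsilon>"
  proof -
    have "L * dy \<le> \<beta> / 3 * dy" using assms by (intro mult_right_mono) auto
    then show ?thesis using assms by simp
  qed
  then have "G\<^sup>2 \<le> (\<beta> * (dy / 3 + \<epsilon>))\<^sup>2" using assms by (intro power_mono) (auto simp: algebra_simps)
  then have "G\<^sup>2 / \<beta> \<le> (\<beta> * (dy / 3 + \<epsilon>))\<^sup>2 / \<beta>" using assms by (intro divide_right_mono) auto
  also have "\<dots> = \<beta> * (dy / 3 + \<epsilon>)\<^sup>2" using assms by (simp add: power2_eq_square)
  also have "\<dots> \<le> \<beta> * (2 / 9 * dy\<^sup>2 + 2 * \<epsilon>\<^sup>2)"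
  proof -
    have "0 \<le> (dy / 3 - \<epsilon>)\<^sup>2" by simp
    then have "(dy / 3 + \<epsilon>)\<^sup>2 \<le> 2 / 9 * dy\<^sup>2 + 2 * \<epsilon>\<^sup>2" by (simp add: power2_eq_square algebra_simps)
    then show ?thesis using assms by (intro mult_left_mono) auto
  qed
  finally have 2: "G\<^sup>2 / \<beta> \<le> 2 / 9 * (\<beta> * dy\<^sup>2) + 2 * (\<beta> * \<epsilon>\<^sup>2)" by (simp add: algebra_simps)
  have 3: "\<beta> * (\<epsilon> * dy) \<le> 1 / 9 * (\<beta> * dy\<^sup>2) + 9 / 4 * (\<beta> * \<epsilon>\<^sup>2)"
  proof -
    have "0 \<le> \<beta> * (dy / 3 - 3 / 2 * \<epsilon>)\<^sup>2" using assms by simp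
    then show ?thesis by (simp add: power2_eq_square algebra_simps)
  qed
  define a where "a = min (\<alpha> / 8) (\<beta> / 12)"
  have a: "0 \<le> a" "a \<le> \<alpha> / 8" "a \<le> \<beta> / 12" unfolding a_def using assms by auto
  have "(dx + dy)\<^sup>2 \<le> 2 * dx\<^sup>2 + 2 * dy\<^sup>2" using zero_le_power2[of "dx - dy"]
      by (simp add: power2_eq_square algebra_simps)
  then have "a * (dx + dy)\<^sup>2 \<le> a * (2 * dx\<^sup>2 + 2 * dy\<^sup>2)" using a(1) by (intro mult_left_mono)
  also have "\<dots> = 2 * (a * dx\<^sup>2) + 2 * (a * dy\<^sup>2)" by (simp add: algebra_simps)
  also have "\<dots> \<le> 2 * (\<alpha> / 8 * dx\<^sup>2) + 2 * (\<beta> / 12 * dy\<^sup>2)" using a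
      by (intro add_mono mult_left_mono mult_right_mono) auto
  finally have 4: "a * (dx + dy)\<^sup>2 \<le> \<alpha> / 4 * dx\<^sup>2 + \<beta> / 6 * dy\<^sup>2" by simp
  have 5: "\<rho>\<^sup>2 / \<alpha> * n1\<^sup>2 \<le> \<rho>\<^sup>2 / \<alpha> * (n1 + \<epsilon>)\<^sup>2" using assms by (intro mult_left_mono power_mono) auto
  have 6: "\<beta> * \<epsilon>\<^sup>2 \<le> \<beta> * (n1 + \<epsilon>)\<^sup>2" using assms by (intro mult_left_mono power_mono) auto
  have 7: "0 \<le> \<beta> * (n1 + \<epsilon>)\<^sup>2" using assms by simp
  have "- \<alpha> / 2 * dx\<^sup>2 + \<rho> * (n1 * dx) - \<beta> / 2 * dy\<^sup>2 + \<beta> * (\<epsilon> * dy) + G\<^sup>2 / \<beta>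
     \<le> - (a * (dx + dy)\<^sup>2) + (\<rho>\<^sup>2 / \<alpha> * (n1 + \<epsilon>)\<^sup>2 + 5 * (\<beta> * (n1 + \<epsilon>)\<^sup>2))"
    using 1 2 3 4 5 6 7 by simp
  then show ?thesis unfolding \<rho>_def a_def by (simp add: distrib_right)
qed

text \<open>
  Up to noise, the first two updates decrease the augmented Lagrangian by their proximal terms; the multiplier update
  increases it by \<open>(norm (\<Gamma> - \<gamma>))\<^sup>2 / \<beta>\<close>. Since the multiplier is minus the gradient of \<open>g\<close> up to noise, this
  increase is controlled by \<open>norm (Y - y)\<close>.
\<close>

lemma admm_descent:
  fixes x y \<gamma> X Y \<Gamma> e\<^sub>1 e\<^sub>2 e\<^sub>2' :: "'v::real_inner"
  assumes \<alpha>: "\<alpha> > 0" and \<beta>: "\<beta> > 0" and L: "0 \<le> L" "3 * L \<le> \<beta>"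
    and c: "(\<alpha> + \<beta>) *\<^sub>R c = \<alpha> *\<^sub>R x - \<beta> *\<^sub>R y - \<gamma> + (\<alpha> + \<beta>) *\<^sub>R e\<^sub>1"
    and xmin: "a1 + (\<alpha> + \<beta>) / 2 * (norm (X - c))\<^sup>2 \<le> a0 + (\<alpha> + \<beta>) / 2 * (norm (x - c))\<^sup>2"
    and \<Gamma>: "\<Gamma> = \<gamma> + \<beta> *\<^sub>R (X + Y)"
    and gY: "gY + (\<beta> *\<^sub>R e\<^sub>2 - \<Gamma>) \<bullet> (y - Y) \<le> gy"
    and lip: "norm ((\<beta> *\<^sub>R e\<^sub>2 - \<Gamma>) - (\<beta> *\<^sub>R e\<^sub>2' - \<gamma>)) \<le> L * norm (Y - y)"
  shows "a1 + gY + coupling \<beta> X Y \<Gamma> + min (\<alpha> / 8) (\<beta> / 12) * (norm (X - x) + norm (Y - y))\<^sup>2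
    \<le> a0 + gy + coupling \<beta> x y \<gamma> + ((\<alpha> + \<beta>)\<^sup>2 / \<alpha> + 5 * \<beta>) * (norm e\<^sub>1 + (norm e\<^sub>2 + norm e\<^sub>2'))\<^sup>2"
proof -
  have s: "(\<alpha> + \<beta>) / 2 * (norm (X - c))\<^sup>2 - (\<alpha> + \<beta>) / 2 * (norm (x - c))\<^sup>2 =
      (\<alpha> + \<beta>) / 2 * (X \<bullet> X - x \<bullet> x) - (\<alpha> *\<^sub>R x - \<beta> *\<^sub>R y - \<gamma> + (\<alpha> + \<beta>) *\<^sub>R e\<^sub>1) \<bullet> (X - x)"
    unfolding scaled_square_diff c ..
  have 1: "a1 + coupling \<beta> X y \<gamma> - a0 - coupling \<beta> x y \<gamma> \<le>
      - \<alpha> / 2 * (norm (X - x))\<^sup>2 + (\<alpha> + \<beta>) * (e\<^sub>1 \<bullet> (X - x))"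
    using xmin s unfolding coupling_def power2_norm_eq_inner
    by (simp add: inner_diff_left inner_diff_right inner_add_left inner_add_right inner_commute algebra_simps add_divide_distrib diff_divide_distrib)
  have 2: "gY + coupling \<beta> X Y \<gamma> - gy - coupling \<beta> X y \<gamma> \<le> - \<beta> / 2 * (norm (Y - y))\<^sup>2 + \<beta> * (e\<^sub>2 \<bullet> (Y - y))"
    using gY unfolding \<Gamma> coupling_def power2_norm_eq_inner
    by (simp add: inner_diff_left inner_diff_right inner_add_left inner_add_right inner_commute algebra_simps add_divide_distrib diff_divide_distrib)
  have 3: "coupling \<beta> X Y \<Gamma> - coupling \<beta> X Y \<gamma> = (norm (\<Gamma> - \<gamma>))\<^sup>2 / \<beta>"
    unfolding \<Gamma> coupling_def power2_norm_eq_inner using \<beta> by (simp add: inner_add_left)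
  have n1: "e\<^sub>1 \<bullet> (X - x) \<le> norm e\<^sub>1 * norm (X - x)" by (rule norm_cauchy_schwarz)
  have n2: "e\<^sub>2 \<bullet> (Y - y) \<le> (norm e\<^sub>2 + norm e\<^sub>2') * norm (Y - y)"
    using norm_cauchy_schwarz[of e\<^sub>2 "Y - y"] by (simp add: distrib_right add_increasing2)
  have G: "norm (\<Gamma> - \<gamma>) \<le> L * norm (Y - y) + \<beta> * (norm e\<^sub>2 + norm e\<^sub>2')"
  proof -
    have "\<Gamma> - \<gamma> = \<beta> *\<^sub>R e\<^sub>2 - \<beta> *\<^sub>R e\<^sub>2' - ((\<beta> *\<^sub>R e\<^sub>2 - \<Gamma>) - (\<beta> *\<^sub>R e\<^sub>2' - \<gamma>))" by simp
    also have "norm \<dots> \<le> norm (\<beta> *\<^sub>R e\<^sub>2) + norm (\<beta> *\<^sub>R e\<^sub>2') + norm ((\<beta> *\<^sub>R e\<^sub>2 - \<Gamma>) - (\<beta> *\<^sub>R e\<^sub>2' - \<gamma>))"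
      by (intro order_trans[OF norm_triangle_ineq4] add_mono norm_triangle_ineq4 order_refl)
    finally show ?thesis using lip \<beta> by (simp add: distrib_left)
  qed
  have "(\<alpha> + \<beta>) * (e\<^sub>1 \<bullet> (X - x)) \<le> (\<alpha> + \<beta>) * (norm e\<^sub>1 * norm (X - x))"
      "\<beta> * (e\<^sub>2 \<bullet> (Y - y)) \<le> \<beta> * ((norm e\<^sub>2 + norm e\<^sub>2') * norm (Y - y))"
    using n1 n2 \<alpha> \<beta> by (auto intro!: mult_left_mono)
  moreover have "- \<alpha> / 2 * (norm (X - x))\<^sup>2 + (\<alpha> + \<beta>) * (norm e\<^sub>1 * norm (X - x)) - \<beta> / 2 * (norm (Y - y))\<^sup>2
        + \<beta> * ((norm e\<^sub>2 + norm e\<^sub>2') * norm (Y - y)) + (norm (\<Gamma> - \<gamma>))\<^sup>2 / \<beta>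
     \<le> - min (\<alpha> / 8) (\<beta> / 12) * (norm (X - x) + norm (Y - y))\<^sup>2
        + ((\<alpha> + \<beta>)\<^sup>2 / \<alpha> + 5 * \<beta>) * (norm e\<^sub>1 + (norm e\<^sub>2 + norm e\<^sub>2'))\<^sup>2"
    by (rule real_descent_estimate[OF \<alpha> \<beta> L _ _ _ _ _ G]) auto
  ultimately show ?thesis using 1 2 3 by simp
qed

text \<open>
  The optimality conditions of the two proximal steps, rewritten at the new point. The coupling is quadratic, so it
  deviates from its linearization by a quadratic form; completing the square bounds that form
  below by \<open>- 1 / (2 * \<beta>) * (dw \<bullet> dw)\<close>.
\<close>

lemma admm_slope:
  fixes x y \<gamma> X Y \<Gamma> e\<^sub>1 e\<^sub>2 u v w :: "'v::real_inner"
  assumes \<alpha>: "\<alpha> > 0" and \<beta>: "\<beta> > 0"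
    and c: "(\<alpha> + \<beta>) *\<^sub>R c = \<alpha> *\<^sub>R x - \<beta> *\<^sub>R y - \<gamma> + (\<alpha> + \<beta>) *\<^sub>R e\<^sub>1"
    and xmin: "a1 + (\<alpha> + \<beta>) / 2 * (norm (X - c))\<^sup>2 \<le> b + (\<alpha> + \<beta>) / 2 * (norm (u - c))\<^sup>2"
    and \<Gamma>: "\<Gamma> = \<gamma> + \<beta> *\<^sub>R (X + Y)"
    and gY: "gY + (\<beta> *\<^sub>R e\<^sub>2 - \<Gamma>) \<bullet> (v - Y) \<le> gv"
  shows "a1 + gY + coupling \<beta> X Y \<Gamma>
      + (\<alpha> *\<^sub>R (x - X) + \<beta> *\<^sub>R (Y - y) + (\<Gamma> - \<gamma>) + (\<alpha> + \<beta>) *\<^sub>R e\<^sub>1) \<bullet> (u - X)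
      + (\<beta> *\<^sub>R e\<^sub>2 + (\<Gamma> - \<gamma>)) \<bullet> (v - Y) + ((1 / \<beta>) *\<^sub>R (\<Gamma> - \<gamma>)) \<bullet> (w - \<Gamma>)
      - ((\<alpha> + \<beta>) / 2 + 1 / (2 * \<beta>)) * ((u - X) \<bullet> (u - X) + (v - Y) \<bullet> (v - Y) + (w - \<Gamma>) \<bullet> (w - \<Gamma>))
     \<le> b + gv + coupling \<beta> u v w"
proof -
  define du dv dw where "du = u - X" and "dv = v - Y" and "dw = w - \<Gamma>"
  have uvw: "u = X + du" "v = Y + dv" "w = \<Gamma> + dw" unfolding du_def dv_def dw_def by auto
  have XY: "\<beta> *\<^sub>R (X + Y) = \<Gamma> - \<gamma>" "(1 / \<beta>) *\<^sub>R (\<Gamma> - \<gamma>) = X + Y" unfolding \<Gamma> using \<beta> by simp_all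
  have s: "(\<alpha> + \<beta>) / 2 * (norm (X - c))\<^sup>2 - (\<alpha> + \<beta>) / 2 * (norm (u - c))\<^sup>2 =
      (\<alpha> + \<beta>) / 2 * (X \<bullet> X - u \<bullet> u) - (\<alpha> *\<^sub>R x - \<beta> *\<^sub>R y - \<gamma> + (\<alpha> + \<beta>) *\<^sub>R e\<^sub>1) \<bullet> (X - u)"
    unfolding scaled_square_diff c ..
  have b: "a1 + (\<alpha> *\<^sub>R (x - X) - \<beta> *\<^sub>R X - \<beta> *\<^sub>R y - \<gamma> + (\<alpha> + \<beta>) *\<^sub>R e\<^sub>1) \<bullet> du - (\<alpha> + \<beta>) / 2 * (du \<bullet> du) \<le> b"
    using xmin s unfolding uvw
    by (simp add: inner_diff_left inner_diff_right inner_add_left inner_add_right inner_commute algebra_simps add_divide_distrib diff_divide_distrib)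
  have g: "gY + (\<beta> *\<^sub>R e\<^sub>2 - \<Gamma>) \<bullet> dv \<le> gv" using gY unfolding dv_def .
  have q: "0 \<le> \<beta> / 2 * ((du + dv) \<bullet> (du + dv)) + dw \<bullet> (du + dv) + 1 / (2 * \<beta>) * (dw \<bullet> dw)"
  proof -
    have "0 \<le> \<beta> / 2 * (((du + dv) + (1 / \<beta>) *\<^sub>R dw) \<bullet> ((du + dv) + (1 / \<beta>) *\<^sub>R dw))" using \<beta> by simp
    also have "\<dots> = \<beta> / 2 * ((du + dv) \<bullet> (du + dv)) + dw \<bullet> (du + dv) + 1 / (2 * \<beta>) * (dw \<bullet> dw)"
      unfolding inner_add_left[of "du + dv"] inner_add_right[of _ "du + dv"] inner_scaleR_left inner_scaleR_right
      using \<beta> by (simp add: inner_commute[of "du + dv" dw] field_simps)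
    finally show ?thesis .
  qed
  have "coupling \<beta> u v w = coupling \<beta> X Y \<Gamma> + \<Gamma> \<bullet> (du + dv) + dw \<bullet> (X + Y) + (\<beta> *\<^sub>R (X + Y)) \<bullet> (du + dv)
      + (\<beta> / 2 * ((du + dv) \<bullet> (du + dv)) + dw \<bullet> (du + dv))"
    unfolding coupling_def uvw
    by (simp add: inner_diff_left inner_diff_right inner_add_left inner_add_right inner_commute algebra_simps add_divide_distrib)
  then have cp: "coupling \<beta> u v w \<ge> coupling \<beta> X Y \<Gamma> + \<Gamma> \<bullet> (du + dv) + dw \<bullet> (X + Y) + (\<beta> *\<^sub>R (X + Y)) \<bullet> (du + dv)
      - 1 / (2 * \<beta>) * (dw \<bullet> dw)"
    using q by simp
  have m: "(\<alpha> + \<beta>) / 2 * (du \<bullet> du) + 1 / (2 * \<beta>) * (dw \<bullet> dw) \<le>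
      ((\<alpha> + \<beta>) / 2 + 1 / (2 * \<beta>)) * (du \<bullet> du + dv \<bullet> dv + dw \<bullet> dw)"
  proof -
    have "((\<alpha> + \<beta>) / 2 + 1 / (2 * \<beta>)) * (du \<bullet> du + dv \<bullet> dv + dw \<bullet> dw) =
       (\<alpha> + \<beta>) / 2 * (du \<bullet> du) + 1 / (2 * \<beta>) * (dw \<bullet> dw) +
       ((\<alpha> + \<beta>) / 2 * (dv \<bullet> dv) + (\<alpha> + \<beta>) / 2 * (dw \<bullet> dw) + 1 / (2 * \<beta>) * (du \<bullet> du) + 1 / (2 * \<beta>) * (dv \<bullet> dv))"
      by (simp add: distrib_left distrib_right)
    moreover have "0 \<le> (\<alpha> + \<beta>) / 2 * (dv \<bullet> dv) + (\<alpha> + \<beta>) / 2 * (dw \<bullet> dw) + 1 / (2 * \<beta>) * (du \<bullet> du) + 1 / (2 * \<beta>) * (dv \<bullet> dv)"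
      using \<alpha> \<beta> by (intro add_nonneg_nonneg mult_nonneg_nonneg) auto
    ultimately show ?thesis by linarith
  qed
  have lin: "(\<alpha> *\<^sub>R (x - X) + \<beta> *\<^sub>R (Y - y) + (\<Gamma> - \<gamma>) + (\<alpha> + \<beta>) *\<^sub>R e\<^sub>1) \<bullet> du + (\<beta> *\<^sub>R e\<^sub>2 + (\<Gamma> - \<gamma>)) \<bullet> dv
     = (\<alpha> *\<^sub>R (x - X) - \<beta> *\<^sub>R X - \<beta> *\<^sub>R y - \<gamma> + (\<alpha> + \<beta>) *\<^sub>R e\<^sub>1) \<bullet> du + (\<beta> *\<^sub>R e\<^sub>2 - \<Gamma>) \<bullet> dv
       + \<Gamma> \<bullet> (du + dv) + (\<beta> *\<^sub>R (X + Y)) \<bullet> (du + dv)"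
    unfolding \<Gamma> by (simp add: inner_diff_left inner_diff_right inner_add_left inner_add_right algebra_simps)
  have lin2: "((1 / \<beta>) *\<^sub>R (\<Gamma> - \<gamma>)) \<bullet> dw = dw \<bullet> (X + Y)" unfolding XY by (rule inner_commute)
  show ?thesis
    unfolding du_def[symmetric] dv_def[symmetric] dw_def[symmetric]
    using b g cp m lin lin2 by linarith
qed

section \<open>Finite length\<close>

lemma coercive_lower_bound:
  assumes "coercive f" shows "\<exists>r. \<forall>u. r \<le> norm u \<longrightarrow> ereal A < f u"
  using assms unfolding coercive_def tendsto_PInfty eventually_at_infinity by blast

lemma norm_Pair3_le: "norm (a, b, c) \<le> norm a + norm b + norm c"
  using norm_Pair_le[of a "(b, c)"] norm_Pair_le[of b c] by simp

text \<open>
  The augmented Lagrangian \<open>F\<close> satisfies the three conditions of \<open>summable_of_descent_and_KL\<close>. The condition on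
  \<open>g u - \<sigma> * (norm (grad_g u))\<^sup>2\<close> bounds \<open>F\<close> below by \<open>f\<close> up to a constant, because the multiplier enters \<open>F\<close>
  only through its square over \<open>2 * \<beta>\<close>; together with descent and coercivity this confines the iterates to a ball, on which
  the Kurdyka--Lojasiewicz inequality is uniform.
\<close>

theorem inexact_admm_finite_length:
  fixes f :: "'v::euclidean_space \<Rightarrow> ereal"
    and g :: "'v \<Rightarrow> real"
    and grad_g :: "'v \<Rightarrow> 'v"
    and L \<alpha> \<beta> \<sigma> p :: real
    and x y \<gamma> e\<^sub>1 e\<^sub>2 :: "nat \<Rightarrow> 'v"
  assumes f_proper: "proper_fun f"
    and g_convex: "convex_on UNIV g"
    and g_gradient: "\<And>u. GDERIV g u :> grad_g u"
    and g_Lipschitz: "L-lipschitz_on UNIV grad_g"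
    and alpha: "\<alpha> > 0"
    and beta: "\<beta> \<ge> 3 * L"
    and x_step: "\<And>k. x (Suc k) \<in> prox (\<lambda>u. f u / ereal (\<alpha> + \<beta>))
          ((\<alpha> / (\<alpha> + \<beta>)) *\<^sub>R x k - (\<beta> / (\<alpha> + \<beta>)) *\<^sub>R y k
             - (1 / (\<alpha> + \<beta>)) *\<^sub>R \<gamma> k + e\<^sub>1 (Suc k))"
    and y_step: "\<And>k. y (Suc k) \<in> prox (\<lambda>u. ereal (g u / \<beta>))
          (- x (Suc k) - (1 / \<beta>) *\<^sub>R \<gamma> k + e\<^sub>2 (Suc k))"
    and gamma_step: "\<And>k. \<gamma> (Suc k) = \<gamma> k + \<beta> *\<^sub>R (x (Suc k) + y (Suc k))"
    and sigma_pos: "\<sigma> > 0"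
    and g_bound: "(INF u. ereal (g u - \<sigma> * (norm (grad_g u))\<^sup>2)) > -\<infinity>"
    and beta_sigma: "\<beta> \<ge> 1 / \<sigma>"
    and e2_bounded: "bounded (range e\<^sub>2)"
    and f_coercive: "coercive f"
    and f_semialgebraic: "semialgebraic_fun f"
    and g_semialgebraic: "semialgebraic_fun (\<lambda>u. ereal (g u))"
    and p_gt_1: "p > 1"
    and noise: "(\<lambda>k. norm (e\<^sub>1 k) + norm (e\<^sub>2 k)) \<in> O(\<lambda>k. 1 / real k powr p)"
  shows "summable (\<lambda>k. norm (x (Suc k) - x k) + norm (y (Suc k) - y k))"
proof -
  define \<rho> where "\<rho> = \<alpha> + \<beta>"
  have "0 < 1 / \<sigma>" using sigma_pos by simp
  then have \<beta>: "\<beta> > 0" using beta_sigma by linarith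
  have \<rho>: "\<rho> > 0" using alpha \<beta> unfolding \<rho>_def by simp
  have L: "0 \<le> L" using lipschitz_on_nonneg[OF g_Lipschitz] .
  have lip: "norm (grad_g u - grad_g v) \<le> L * norm (u - v)" for u v
    using lipschitz_onD[OF g_Lipschitz, of u v] by (simp add: dist_norm)
  have grad_growth: "norm (grad_g u) \<le> norm (grad_g 0) + L * norm u" for u
    using lip[of u 0] norm_triangle_ineq2[of "grad_g u" "grad_g 0"] by simp
  define c where "c k = (\<alpha> / \<rho>) *\<^sub>R x k - (\<beta> / \<rho>) *\<^sub>R y k - (1 / \<rho>) *\<^sub>R \<gamma> k + e\<^sub>1 (Suc k)" for k
  have c: "\<rho> *\<^sub>R c k = \<alpha> *\<^sub>R x k - \<beta> *\<^sub>R y k - \<gamma> k + \<rho> *\<^sub>R e\<^sub>1 (Suc k)" for k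
    unfolding c_def using \<rho> by (simp add: scaleR_add_right scaleR_diff_right)
  have "\<exists>a. f (x (Suc k)) = ereal a \<and> (\<forall>u b. f u = ereal b \<longrightarrow>
      a + \<rho> / 2 * (norm (x (Suc k) - c k))\<^sup>2 \<le> b + \<rho> / 2 * (norm (u - c k))\<^sup>2)" for k
    by (rule prox_scaled_minimizer[OF f_proper \<rho>]) (use x_step[of k] in \<open>simp add: c_def \<rho>_def\<close>)
  then obtain a where fx: "\<And>k. f (x (Suc k)) = ereal (a k)" and
    xmin: "\<And>k u b. f u = ereal b \<Longrightarrow> a k + \<rho> / 2 * (norm (x (Suc k) - c k))\<^sup>2 \<le> b + \<rho> / 2 * (norm (u - c k))\<^sup>2"
    by metis
  have grad_y: "grad_g (y (Suc k)) = \<beta> *\<^sub>R e\<^sub>2 (Suc k) - \<gamma> (Suc k)" for k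
  proof -
    have "grad_g (y (Suc k)) = \<beta> *\<^sub>R (- x (Suc k) - (1 / \<beta>) *\<^sub>R \<gamma> k + e\<^sub>2 (Suc k) - y (Suc k))"
      by (rule prox_gradient[OF y_step g_gradient \<beta>])
    also have "\<dots> = \<beta> *\<^sub>R e\<^sub>2 (Suc k) - \<gamma> (Suc k)" unfolding gamma_step using \<beta> by (simp add: algebra_simps)
    finally show ?thesis .
  qed
  have gmin: "g (y (Suc k)) + (\<beta> *\<^sub>R e\<^sub>2 (Suc k) - \<gamma> (Suc k)) \<bullet> (u - y (Suc k)) \<le> g u" for k u
    using convex_gradient_inequality[OF g_convex g_gradient, of "y (Suc k)" u] unfolding grad_y .

  \<comment> \<open>All sequences are shifted by one, since \<open>f (x 0)\<close> may be infinite and \<open>\<gamma> 0\<close> is unrelated to \<open>y 0\<close>.\<close>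
  define F where "F k = a k + g (y (Suc k)) + coupling \<beta> (x (Suc k)) (y (Suc k)) (\<gamma> (Suc k))" for k
  define d where "d k = norm (x (Suc (Suc k)) - x (Suc k)) + norm (y (Suc (Suc k)) - y (Suc k))" for k
  define \<delta> where "\<delta> k = norm (e\<^sub>1 (Suc (Suc k))) + (norm (e\<^sub>2 (Suc (Suc k))) + norm (e\<^sub>2 (Suc k)))" for k
  define C where "C = \<rho>\<^sup>2 / \<alpha> + 5 * \<beta>"
  define s where "s = min (\<alpha> / 8) (\<beta> / 12)"
  have C0: "C \<ge> 0" and s0: "s > 0" unfolding C_def s_def using alpha \<beta> by auto
  have d0: "d k \<ge> 0" and \<delta>0: "\<delta> k \<ge> 0" for k unfolding d_def \<delta>_def by simp_all
  have descent: "F (Suc k) + s * (d k)\<^sup>2 \<le> F k + C * (\<delta> k)\<^sup>2" for k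
  proof -
    have "norm ((\<beta> *\<^sub>R e\<^sub>2 (Suc (Suc k)) - \<gamma> (Suc (Suc k))) - (\<beta> *\<^sub>R e\<^sub>2 (Suc k) - \<gamma> (Suc k))) \<le>
        L * norm (y (Suc (Suc k)) - y (Suc k))"
      using lip[of "y (Suc (Suc k))" "y (Suc k)"] unfolding grad_y .
    from admm_descent[OF alpha \<beta> L beta c[of "Suc k", unfolded \<rho>_def] xmin[OF fx[of k], of "Suc k", unfolded \<rho>_def]
        gamma_step gmin this]
    show ?thesis unfolding F_def d_def \<delta>_def C_def s_def \<rho>_def .
  qed

  obtain E where E: "E \<ge> 0" "\<And>k. norm (e\<^sub>2 k) \<le> E"
    using e2_bounded unfolding bounded_iff by (metis norm_ge_zero order_trans rangeI)
  have gamma_le: "norm (\<gamma> (Suc k)) \<le> \<beta> * E + norm (grad_g (y (Suc k)))" for k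
  proof -
    have "\<gamma> (Suc k) = \<beta> *\<^sub>R e\<^sub>2 (Suc k) - grad_g (y (Suc k))" unfolding grad_y by simp
    then have "norm (\<gamma> (Suc k)) = norm (\<beta> *\<^sub>R e\<^sub>2 (Suc k) - grad_g (y (Suc k)))" by (rule arg_cong)
    also have "\<dots> \<le> norm (\<beta> *\<^sub>R e\<^sub>2 (Suc k)) + norm (grad_g (y (Suc k)))" by (rule norm_triangle_ineq4)
    also have "norm (\<beta> *\<^sub>R e\<^sub>2 (Suc k)) \<le> \<beta> * E" using E(2)[of "Suc k"] \<beta> by simp
    finally show ?thesis by simp
  qed
  obtain G where G: "\<And>u. G \<le> g u - \<sigma> * (norm (grad_g u))\<^sup>2"
  proof -
    obtain r where "ereal r < (INF u. ereal (g u - \<sigma> * (norm (grad_g u))\<^sup>2))" using ereal_dense2[OF g_bound]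
        by blast
    then have "ereal r < ereal (g u - \<sigma> * (norm (grad_g u))\<^sup>2)" for u by (rule less_INF_D) simp
    then have "r \<le> g u - \<sigma> * (norm (grad_g u))\<^sup>2" for u by (simp add: less_imp_le)
    then show ?thesis by (rule that)
  qed
  have lower: "a k + G - \<beta> * E\<^sup>2 + \<beta> / 2 * (norm (x (Suc k) + y (Suc k) + (1 / \<beta>) *\<^sub>R \<gamma> (Suc k)))\<^sup>2 \<le> F k" for k
  proof -
    let ?x = "x (Suc k)" and ?y = "y (Suc k)" and ?\<gamma> = "\<gamma> (Suc k)"
    have cp: "coupling \<beta> ?x ?y ?\<gamma> = \<beta> / 2 * (norm (?x + ?y + (1 / \<beta>) *\<^sub>R ?\<gamma>))\<^sup>2 - (norm ?\<gamma>)\<^sup>2 / (2 * \<beta>)"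
      unfolding coupling_def power2_norm_eq_inner inner_add_left[of "?x + ?y"] inner_add_right[of _ "?x + ?y"]
        inner_scaleR_left inner_scaleR_right using \<beta> by (simp add: inner_commute[of "?x + ?y" ?\<gamma>] field_simps)
    have "(norm ?\<gamma>)\<^sup>2 \<le> (\<beta> * E + norm (grad_g ?y))\<^sup>2" by (intro power_mono gamma_le) auto
    also have "\<dots> \<le> 2 * (\<beta> * E)\<^sup>2 + 2 * (norm (grad_g ?y))\<^sup>2"
      using zero_le_power2[of "\<beta> * E - norm (grad_g ?y)"] by (simp add: power2_eq_square algebra_simps)
    finally have "(norm ?\<gamma>)\<^sup>2 / (2 * \<beta>) \<le> (2 * (\<beta> * E)\<^sup>2 + 2 * (norm (grad_g ?y))\<^sup>2) / (2 * \<beta>)"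
      using \<beta> by (intro divide_right_mono) auto
    also have "\<dots> = \<beta> * E\<^sup>2 + 1 / \<beta> * (norm (grad_g ?y))\<^sup>2" using \<beta> by (simp add: power2_eq_square field_simps)
    also have "\<dots> \<le> \<beta> * E\<^sup>2 + \<sigma> * (norm (grad_g ?y))\<^sup>2"
    proof -
      have "1 / \<beta> \<le> \<sigma>" using beta_sigma \<beta> sigma_pos by (simp add: field_simps)
      then show ?thesis by (intro add_left_mono mult_right_mono) auto
    qed
    finally show ?thesis using G[of ?y] cp unfolding F_def by linarith
  qed
  obtain A where A: "\<And>u b. f u = ereal b \<Longrightarrow> A \<le> b"
  proof -
    obtain r where r: "\<And>u. r \<le> norm u \<Longrightarrow> ereal 0 < f u" using coercive_lower_bound[OF f_coercive] by blast
    define A where "A = min 0 (a 0 - \<rho> / 2 * (r + norm (c 0))\<^sup>2)"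
    have "A \<le> b" if b: "f u = ereal b" for u b
    proof (cases "r \<le> norm u")
      case True
      then show ?thesis using r[of u] b unfolding A_def by simp
    next
      case False
      have "norm (u - c 0) \<le> r + norm (c 0)" using norm_triangle_ineq4[of u "c 0"] False by simp
      then have "\<rho> / 2 * (norm (u - c 0))\<^sup>2 \<le> \<rho> / 2 * (r + norm (c 0))\<^sup>2" using \<rho>
          by (intro mult_left_mono power_mono) auto
      moreover have "0 \<le> \<rho> / 2 * (norm (x (Suc 0) - c 0))\<^sup>2" using \<rho> by simp
      ultimately have "a 0 - \<rho> / 2 * (r + norm (c 0))\<^sup>2 \<le> b" using xmin[OF b, of 0] by linarith
      then show ?thesis unfolding A_def by simp
    qed
    then show ?thesis by (rule that)
  qed
  have below: "A + G - \<beta> * E\<^sup>2 \<le> F k" for k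
  proof -
    have "0 \<le> \<beta> / 2 * (norm (x (Suc k) + y (Suc k) + (1 / \<beta>) *\<^sub>R \<gamma> (Suc k)))\<^sup>2" using \<beta> by simp
    then show ?thesis using lower[of k] A[OF fx[of k]] by linarith
  qed

  obtain D N where N: "N \<ge> 1" and \<delta>_le: "\<And>k. k \<ge> N \<Longrightarrow> \<delta> k \<le> D * real k powr - p"
  proof -
    obtain D0 where D0: "D0 > 0" "eventually (\<lambda>k. norm (norm (e\<^sub>1 k) + norm (e\<^sub>2 k)) \<le>
        D0 * norm (1 / real k powr p)) at_top"
      using landau_o.bigE[OF noise] by blast
    then obtain N0 where N0: "\<And>k. k \<ge> N0 \<Longrightarrow> norm (e\<^sub>1 k) + norm (e\<^sub>2 k) \<le> D0 * real k powr - p"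
      unfolding eventually_sequentially by (auto simp: powr_minus_divide)
    have "\<delta> k \<le> 2 * D0 * real k powr - p" if k: "k \<ge> max N0 1" for k
    proof -
      have mono: "real (k + j) powr - p \<le> real k powr - p" for j using k p_gt_1 by (intro powr_mono2') auto
      have "norm (e\<^sub>1 (k + j)) + norm (e\<^sub>2 (k + j)) \<le> D0 * real k powr - p" for j
        by (rule order_trans[OF N0 mult_left_mono[OF mono[of j]]]) (use D0(1) k in auto)
      from this[of 2] this[of 1]
      have "norm (e\<^sub>1 (Suc (Suc k))) + norm (e\<^sub>2 (Suc (Suc k))) \<le> D0 * real k powr - p"
          "norm (e\<^sub>1 (Suc k)) + norm (e\<^sub>2 (Suc k)) \<le> D0 * real k powr - p" by (simp_all add: numeral_2_eq_2)
      then show ?thesis using norm_ge_zero[of "e\<^sub>1 (Suc k)"] unfolding \<delta>_def by linarith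
    qed
    then show ?thesis using that[of "max N0 1" "2 * D0"] by simp
  qed
  obtain Fmax where Fmax: "\<And>k. k \<ge> N \<Longrightarrow> F k \<le> Fmax"
  proof -
    have CD: "C * D\<^sup>2 \<ge> 0" using C0 by simp
    obtain T where T: "T \<ge> 0" "\<And>k. k \<ge> (1::nat) \<Longrightarrow>
        C * D\<^sup>2 * (real k powr - p)\<^sup>2 \<le> T * real k powr (1 - 2 * p) - T * real (Suc k) powr (1 - 2 * p)"
      using powr_tail_decrement[OF p_gt_1 CD] by blast
    define S where "S k = T * real k powr (1 - 2 * p)" for k :: nat
    have decr: "F k + S k \<le> F N + S N" if "k \<ge> N" for k
      using that
    proof (induction k rule: dec_induct)
      case (step k)
      have "(\<delta> k)\<^sup>2 \<le> (D * real k powr - p)\<^sup>2" using \<delta>_le[of k] step \<delta>0[of k] by (intro power_mono) auto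
      then have "C * (\<delta> k)\<^sup>2 \<le> C * (D * real k powr - p)\<^sup>2" using C0 by (rule mult_left_mono)
      also have "\<dots> \<le> S k - S (Suc k)" using T(2)[of k] step N unfolding S_def
          by (simp add: power_mult_distrib mult.assoc)
      finally have "C * (\<delta> k)\<^sup>2 \<le> S k - S (Suc k)" .
      moreover have "0 \<le> s * (d k)\<^sup>2" using s0 by simp
      ultimately show ?case using descent[of k] step.IH by linarith
    qed simp
    have S0: "S k \<ge> 0" for k unfolding S_def using T by simp
    have "F k \<le> F N + S N" if "k \<ge> N" for k using decr[OF that] S0[of k] by linarith
    then show ?thesis by (rule that)
  qed
  define z where "z k = (x (Suc k), y (Suc k), \<gamma> (Suc k))" for k
  obtain r where r: "\<And>k. k \<ge> N \<Longrightarrow> norm (z k) \<le> r"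
  proof -
    obtain r1 where r1: "\<And>u. r1 \<le> norm u \<Longrightarrow> ereal (Fmax - G + \<beta> * E\<^sup>2) < f u"
      using coercive_lower_bound[OF f_coercive] by blast
    \<comment> \<open>The bounds \<open>r1\<close>, \<open>r3\<close>, \<open>r4\<close> are for \<open>x\<close>, \<open>y\<close>, \<open>\<gamma>\<close>, and \<open>r2\<close> is for the residual \<open>x + y + \<gamma> / \<beta>\<close>.\<close>
    define r2 where "r2 = sqrt (2 / \<beta> * (Fmax - A - G + \<beta> * E\<^sup>2))"
    define q where "q = norm (grad_g 0) / \<beta>"
    define r3 where "r3 = 3 / 2 * (r2 + r1 + E + q)"
    define r4 where "r4 = \<beta> * E + (norm (grad_g 0) + L * r3)"
    have "norm (z k) \<le> r1 + r3 + r4" if k: "k \<ge> N" for k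
    proof -
      let ?x = "x (Suc k)" and ?y = "y (Suc k)" and ?\<gamma> = "\<gamma> (Suc k)"
      let ?w = "?x + ?y + (1 / \<beta>) *\<^sub>R ?\<gamma>"
      have w0: "0 \<le> \<beta> / 2 * (norm ?w)\<^sup>2" using \<beta> by simp
      have "a k \<le> Fmax - G + \<beta> * E\<^sup>2" using lower[of k] Fmax[OF k] w0 by linarith
      then have x1: "norm ?x \<le> r1" using r1[of ?x] fx[of k] by (cases "r1 \<le> norm ?x") auto
      have "\<beta> / 2 * (norm ?w)\<^sup>2 \<le> Fmax - A - G + \<beta> * E\<^sup>2" using lower[of k] Fmax[OF k] A[OF fx[of k]]
          by linarith
      then have "(norm ?w)\<^sup>2 \<le> 2 / \<beta> * (Fmax - A - G + \<beta> * E\<^sup>2)" using \<beta> by (simp add: field_simps)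
      then have w1: "norm ?w \<le> r2" unfolding r2_def by (rule real_le_rsqrt)
      have "?y = ?w - ?x - e\<^sub>2 (Suc k) + (1 / \<beta>) *\<^sub>R grad_g ?y"
        unfolding grad_y using \<beta> by (simp add: algebra_simps)
      then have "norm ?y = norm (?w - ?x - e\<^sub>2 (Suc k) + (1 / \<beta>) *\<^sub>R grad_g ?y)"
        by (rule arg_cong[where f = norm])
      then have y0: "norm ?y \<le> norm ?w + norm ?x + norm (e\<^sub>2 (Suc k)) + norm ((1 / \<beta>) *\<^sub>R grad_g ?y)"
        using norm_triangle_ineq4[of ?w ?x] norm_triangle_ineq4[of "?w - ?x" "e\<^sub>2 (Suc k)"]
          norm_triangle_ineq[of "?w - ?x - e\<^sub>2 (Suc k)" "(1 / \<beta>) *\<^sub>R grad_g ?y"] by linarith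
      have "norm ((1 / \<beta>) *\<^sub>R grad_g ?y) \<le> 1 / \<beta> * (norm (grad_g 0) + L * norm ?y)"
        using mult_left_mono[OF grad_growth[of ?y], of "1 / \<beta>"] \<beta> by simp
      also have "\<dots> \<le> q + 1 / 3 * norm ?y"
      proof -
        have "L / \<beta> * norm ?y \<le> 1 / 3 * norm ?y" using beta \<beta>
            by (intro mult_right_mono) (auto simp: field_simps)
        then show ?thesis unfolding q_def by (simp add: distrib_left)
      qed
      finally have gy: "norm ((1 / \<beta>) *\<^sub>R grad_g ?y) \<le> q + 1 / 3 * norm ?y" .
      have "n \<le> 3 / 2 * (r2 + r1 + E + q)" if "t \<le> q + 1 / 3 * n" "n \<le> w + m + e + t" "w \<le> r2" "m \<le> r1" "e \<le> E"
        for n t w m e :: real using that by simp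
      from this[OF gy y0 w1 x1 E(2)] have y1: "norm ?y \<le> r3" unfolding r3_def .
      have "norm ?\<gamma> \<le> \<beta> * E + norm (grad_g ?y)" by (rule gamma_le)
      also have "\<dots> \<le> r4" unfolding r4_def using grad_growth[of ?y] mult_left_mono[OF y1 L] by simp
      finally show ?thesis unfolding z_def using norm_Pair3_le[of ?x ?y ?\<gamma>] x1 y1 by linarith
    qed
    then show ?thesis by (rule that)
  qed

  \<comment> \<open>The graph of the augmented Lagrangian as a function of all three variables.\<close>
  define \<G> where "\<G> = {w :: ('v \<times> 'v \<times> 'v) \<times> real. \<exists>b. f (fst (fst w)) = ereal b \<and>
     snd w = b + g (fst (snd (fst w))) + coupling \<beta> (fst (fst w)) (fst (snd (fst w))) (snd (snd (fst w)))}"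
  have "definable {(u, t). f u = ereal t}"
    by (rule semialgebraic_imp_definable) (use f_semialgebraic in \<open>simp add: semialgebraic_fun_def\<close>)
  then have df: "definable {z. f (m z) = ereal (k z)}" if "polynomial_function m" "polynomial_function k"
    for m :: "'x::euclidean_space \<Rightarrow> 'v" and k
    using definable_vimage[OF _ poly_function_Pair[OF that]] by fastforce
  have "definable {(u, t). ereal (g u) = ereal t}"
    by (rule semialgebraic_imp_definable) (use g_semialgebraic in \<open>simp add: semialgebraic_fun_def\<close>)
  then have dg: "definable_fun g" unfolding definable_fun_def by (simp add: case_prod_unfold eq_commute)
  have def\<G>: "definable \<G>" unfolding \<G>_def coupling_def
    by (intro definable_ex definable_conj definable_eq df definable_fun_add definable_fun_vimage[OF dg]
       definable_fun_poly poly_function_intros)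
  define \<kappa> where "\<kappa> = (\<alpha> + \<beta>) / 2 + 1 / (2 * \<beta>)"
  have \<kappa>: "\<kappa> \<ge> 0" unfolding \<kappa>_def using alpha \<beta> by simp
  define V where "V k = (\<alpha> *\<^sub>R (x (Suc k) - x (Suc (Suc k))) + \<beta> *\<^sub>R (y (Suc (Suc k)) - y (Suc k))
        + (\<gamma> (Suc (Suc k)) - \<gamma> (Suc k)) + (\<alpha> + \<beta>) *\<^sub>R e\<^sub>1 (Suc (Suc k)),
      \<beta> *\<^sub>R e\<^sub>2 (Suc (Suc k)) + (\<gamma> (Suc (Suc k)) - \<gamma> (Suc k)), (1 / \<beta>) *\<^sub>R (\<gamma> (Suc (Suc k)) - \<gamma> (Suc k)))" for k
  have slope: "proximal_slope \<G> \<kappa> (z (Suc k)) (F (Suc k)) (V k)" for k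
    unfolding proximal_slope_def
  proof (intro conjI allI impI)
    show "(z (Suc k), F (Suc k)) \<in> \<G>" unfolding \<G>_def z_def F_def using fx[of "Suc k"] by simp
    fix w \<tau> assume w: "(w, \<tau>) \<in> \<G>"
    obtain u v q where wq: "w = (u, v, q)" by (cases w)
    from w obtain b where b: "f u = ereal b" "\<tau> = b + g v + coupling \<beta> u v q" unfolding \<G>_def wq by auto
    from admm_slope[OF alpha \<beta> c[of "Suc k", unfolded \<rho>_def] xmin[OF b(1), of "Suc k", unfolded \<rho>_def]
        gamma_step gmin, of v q]
    show "F (Suc k) + V k \<bullet> (w - z (Suc k)) - \<kappa> * ((w - z (Suc k)) \<bullet> (w - z (Suc k))) \<le> \<tau>"
      unfolding F_def V_def z_def wq b(2) \<kappa>_def by (simp add: add.assoc)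
  qed
  define B where "B = \<rho> + \<beta> + (2 + 1 / \<beta>) * (L + \<beta>)"
  have B: "B > 0" unfolding B_def using \<rho> \<beta> L by (intro add_pos_nonneg) auto
  have normV: "norm (V k) \<le> B * (d k + \<delta> k)" for k
  proof -
    let ?dx = "norm (x (Suc (Suc k)) - x (Suc k))" and ?dy = "norm (y (Suc (Suc k)) - y (Suc k))"
    let ?n1 = "norm (e\<^sub>1 (Suc (Suc k)))" and ?n2 = "norm (e\<^sub>2 (Suc (Suc k)))" and ?n3 = "norm (e\<^sub>2 (Suc k))"
    let ?D = "\<gamma> (Suc (Suc k)) - \<gamma> (Suc k)"
    have "?D = \<beta> *\<^sub>R e\<^sub>2 (Suc (Suc k)) - \<beta> *\<^sub>R e\<^sub>2 (Suc k) - (grad_g (y (Suc (Suc k))) - grad_g (y (Suc k)))"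
      unfolding grad_y by simp
    also have "norm \<dots> \<le> norm (\<beta> *\<^sub>R e\<^sub>2 (Suc (Suc k))) + norm (\<beta> *\<^sub>R e\<^sub>2 (Suc k)) + norm (grad_g (y (Suc (Suc k))) - grad_g (y (Suc k)))"
      by (intro order_trans[OF norm_triangle_ineq4] add_mono norm_triangle_ineq4 order_refl)
    finally have D1: "norm ?D \<le> L * ?dy + \<beta> * ?n2 + \<beta> * ?n3"
      using lip[of "y (Suc (Suc k))" "y (Suc k)"] \<beta> by simp
    have "L * ?dy \<le> L * (d k + \<delta> k)" unfolding d_def \<delta>_def using L by (intro mult_left_mono) auto
    moreover have "\<beta> * (?n2 + ?n3) \<le> \<beta> * (d k + \<delta> k)" unfolding d_def \<delta>_def using \<beta>
        by (intro mult_left_mono) auto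
    ultimately have D: "norm ?D \<le> (L + \<beta>) * (d k + \<delta> k)" using D1 by (simp add: distrib_left distrib_right)
    have "norm (V k) \<le> norm (fst (V k)) + norm (fst (snd (V k))) + norm (snd (snd (V k)))"
      using norm_Pair3_le[of "fst (V k)" "fst (snd (V k))" "snd (snd (V k))"] by simp
    also have "\<dots> \<le> (\<alpha> * ?dx + \<beta> * ?dy + norm ?D + (\<alpha> + \<beta>) * ?n1) + (\<beta> * ?n2 + norm ?D) + 1 / \<beta> * norm ?D"
    proof (intro add_mono)
      show "norm (fst (V k)) \<le> \<alpha> * ?dx + \<beta> * ?dy + norm ?D + (\<alpha> + \<beta>) * ?n1"
        unfolding V_def fst_conv using alpha \<beta>
        by (intro order_trans[OF norm_triangle_ineq] add_mono) (auto simp: norm_minus_commute)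
      show "norm (fst (snd (V k))) \<le> \<beta> * ?n2 + norm ?D"
        unfolding V_def fst_conv snd_conv using \<beta> by (intro order_trans[OF norm_triangle_ineq] add_mono) auto
      show "norm (snd (snd (V k))) \<le> 1 / \<beta> * norm ?D" unfolding V_def using \<beta> by simp
    qed
    also have "\<dots> = (\<alpha> * ?dx + \<beta> * ?dy + \<rho> * ?n1 + \<beta> * ?n2) + (2 + 1 / \<beta>) * norm ?D"
      unfolding \<rho>_def by (simp add: algebra_simps)
    also have "\<dots> \<le> (\<rho> + \<beta>) * (d k + \<delta> k) + (2 + 1 / \<beta>) * ((L + \<beta>) * (d k + \<delta> k))"
    proof (rule add_mono)
      show "(2 + 1 / \<beta>) * norm ?D \<le> (2 + 1 / \<beta>) * ((L + \<beta>) * (d k + \<delta> k))" using D \<beta>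
          by (intro mult_left_mono) auto
      have "\<alpha> * ?dx \<le> (\<rho> + \<beta>) * ?dx" "\<beta> * ?dy \<le> (\<rho> + \<beta>) * ?dy" "\<rho> * ?n1 \<le> (\<rho> + \<beta>) * ?n1"
           "\<beta> * ?n2 \<le> (\<rho> + \<beta>) * ?n2" "0 \<le> (\<rho> + \<beta>) * ?n3"
        using alpha \<beta> \<rho> unfolding \<rho>_def by (auto intro!: mult_right_mono)
      then show "\<alpha> * ?dx + \<beta> * ?dy + \<rho> * ?n1 + \<beta> * ?n2 \<le> (\<rho> + \<beta>) * (d k + \<delta> k)"
        unfolding d_def \<delta>_def distrib_left by linarith
    qed
    also have "\<dots> = B * (d k + \<delta> k)" unfolding B_def distrib_right[of "\<rho> + \<beta>"] mult.assoc ..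
    finally show ?thesis .
  qed
  have "summable d"
  proof (rule summable_of_descent_and_KL[OF s0 C0 p_gt_1 d0 \<delta>0])
    show "eventually (\<lambda>k. \<delta> k \<le> D * real k powr - p) sequentially"
      unfolding eventually_sequentially using \<delta>_le by blast
    show "eventually (\<lambda>k. F (Suc k) + s * (d k)\<^sup>2 \<le> F k + C * (\<delta> k)\<^sup>2) sequentially" using descent by simp
    show "eventually (\<lambda>k. A + G - \<beta> * E\<^sup>2 \<le> F k) sequentially" using below by simp
    fix l
    obtain c \<theta> \<eta> where kl: "0 < c" "0 < \<theta>" "\<theta> < 1" "0 < \<eta>"
      "\<And>z t V. norm z \<le> r \<Longrightarrow> l < t \<Longrightarrow> t < l + \<eta> \<Longrightarrow> proximal_slope \<G> \<kappa> z t V \<Longrightarrow> c * (t - l) powr \<theta> \<le> norm V"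
      using definable_Kurdyka_Lojasiewicz[OF def\<G> \<kappa>, of r l] by blast
    have "c / B * (F (Suc k) - l) powr \<theta> \<le> d k + \<delta> k" if "l < F (Suc k)" "F (Suc k) < l + \<eta>" "k \<ge> N" for k
    proof -
      have "c * (F (Suc k) - l) powr \<theta> \<le> B * (d k + \<delta> k)"
        using kl(5)[OF r[of "Suc k"] that(1,2) slope] normV[of k] that(3) by simp
      then show ?thesis using B by (simp add: field_simps)
    qed
    then have "eventually (\<lambda>k. l < F (Suc k) \<longrightarrow> F (Suc k) < l + \<eta> \<longrightarrow>
        c / B * (F (Suc k) - l) powr \<theta> \<le> d k + \<delta> k) sequentially"
      unfolding eventually_sequentially by blast
    then show "\<exists>c \<theta> \<eta>. 0 < c \<and> 0 < \<theta> \<and> \<theta> < 1 \<and> 0 < \<eta> \<and>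
        eventually (\<lambda>k. l < F (Suc k) \<longrightarrow> F (Suc k) < l + \<eta> \<longrightarrow> c * (F (Suc k) - l) powr \<theta> \<le> d k + \<delta> k) sequentially"
      using kl B by (intro exI[of _ "c / B"] exI[of _ \<theta>] exI[of _ \<eta>]) auto
  qed
  then show ?thesis
    unfolding d_def by (subst (asm) summable_Suc_iff[of "\<lambda>k. norm (x (Suc k) - x k) + norm (y (Suc k) - y k)"])
qed

theorem proposition5:
  fixes f :: "real ^ 'n \<Rightarrow> ereal"
    and g :: "real ^ 'n \<Rightarrow> real"
    and grad_g :: "real ^ 'n \<Rightarrow> real ^ 'n"
    and L\<^sub>g \<alpha> \<beta> \<sigma>\<^sub>0 p :: real
    and x y \<gamma> e\<^sub>1 e\<^sub>2 :: "nat \<Rightarrow> real ^ 'n"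
  assumes f_proper: "proper_fun f"
    and f_closed: "lower_semicontinuous f"
    and g_convex: "convex_on UNIV g"
    and g_gradient: "\<And>u. GDERIV g u :> grad_g u"
    and g_Lipschitz: "L\<^sub>g-lipschitz_on UNIV grad_g"
    and alpha: "\<alpha> > 0"
    and beta: "\<beta> > (2 * sqrt 2 + 1) * L\<^sub>g"
    and x_step: "\<And>k. x (Suc k) \<in> prox (\<lambda>u. f u / ereal (\<alpha> + \<beta>))
          ((\<alpha> / (\<alpha> + \<beta>)) *\<^sub>R x k - (\<beta> / (\<alpha> + \<beta>)) *\<^sub>R y k
             - (1 / (\<alpha> + \<beta>)) *\<^sub>R \<gamma> k + e\<^sub>1 (Suc k))"
    and y_step: "\<And>k. y (Suc k) \<in> prox (\<lambda>u. ereal (g u / \<beta>))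
          (- x (Suc k) - (1 / \<beta>) *\<^sub>R \<gamma> k + e\<^sub>2 (Suc k))"
    and gamma_step: "\<And>k. \<gamma> (Suc k) = \<gamma> k + \<beta> *\<^sub>R (x (Suc k) + y (Suc k))"
    and sigma_pos: "\<sigma>\<^sub>0 > 0"
    and g_bound: "(INF u. ereal (g u - \<sigma>\<^sub>0 * (norm (grad_g u))\<^sup>2)) > -\<infinity>"
    and beta_sigma: "\<beta> \<ge> 1 / \<sigma>\<^sub>0"
    and e2_bounded: "bounded (range e\<^sub>2)"
    and f_coercive: "coercive f"
    and f_semialgebraic: "semialgebraic_fun f"
    and g_semialgebraic: "semialgebraic_fun (\<lambda>u. ereal (g u))"
    and p_gt_1: "p > 1"
    and noise: "(\<lambda>k. norm (e\<^sub>1 k) + norm (e\<^sub>2 k)) \<in> O(\<lambda>k. 1 / real k powr p)"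
  shows "summable (\<lambda>k. norm (x (Suc k) - x k) + norm (y (Suc k) - y k))"
proof -
  have "0 \<le> L\<^sub>g" by (rule lipschitz_on_nonneg[OF g_Lipschitz])
  then have "3 * L\<^sub>g \<le> (2 * sqrt 2 + 1) * L\<^sub>g" by (intro mult_right_mono) auto
  then have "3 * L\<^sub>g \<le> \<beta>" using beta by simp
  then show ?thesis
    using inexact_admm_finite_length[OF f_proper g_convex g_gradient g_Lipschitz alpha _ x_step y_step gamma_step
        sigma_pos g_bound beta_sigma e2_bounded f_coercive f_semialgebraic g_semialgebraic p_gt_1 noise]
            by blast
qed

end
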